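(* Let $n\in\mathbb{N}=\{1,2,3,\dots\}$ and let $\Omega\subset\mathbb{H}^n$ be a domain of finite measure in the Heisenberg group $\mathbb{H}^n$ such that the embedding $S^1(\Omega)\subset L_2(\Omega)$ is compact. Let $L_\Omega^D$ and $L_\Omega^N$ be the Dirichlet and Neumann sub-Laplacians on $\Omega$. Then $\lambda_{j+1}(L_\Omega^N)<\lambda_j(L_\Omega^D)$ for every $j\in\mathbb{N}$.
   Context: As a set, the Heisenberg group $\mathbb{H}^n$ is $\mathbb{R}^{2n+1}$ with coordinates $(x_1,y_1,\dots,x_n,y_n,t)$; its Haar measure is Lebesgue measure. A domain is a non-empty open connected set. $L_2(\Omega)$ is the space of complex-valued functions on $\Omega$ that are square-integrable with respect to Lebesgue measure, with norm $\|\cdot\|$. The left-invariant vector fields used are $$X_j=\frac{\partial}{\partial x_j}+2y_j\frac{\partial}{\partial t},\qquad Y_j=\frac{\partial}{\partial y_j}-2x_j\frac{\partial}{\partial t},\qquad j=1,\dots,n,$$ and the sub-Laplacian is $-\sum_{j=1}^n(X_j^2+Y_j^2)$. $S^1(\Omega)$ is the space of all $u\in L_2(\Omega)$ whose distributional derivatives $X_ju$ and $Y_ju$, $j=1,\dots,n$, belong to $L_2(\Omega)$, with norm $\left(\sum_{j=1}^n(\|X_ju\|^2+\|Y_ju\|^2)+\|u\|^2\right)^{1/2}$. $\mathring{S}^1(\Omega)$ is the closure of $C_0^\infty(\Omega)$ in $S^1(\Omega)$. The Dirichlet sub-Laplacian $L_\Omega^D$ and the Neumann sub-Laplacian $L_\Omega^N$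 are the self-adjoint operators in $L_2(\Omega)$ associated with the quadratic form $\sum_{j=1}^n(\|X_ju\|^2+\|Y_ju\|^2)$ with form domain $\mathring{S}^1(\Omega)$ and $S^1(\Omega)$, respectively. For a lower semi-bounded self-adjoint operator $A$ with purely discrete spectrum, $\lambda_j(A)$, $j\in\mathbb{N}$, denotes its $j$-th eigenvalue in non-decreasing order, counting multiplicities. Under the compactness assumption both operators have purely discrete spectrum. *)

theory Defs
  imports "HOL-Analysis.Analysis"
begin

section \<open>The Heisenberg group and its horizontal vector fields\<close>

text \<open>
  A point of the Heisenberg group is written as \<open>(x, y, t)\<close>, where \<open>n = CARD('n) \<ge> 1\<close>. Compared with
  \<open>(x\<^sub>1, y\<^sub>1, \<dots>, x\<^sub>n, y\<^sub>n, t)\<close> the coordinates are only permuted, so Lebesgue measure is the same.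
\<close>

type_synonym 'n heis = "(real ^ 'n) \<times> (real ^ 'n) \<times> real"

definition partial_deriv :: "'a \<Rightarrow> ('a::euclidean_space \<Rightarrow> complex) \<Rightarrow> 'a \<Rightarrow> complex" where
  "partial_deriv b \<phi> p = frechet_derivative \<phi> (at p) b"

definition vf_X :: "'n::finite \<Rightarrow> ('n heis \<Rightarrow> complex) \<Rightarrow> 'n heis \<Rightarrow> complex" where
  "vf_X j \<phi> = (\<lambda>(x, y, t).
     partial_deriv (axis j 1, 0, 0) \<phi> (x, y, t)
       + of_real (2 * y $ j) * partial_deriv (0, 0, 1) \<phi> (x, y, t))"

definition vf_Y :: "'n::finite \<Rightarrow> ('n heis \<Rightarrow> complex) \<Rightarrow> 'n heis \<Rightarrow> complex" where
  "vf_Y j \<phi> = (\<lambda>(x, y, t).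
     partial_deriv (0, axis j 1, 0) \<phi> (x, y, t)
       - of_real (2 * x $ j) * partial_deriv (0, 0, 1) \<phi> (x, y, t))"


section \<open>Test functions\<close>

primrec C_k :: "nat \<Rightarrow> ('a::euclidean_space \<Rightarrow> complex) \<Rightarrow> bool" where
  "C_k 0 \<phi> \<longleftrightarrow> continuous_on UNIV \<phi>"
| "C_k (Suc k) \<phi> \<longleftrightarrow>
     (\<forall>p. \<phi> differentiable (at p)) \<and> (\<forall>b\<in>Basis. C_k k (partial_deriv b \<phi>))"

text \<open>Elements of \<open>C\<^sub>0\<^sup>\<infinity>(\<Omega>)\<close> are taken to be extended by zero to the whole space.\<close>

definition test_fun :: "'a::euclidean_space set \<Rightarrow> ('a \<Rightarrow> complex) set" where
  "test_fun \<Omega> = {\<phi>. (\<forall>k. C_k k \<phi>) \<and>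
     compact (closure {p. \<phi> p \<noteq> 0}) \<and> closure {p. \<phi> p \<noteq> 0} \<subseteq> \<Omega>}"


section \<open>Square-integrable functions\<close>

text \<open>
  Elements of \<open>L\<^sub>2(\<Omega>)\<close> are represented by functions of which only the values on \<open>\<Omega>\<close> matter. Functions
  that agree almost everywhere on \<open>\<Omega>\<close> represent the same element: all notions below that
  depend on the identity of elements (linear independence, span, operators) respect this.
\<close>

definition L2 :: "'a::euclidean_space set \<Rightarrow> ('a \<Rightarrow> complex) set" where
  "L2 \<Omega> = {u. u \<in> borel_measurable (lebesgue_on \<Omega>) \<and>
     integrable (lebesgue_on \<Omega>) (\<lambda>p. (norm (u p))\<^sup>2)}"

definition L2_inner ::
    "'a::euclidean_space set \<Rightarrow> ('a \<Rightarrow> complex) \<Rightarrow> ('a \<Rightarrow> complex) \<Rightarrow> complex" where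
  "L2_inner \<Omega> u v = (LINT p|lebesgue_on \<Omega>. u p * cnj (v p))"

definition L2_norm :: "'a::euclidean_space set \<Rightarrow> ('a \<Rightarrow> complex) \<Rightarrow> real" where
  "L2_norm \<Omega> u = sqrt (LINT p|lebesgue_on \<Omega>. (norm (u p))\<^sup>2)"

text \<open>\<open>E\<close> has dimension \<open>m\<close> as a subspace of \<open>L\<^sub>2(\<Omega>)\<close>, i.e. modulo equality almost everywhere.\<close>

definition L2_has_dim :: "'a::euclidean_space set \<Rightarrow> ('a \<Rightarrow> complex) set \<Rightarrow> nat \<Rightarrow> bool" where
  "L2_has_dim \<Omega> E m \<longleftrightarrow> (\<exists>e :: nat \<Rightarrow> 'a \<Rightarrow> complex.
     (\<forall>i<m. e i \<in> E) \<and>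
     (\<forall>c :: nat \<Rightarrow> complex.
        (AE p in lebesgue_on \<Omega>. (\<Sum>i<m. c i * e i p) = 0) \<longrightarrow> (\<forall>i<m. c i = 0)) \<and>
     (\<forall>u\<in>E. \<exists>c :: nat \<Rightarrow> complex. AE p in lebesgue_on \<Omega>. u p = (\<Sum>i<m. c i * e i p)))"


section \<open>The spaces \<open>S\<^sup>1\<close>\<close>

text \<open>
  The formal transposes of \<open>X\<^sub>j\<close> and \<open>Y\<^sub>j\<close> are \<open>- X\<^sub>j\<close> and \<open>- Y\<^sub>j\<close>, since the coefficient of
  \<open>\<partial>/\<partial>t\<close> does not depend on \<open>t\<close>.
\<close>

definition is_weak_X ::
    "'n::finite heis set \<Rightarrow> 'n \<Rightarrow> ('n heis \<Rightarrow> complex) \<Rightarrow> ('n heis \<Rightarrow> complex) \<Rightarrow> bool" where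
  "is_weak_X \<Omega> j u g \<longleftrightarrow> g \<in> L2 \<Omega> \<and> (\<forall>\<phi>\<in>test_fun \<Omega>.
     (LINT p|lebesgue_on \<Omega>. g p * \<phi> p) = - (LINT p|lebesgue_on \<Omega>. u p * vf_X j \<phi> p))"

definition is_weak_Y ::
    "'n::finite heis set \<Rightarrow> 'n \<Rightarrow> ('n heis \<Rightarrow> complex) \<Rightarrow> ('n heis \<Rightarrow> complex) \<Rightarrow> bool" where
  "is_weak_Y \<Omega> j u g \<longleftrightarrow> g \<in> L2 \<Omega> \<and> (\<forall>\<phi>\<in>test_fun \<Omega>.
     (LINT p|lebesgue_on \<Omega>. g p * \<phi> p) = - (LINT p|lebesgue_on \<Omega>. u p * vf_Y j \<phi> p))"

text \<open>Distributional derivatives are determined up to null sets; some representative is chosen.\<close>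

definition weak_X ::
    "'n::finite heis set \<Rightarrow> 'n \<Rightarrow> ('n heis \<Rightarrow> complex) \<Rightarrow> 'n heis \<Rightarrow> complex" where
  "weak_X \<Omega> j u = (SOME g. is_weak_X \<Omega> j u g)"

definition weak_Y ::
    "'n::finite heis set \<Rightarrow> 'n \<Rightarrow> ('n heis \<Rightarrow> complex) \<Rightarrow> 'n heis \<Rightarrow> complex" where
  "weak_Y \<Omega> j u = (SOME g. is_weak_Y \<Omega> j u g)"

definition S1 :: "'n::finite heis set \<Rightarrow> ('n heis \<Rightarrow> complex) set" where
  "S1 \<Omega> = {u \<in> L2 \<Omega>. \<forall>j. (\<exists>g. is_weak_X \<Omega> j u g) \<and> (\<exists>g. is_weak_Y \<Omega> j u g)}"

definition S1_norm :: "'n::finite heis set \<Rightarrow> ('n heis \<Rightarrow> complex) \<Rightarrow> real" where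
  "S1_norm \<Omega> u = sqrt
     ((\<Sum>j\<in>UNIV. (L2_norm \<Omega> (weak_X \<Omega> j u))\<^sup>2 + (L2_norm \<Omega> (weak_Y \<Omega> j u))\<^sup>2)
      + (L2_norm \<Omega> u)\<^sup>2)"

definition S1_0 :: "'n::finite heis set \<Rightarrow> ('n heis \<Rightarrow> complex) set" where
  "S1_0 \<Omega> = {u \<in> S1 \<Omega>. \<forall>\<epsilon>>0. \<exists>\<phi>\<in>test_fun \<Omega>. S1_norm \<Omega> (\<lambda>p. u p - \<phi> p) < \<epsilon>}"

definition compact_embedding :: "'n::finite heis set \<Rightarrow> bool" where
  "compact_embedding \<Omega> \<longleftrightarrow> (\<forall>u :: nat \<Rightarrow> 'n heis \<Rightarrow> complex.
     (\<forall>k. u k \<in> S1 \<Omega>) \<and> (\<exists>B. \<forall>k. S1_norm \<Omega> (u k) \<le> B) \<longrightarrow>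
     (\<exists>v\<in>L2 \<Omega>. \<exists>r :: nat \<Rightarrow> nat. strict_mono r \<and>
        (\<lambda>k. L2_norm \<Omega> (\<lambda>p. u (r k) p - v p)) \<longlonglongrightarrow> 0))"


section \<open>Operators associated with the quadratic form\<close>

text \<open>The sesquilinear form polarizing \<open>\<Sum>\<^sub>j (\<parallel>X\<^sub>j u\<parallel>\<^sup>2 + \<parallel>Y\<^sub>j u\<parallel>\<^sup>2)\<close>.\<close>

definition sub_form ::
    "'n::finite heis set \<Rightarrow> ('n heis \<Rightarrow> complex) \<Rightarrow> ('n heis \<Rightarrow> complex) \<Rightarrow> complex" where
  "sub_form \<Omega> u v =
     (\<Sum>j\<in>UNIV. L2_inner \<Omega> (weak_X \<Omega> j u) (weak_X \<Omega> j v)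
               + L2_inner \<Omega> (weak_Y \<Omega> j u) (weak_Y \<Omega> j v))"

text \<open>
  Operators in \<open>L\<^sub>2(\<Omega>)\<close> are given by their graphs. The operator associated with a form \<open>a\<close> with form
  domain \<open>V\<close> maps \<open>u\<close> to \<open>f\<close> iff \<open>u \<in> V\<close> and \<open>a(u, v) = \<langle>f, v\<rangle>\<close> for all \<open>v \<in> V\<close>.
\<close>

definition form_operator ::
    "'a::euclidean_space set \<Rightarrow> (('a \<Rightarrow> complex) \<Rightarrow> ('a \<Rightarrow> complex) \<Rightarrow> complex) \<Rightarrow>
     ('a \<Rightarrow> complex) set \<Rightarrow> (('a \<Rightarrow> complex) \<times> ('a \<Rightarrow> complex)) set" where
  "form_operator \<Omega> a V = {(u, f). u \<in> V \<and> f \<in> L2 \<Omega> \<and> (\<forall>v\<in>V. a u v = L2_inner \<Omega> f v)}"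

definition dirichlet_sublaplacian ::
    "'n::finite heis set \<Rightarrow> (('n heis \<Rightarrow> complex) \<times> ('n heis \<Rightarrow> complex)) set" where
  "dirichlet_sublaplacian \<Omega> = form_operator \<Omega> (sub_form \<Omega>) (S1_0 \<Omega>)"

definition neumann_sublaplacian ::
    "'n::finite heis set \<Rightarrow> (('n heis \<Rightarrow> complex) \<times> ('n heis \<Rightarrow> complex)) set" where
  "neumann_sublaplacian \<Omega> = form_operator \<Omega> (sub_form \<Omega>) (S1 \<Omega>)"


section \<open>Eigenvalues counted with multiplicities\<close>

definition eigenspace ::
    "(('a \<Rightarrow> complex) \<times> ('a \<Rightarrow> complex)) set \<Rightarrow> real \<Rightarrow> ('a \<Rightarrow> complex) set" where
  "eigenspace A \<mu> = {u. (u, \<lambda>p. of_real \<mu> * u p) \<in> A}"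

text \<open>
  \<open>l 1 \<le> l 2 \<le> \<dots>\<close> lists the eigenvalues of \<open>A\<close>, each real \<open>\<mu>\<close> occurring exactly as often as the
  dimension of its eigenspace (which is 0 if \<open>\<mu>\<close> is not an eigenvalue).
\<close>

definition eigenvalue_enumeration ::
    "'a::euclidean_space set \<Rightarrow> (('a \<Rightarrow> complex) \<times> ('a \<Rightarrow> complex)) set \<Rightarrow>
     (nat \<Rightarrow> real) \<Rightarrow> bool" where
  "eigenvalue_enumeration \<Omega> A l \<longleftrightarrow> mono_on {1..} l \<and>
     (\<forall>\<mu>. finite {k. k \<ge> 1 \<and> l k = \<mu>} \<and>
          L2_has_dim \<Omega> (eigenspace A \<mu>) (card {k. k \<ge> 1 \<and> l k = \<mu>}))"

text \<open>
  The \<open>j\<close>-th eigenvalue, \<open>j \<ge> 1\<close>. An enumeration is unique on \<open>{1..}\<close> if it exists, and it exists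
  for operators in an infinite-dimensional space that are self-adjoint, lower semi-bounded and
  have purely discrete spectrum.
\<close>

definition eigval ::
    "'a::euclidean_space set \<Rightarrow> (('a \<Rightarrow> complex) \<times> ('a \<Rightarrow> complex)) set \<Rightarrow> nat \<Rightarrow> real" where
  "eigval \<Omega> A j = (THE \<mu>. \<exists>l. eigenvalue_enumeration \<Omega> A l \<and> \<mu> = l j)"

end

theory Submission
  imports Defs "HOL-Probability.Probability" "HOL-Library.Function_Algebras"
begin

text \<open>
  Let \<open>\<mu>\<close> be the \<open>j\<close>-th Dirichlet eigenvalue; it is positive. For \<open>\<tau> = \<mu> / (4 n)\<close> the function
  \<open>exp (- \<tau> \<bar>z\<bar>\<^sup>2 + \<i> \<tau> t)\<close> and its left translates \<open>U\<^sub>w\<close>, which span the lowest Landau level, solve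
  the eigenvalue equation of the sub-Laplacian for \<open>\<mu>\<close> on the whole group. Hence
  \<open>a(d, U\<^sub>w) = \<mu> \<langle>d, U\<^sub>w\<rangle>\<close> for the quadratic form \<open>a\<close> and all \<open>d\<close> in the Dirichlet form domain. Averaging
  over \<open>w\<close> with a very flat Gaussian weight shows that \<open>a[U\<^sub>w] < \<mu> \<parallel>U\<^sub>w\<parallel>\<^sup>2\<close> for some \<open>w\<close>.

  Suppose that the \<open>(j + 1)\<close>-st Neumann eigenvalue is at least \<open>\<mu>\<close>. On the span of \<open>U\<^sub>w\<close> and the
  first \<open>j\<close> Dirichlet eigenfunctions, \<open>a[v] \<le> \<mu> \<parallel>v\<parallel>\<^sup>2\<close>; counting dimensions, this span contains some
  \<open>v \<noteq> 0\<close> orthogonal to all Neumann eigenfunctions with eigenvalue below \<open>\<mu>\<close>, so that also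
  \<open>a[v] \<ge> \<mu> \<parallel>v\<parallel>\<^sup>2\<close>. Equality forces \<open>v\<close> to lie in the Dirichlet form domain and to be a Neumann
  eigenfunction for \<open>\<mu>\<close>. Extend \<open>v\<close> by zero and test its equation against its dilates \<open>v \<circ> \<delta>\<^sub>s\<close>: as the
  form scales by \<open>s\<^sup>2\<close>, \<open>v\<close> is orthogonal to \<open>v \<circ> \<delta>\<^sub>s\<close> for \<open>s \<noteq> 1\<close>, and \<open>s \<rightarrow> 1\<close> gives \<open>v = 0\<close>.
\<close>

section \<open>Forms with compact embedding\<close>

text \<open>For the Laplacian in Euclidean space an exponential exp(i k x) with |k|^2 = \<mu> has
  energy density exactly \<mu> |U|^2 at every point. A Landau function has no such balance: with z
  the horizontal part of the point, its energy density minus \<mu> |U|^2 is 4 \<tau> (2 \<tau> |z -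
  w|^2 - n) exp(-2 \<tau> |z - w|^2), negative near w and positive far away, so w has to be adapted
  to \<Omega>. Integrated over all w this density gives zero, being a multiple of the Laplacian of a
  Gaussian; a constant weight therefore decides nothing, and the Gaussian weight tips the balance.
  The strict sign is essential: in the case of equality it removes U from the combination v, which
  leaves Dirichlet eigenfunctions only. A function that solves both problems is excluded by
  homogeneity instead of unique continuation. A dilate of v restricted to \<Omega> need not vanish
  at the boundary, but it is admissible because v satisfies the Neumann equation, whose test
  functions are all of \<open>S1\<close>; that v itself is in the Dirichlet form domain is what
  allows extending it by zero.\<close>

locale semi_inner = vector_space scale
  for scale :: "complex \<Rightarrow> 'v::ab_group_add \<Rightarrow> 'v" (infixr \<open>\<odot>\<close> 75) +
  fixes V :: "'v set" and ip :: "'v \<Rightarrow> 'v \<Rightarrow> complex"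
  assumes subspace_V: "subspace V"
    and ip_add: "\<lbrakk>u \<in> V; v \<in> V; w \<in> V\<rbrakk> \<Longrightarrow> ip (u + v) w = ip u w + ip v w"
    and ip_scale: "\<lbrakk>u \<in> V; w \<in> V\<rbrakk> \<Longrightarrow> ip (c \<odot> u) w = c * ip u w"
    and ip_cnj: "\<lbrakk>u \<in> V; w \<in> V\<rbrakk> \<Longrightarrow> ip w u = cnj (ip u w)"
    and ip_nonneg: "u \<in> V \<Longrightarrow> 0 \<le> Re (ip u u)"
begin

text \<open>Only a seminorm: functions that vanish almost everywhere are not divided out, and the
  shifted forms \<open>a - lam ip\<close> below are degenerate at minimizers. The calculus is
  therefore developed for semi-definite forms.\<close>

definition nrm :: "'v \<Rightarrow> real" where "nrm u = sqrt (Re (ip u u))"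

lemma V_add: "u \<in> V \<Longrightarrow> v \<in> V \<Longrightarrow> u + v \<in> V"
  and V_scale: "u \<in> V \<Longrightarrow> c \<odot> u \<in> V"
  and V_diff: "u \<in> V \<Longrightarrow> v \<in> V \<Longrightarrow> u - v \<in> V"
  and V_zero: "0 \<in> V"
  and V_sum: "(\<And>i. i \<in> A \<Longrightarrow> f i \<in> V) \<Longrightarrow> sum f A \<in> V"
  using subspace_add[OF subspace_V] subspace_scale[OF subspace_V] subspace_diff[OF subspace_V]
    subspace_0[OF subspace_V] subspace_sum[OF subspace_V, of A f] by auto

lemmas V_closed = V_add V_scale V_diff V_zero V_sum

lemma ip_zero [simp]: "w \<in> V \<Longrightarrow> ip 0 w = 0"
  using ip_scale[of 0 w 0] V_zero by simp

lemma ip_zero_right [simp]: "w \<in> V \<Longrightarrow> ip w 0 = 0"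
  using ip_cnj[of 0 w] V_zero by simp

lemma ip_diff: "\<lbrakk>u \<in> V; v \<in> V; w \<in> V\<rbrakk> \<Longrightarrow> ip (u - v) w = ip u w - ip v w"
  using ip_add[of "u - v" v w] V_diff by simp

lemma ip_add_right: "\<lbrakk>u \<in> V; v \<in> V; w \<in> V\<rbrakk> \<Longrightarrow> ip w (u + v) = ip w u + ip w v"
  using ip_add[of u v w] ip_cnj[of w "u+v"] ip_cnj[of w u] ip_cnj[of w v] V_add
  by (metis complex_cnj_add complex_cnj_cnj)

lemma ip_diff_right: "\<lbrakk>u \<in> V; v \<in> V; w \<in> V\<rbrakk> \<Longrightarrow> ip w (u - v) = ip w u - ip w v"
  using ip_add_right[of "u - v" v w] V_diff by simp

lemma ip_scale_right: "\<lbrakk>u \<in> V; w \<in> V\<rbrakk> \<Longrightarrow> ip w (c \<odot> u) = cnj c * ip w u"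
  using ip_scale[of u w c] ip_cnj[of "c \<odot> u" w] ip_cnj[of u w] V_scale by simp

lemma ip_sum: "\<lbrakk>\<And>i. i \<in> A \<Longrightarrow> f i \<in> V; w \<in> V\<rbrakk> \<Longrightarrow> ip (sum f A) w = (\<Sum>i\<in>A. ip (f i) w)"
proof (induction A rule: infinite_finite_induct)
  case (insert x F)
  then show ?case by (simp add: ip_add V_sum)
qed auto

lemma ip_sum_right: "\<lbrakk>\<And>i. i \<in> A \<Longrightarrow> f i \<in> V; w \<in> V\<rbrakk> \<Longrightarrow> ip w (sum f A) = (\<Sum>i\<in>A. ip w (f i))"
proof (induction A rule: infinite_finite_induct)
  case (insert x F)
  then show ?case by (simp add: ip_add_right V_sum)
qed auto

lemma ip_self: "u \<in> V \<Longrightarrow> ip u u = of_real (Re (ip u u))"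
  using ip_cnj[of u u] by (metis Reals_cnj_iff complex_is_Real_iff of_real_Re)

lemma nrm_nonneg [simp]: "u \<in> V \<Longrightarrow> 0 \<le> nrm u"
  by (simp add: nrm_def ip_nonneg)

lemma nrm_sq: "u \<in> V \<Longrightarrow> (nrm u)\<^sup>2 = Re (ip u u)"
  by (simp add: nrm_def ip_nonneg)

lemma nrm_scale: "u \<in> V \<Longrightarrow> nrm (c \<odot> u) = cmod c * nrm u"
proof -
  assume u: "u \<in> V"
  have "ip (c \<odot> u) (c \<odot> u) = (c * cnj c) * ip u u"
    using u by (simp add: ip_scale ip_scale_right V_scale)
  also have "\<dots> = of_real ((cmod c)\<^sup>2 * Re (ip u u))"
    using ip_self[OF u] complex_norm_square[of c] by (metis of_real_mult)
  finally show ?thesis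
    by (simp add: nrm_def real_sqrt_mult)
qed

text \<open>A non-zero \<open>v\<close> may have norm 0, so dividing by its norm is not possible in
  general. The squared norm of \<open>u - s z v\<close> is a quadratic polynomial in the real number
  \<open>s\<close>; \<open>s = 1/B\<close> gives the inequality when \<open>B > 0\<close>, and for
  \<open>B = 0\<close> the polynomial is affine, so a large \<open>s\<close> forces
  \<open>z = 0\<close>.\<close>

lemma cauchy_schwarz:
  assumes u: "u \<in> V" and v: "v \<in> V"
  shows "cmod (ip u v) \<le> nrm u * nrm v"
proof -
  define z where "z = ip u v"
  define A where "A = Re (ip u u)"
  define B where "B = Re (ip v v)"
  have exp: "0 \<le> A - 2 * s * (cmod z)\<^sup>2 + s\<^sup>2 * (cmod z)\<^sup>2 * B" for s :: real
  proof -
    let ?c = "of_real s * z"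
    have "ip (u - ?c \<odot> v) (u - ?c \<odot> v) =
        ip u u - cnj ?c * ip u v - ?c * ip v u + ?c * cnj ?c * ip v v"
      using u v by (simp add: ip_diff ip_diff_right ip_scale ip_scale_right V_scale V_diff algebra_simps)
    also have "\<dots> = of_real A - 2 * of_real s * (z * cnj z) + of_real (s\<^sup>2) * (z * cnj z) * of_real B"
      using ip_self[OF u] ip_self[OF v] ip_cnj[OF u v]
      by (simp add: A_def B_def z_def algebra_simps power2_eq_square)
    also have "\<dots> = of_real (A - 2 * s * (cmod z)\<^sup>2 + s\<^sup>2 * (cmod z)\<^sup>2 * B)"
      by (simp only: complex_norm_square [symmetric]) simp
    finally have "Re (ip (u - ?c \<odot> v) (u - ?c \<odot> v)) = A - 2 * s * (cmod z)\<^sup>2 + s\<^sup>2 * (cmod z)\<^sup>2 * B"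
      by (metis Re_complex_of_real)
    then show ?thesis using ip_nonneg[of "u - ?c \<odot> v"] u v by (simp add: V_diff V_scale)
  qed
  have AB: "A \<ge> 0" "B \<ge> 0" using u v by (simp_all add: A_def B_def ip_nonneg)
  have "(cmod z)\<^sup>2 \<le> A * B"
  proof (cases "B = 0")
    case True
    have "(cmod z)\<^sup>2 = 0"
    proof (rule ccontr)
      assume n: "(cmod z)\<^sup>2 \<noteq> 0"
      have "0 \<le> A - 2 * ((A+1) / (cmod z)\<^sup>2) * (cmod z)\<^sup>2"
        using exp[of "(A+1) / (cmod z)\<^sup>2"] True by simp
      then show False using n AB by simp
    qed
    then show ?thesis using True by simp
  next
    case False
    have "0 \<le> A - 2 * (1/B) * (cmod z)\<^sup>2 + (1/B)\<^sup>2 * (cmod z)\<^sup>2 * B" by (rule exp)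
    also have "\<dots> = A - (cmod z)\<^sup>2 / B" using False by (simp add: field_simps power2_eq_square)
    finally show ?thesis using False AB by (simp add: field_simps)
  qed
  then have "sqrt ((cmod z)\<^sup>2) \<le> sqrt (A * B)" by (rule real_sqrt_le_mono)
  then show ?thesis by (simp add: z_def nrm_def A_def B_def real_sqrt_mult)
qed

lemma nrm_add: 
  assumes u: "u \<in> V" and v: "v \<in> V"
  shows "nrm (u + v) \<le> nrm u + nrm v"
proof (rule power2_le_imp_le)
  have "Re (ip (u+v) (u+v)) = Re (ip u u) + Re (ip v v) + 2 * Re (ip u v)"
    using u v ip_cnj[OF u v] by (simp add: ip_add ip_add_right V_add)
  also have "Re (ip u v) \<le> nrm u * nrm v"
    using cauchy_schwarz[OF u v] complex_Re_le_cmod order_trans by blast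
  finally show "(nrm (u+v))\<^sup>2 \<le> (nrm u + nrm v)\<^sup>2"
    using u v by (simp add: nrm_sq V_add power2_sum)
qed (use u v in simp)

lemma nrm_minus_commute: "u \<in> V \<Longrightarrow> v \<in> V \<Longrightarrow> nrm (u - v) = nrm (v - u)"
  using nrm_scale[of "u - v" "-1"] by (simp add: V_diff)

lemma nrm_diff: "u \<in> V \<Longrightarrow> v \<in> V \<Longrightarrow> nrm (u - v) \<le> nrm u + nrm v"
  using nrm_add[of u "- v"] nrm_scale[of v "-1"] V_scale[of v "-1"] by simp

lemma nrm_triangle: "\<lbrakk>u \<in> V; v \<in> V; w \<in> V\<rbrakk> \<Longrightarrow> nrm (u - w) \<le> nrm (u - v) + nrm (v - w)"
  using nrm_add[of "u - v" "v - w"] by (simp add: V_diff)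

lemma nrm_le_add: "\<lbrakk>u \<in> V; v \<in> V\<rbrakk> \<Longrightarrow> nrm u \<le> nrm v + nrm (u - v)"
  using nrm_add[of v "u - v"] by (simp add: V_diff)

lemma nrm_zero [simp]: "nrm 0 = 0"
  by (simp add: nrm_def V_zero)

lemma nrm_tendsto:
  assumes "\<And>k. u k \<in> V" "v \<in> V" "(\<lambda>k. nrm (u k - v)) \<longlonglongrightarrow> 0"
  shows "(\<lambda>k. nrm (u k)) \<longlonglongrightarrow> nrm v"
proof (rule LIM_zero_cancel, rule tendsto_0_le[OF assms(3), of _ 1], rule always_eventually, rule allI)
  fix k
  show "norm (nrm (u k) - nrm v) \<le> norm (nrm (u k - v)) * 1"
    using nrm_le_add[of "u k" v] nrm_le_add[of v "u k"] nrm_minus_commute[of v "u k"] assms(1)[of k] assms(2)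
      nrm_nonneg[OF V_diff[OF assms(1)[of k] assms(2)]]
    by simp
qed

lemma ip_tendsto:
  assumes "\<And>k. u k \<in> V" "v \<in> V" "w \<in> V" "(\<lambda>k. nrm (u k - v)) \<longlonglongrightarrow> 0"
  shows "(\<lambda>k. ip (u k) w) \<longlonglongrightarrow> ip v w"
proof (rule LIM_zero_cancel, rule tendsto_0_le[OF assms(4), of _ "nrm w"], rule always_eventually, rule allI)
  fix k
  show "norm (ip (u k) w - ip v w) \<le> norm (nrm (u k - v)) * nrm w"
    using cauchy_schwarz[of "u k - v" w] assms by (simp add: ip_diff V_diff)
qed

lemma semi_inner_subspace: "subspace W \<Longrightarrow> W \<subseteq> V \<Longrightarrow> semi_inner scale W ip"
  by unfold_locales (auto simp: ip_add ip_scale ip_nonneg subset_iff intro: ip_cnj)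

end

text \<open>One spectral theorem for both boundary conditions. \<open>compact\<close> provides only
  an \<open>ip\<close>-Cauchy subsequence; a limit inside \<open>V\<close> comes from
  \<open>complete\<close>, once the subsequence is known to be Cauchy for \<open>a\<close> as well.
  \<open>infinite_dim\<close> keeps the construction of eigenvectors from stopping.\<close>

locale compact_form = semi_inner scale V ip
  for scale :: "complex \<Rightarrow> 'v::ab_group_add \<Rightarrow> 'v" (infixr \<open>\<odot>\<close> 75) and V ip +
  fixes a :: "'v \<Rightarrow> 'v \<Rightarrow> complex"
  assumes form: "semi_inner scale V a"
    and compact: "\<lbrakk>\<And>k. u k \<in> V; \<And>k::nat. Re (a (u k) (u k)) + Re (ip (u k) (u k)) \<le> B\<rbrakk> \<Longrightarrow>
      \<exists>r :: nat \<Rightarrow> nat. strict_mono r \<and> (\<forall>\<epsilon>>0. \<exists>N. \<forall>m\<ge>N. \<forall>n\<ge>N. Re (ip (u (r m) - u (r n)) (u (r m) - u (r n))) < \<epsilon>)"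
    and complete: "\<lbrakk>\<And>k. u k \<in> V; \<And>\<epsilon>. \<epsilon> > 0 \<Longrightarrow> \<exists>N. \<forall>m\<ge>N. \<forall>n\<ge>N. Re (a (u m - u n) (u m - u n)) < \<epsilon>
         \<and> Re (ip (u m - u n) (u m - u n)) < \<epsilon>\<rbrakk> \<Longrightarrow>
      \<exists>v\<in>V. (\<lambda>k. Re (a (u k - v) (u k - v))) \<longlonglongrightarrow> 0 \<and> (\<lambda>k. Re (ip (u k - v) (u k - v))) \<longlonglongrightarrow> 0"
    and infinite_dim: "\<exists>f :: nat \<Rightarrow> 'v. \<forall>i. f i \<in> V \<and> ip (f i) (f i) = 1 \<and> (\<forall>j. j \<noteq> i \<longrightarrow> ip (f i) (f j) = 0)"
begin

sublocale f: semi_inner scale V a by (rule form)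

definition orth :: "'v set \<Rightarrow> 'v set" where
  "orth E = {u \<in> V. \<forall>e\<in>E. ip u e = 0}"

lemma orth_subspace: "E \<subseteq> V \<Longrightarrow> subspace (orth E)"
  unfolding orth_def by (intro subspaceI) (auto simp: V_closed ip_add ip_scale)

lemma orth_shift: 
  assumes E: "E \<subseteq> V" and lam: "\<And>u. u \<in> orth E \<Longrightarrow> lam * Re (ip u u) \<le> Re (a u u)"
  shows "semi_inner scale (orth E) (\<lambda>u v. a u v - of_real lam * ip u v)"
proof unfold_locales
  show "subspace (orth E)" by (rule orth_subspace[OF E])
  fix u v assume uv: "u \<in> orth E" "v \<in> orth E"
  then have "u \<in> V" "v \<in> V" by (auto simp: orth_def)
  then show "a v u - of_real lam * ip v u = cnj (a u v - of_real lam * ip u v)"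
    using ip_cnj[of u v] f.ip_cnj[of u v] by simp
qed (use lam in \<open>auto simp: ip_add f.ip_add ip_scale f.ip_scale algebra_simps orth_def\<close>)

text \<open>A vector of \<open>orth E\<close> at which the lower bound is attained is an eigenvector, because the shifted
  form is semi-definite there and so the Cauchy-Schwarz inequality applies to it.\<close>

lemma orth_minimizer:
  assumes E: "E \<subseteq> V" and lam: "\<And>u. u \<in> orth E \<Longrightarrow> lam * Re (ip u u) \<le> Re (a u u)"
    and v: "v \<in> orth E" "Re (a v v) = lam * Re (ip v v)" and w: "w \<in> orth E"
  shows "a v w = of_real lam * ip v w"
proof -
  interpret q: semi_inner scale "orth E" "\<lambda>u v. a u v - of_real lam * ip u v"
    by (rule orth_shift[OF E lam])
  have "q.nrm v = 0" using v unfolding q.nrm_def by simp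
  then show ?thesis using q.cauchy_schwarz[OF v(1) w] by simp
qed

section \<open>Existence of an eigenbasis by successive minimization\<close>

definition orthonormal :: "'v set \<Rightarrow> bool" where
  "orthonormal E \<longleftrightarrow> E \<subseteq> V \<and> (\<forall>e\<in>E. \<forall>e'\<in>E. ip e e' = (if e = e' then 1 else 0))"

definition eigenvector :: "real \<Rightarrow> 'v \<Rightarrow> bool" where
  "eigenvector lam u \<longleftrightarrow> u \<in> V \<and> (\<forall>v\<in>V. a u v = of_real lam * ip u v)"

lemma orth_proj:
  assumes "finite E" "orthonormal E" "u \<in> V"
  shows "u - (\<Sum>e\<in>E. ip u e \<odot> e) \<in> orth E"
proof -
  have EV: "E \<subseteq> V" using assms by (simp add: orthonormal_def)
  have S: "(\<Sum>e\<in>E. ip u e \<odot> e) \<in> V" using EV by (auto intro!: V_sum V_scale)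
  have "ip (u - (\<Sum>e\<in>E. ip u e \<odot> e)) e' = 0" if e': "e' \<in> E" for e'
  proof -
    have "ip (u - (\<Sum>e\<in>E. ip u e \<odot> e)) e' = ip u e' - (\<Sum>e\<in>E. ip u e * ip e e')"
      using EV e' S assms by (subst ip_diff) (auto simp: ip_sum ip_scale V_scale subset_iff)
    also have "(\<Sum>e\<in>E. ip u e * ip e e') = (\<Sum>e\<in>E. if e = e' then ip u e else 0)"
      using assms(2) e' by (intro sum.cong) (auto simp: orthonormal_def)
    finally show ?thesis using assms(1) e' by simp
  qed
  then show ?thesis using assms S by (auto simp: orth_def V_diff)
qed

text \<open>Subtracting its projection puts a test vector into \<open>orth E\<close>. The projection
  contributes nothing on either side: \<open>a e v\<close> is a multiple of \<open>ip e v\<close>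
  because \<open>e\<close> is an eigenvector, and \<open>ip e v\<close> is 0.\<close>

lemma orth_eigenvector:
  assumes E: "finite E" "orthonormal E" "\<forall>e\<in>E. \<exists>l. eigenvector l e"
    and v: "v \<in> orth E" "\<And>w. w \<in> orth E \<Longrightarrow> a v w = of_real lam * ip v w"
  shows "eigenvector lam v"
  unfolding eigenvector_def
proof (intro conjI ballI)
  show vV: "v \<in> V" using v by (simp add: orth_def)
  fix u assume u: "u \<in> V"
  have EV: "E \<subseteq> V" using E by (simp add: orthonormal_def)
  let ?s = "\<Sum>e\<in>E. ip u e \<odot> e"
  have S: "?s \<in> V" using EV by (auto intro!: V_sum V_scale)
  have ve: "ip v e = 0" if "e \<in> E" for e using that v by (auto simp: orth_def)
  have ave: "a v e = 0" if e: "e \<in> E" for e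
  proof -
    obtain l where "eigenvector l e" using E e by blast
    then have "a e v = of_real l * ip e v" using vV by (simp add: eigenvector_def)
    also have "ip e v = 0" using ip_cnj[of v e] ve[OF e] e EV vV by auto
    finally show ?thesis using f.ip_cnj[of e v] e EV vV by auto
  qed
  have "a v ?s = 0" using EV vV ave by (subst f.ip_sum_right) (auto simp: f.ip_scale_right V_scale subset_iff intro!: sum.neutral)
  moreover have "ip v ?s = 0" using EV vV ve by (subst ip_sum_right) (auto simp: ip_scale_right V_scale subset_iff intro!: sum.neutral)
  moreover have "a v (u - ?s) = of_real lam * ip v (u - ?s)"
    using v orth_proj[OF E(1,2) u] by blast
  ultimately show "a v u = of_real lam * ip v u"
    using vV u S by (simp add: f.ip_diff_right ip_diff_right)
qed

lemma eigenvalue_nonneg: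
  assumes "eigenvector lam v" "Re (ip v v) > 0"
  shows "lam \<ge> 0"
proof -
  have "Re (a v v) = lam * Re (ip v v)" using assms by (auto simp: eigenvector_def)
  then show ?thesis using f.ip_nonneg[of v] assms by (auto simp: eigenvector_def zero_le_mult_iff)
qed

lemma orth_norm:
  assumes E: "finite E" "orthonormal E" and u: "u \<in> V"
  defines "r \<equiv> u - (\<Sum>e\<in>E. ip u e \<odot> e)"
  shows "Re (ip r r) = Re (ip u u) - (\<Sum>e\<in>E. (cmod (ip u e))\<^sup>2)"
proof -
  have EV: "E \<subseteq> V" using E by (simp add: orthonormal_def)
  let ?s = "\<Sum>e\<in>E. ip u e \<odot> e"
  have S: "?s \<in> V" using EV by (auto intro!: V_sum V_scale)
  have r: "r \<in> orth E" unfolding r_def by (rule orth_proj[OF E u])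
  then have rV: "r \<in> V" by (simp add: orth_def)
  have "ip r ?s = 0" using r EV rV
    by (subst ip_sum_right) (auto simp: ip_scale_right V_scale subset_iff orth_def intro!: sum.neutral)
  then have "ip r r = ip r u" using ip_diff_right[OF u S rV] r_def by simp
  also have "\<dots> = ip u u - (\<Sum>e\<in>E. ip u e * ip e u)"
    unfolding r_def using u S EV by (subst ip_diff) (auto simp: ip_sum ip_scale V_scale subset_iff)
  also have "(\<Sum>e\<in>E. ip u e * ip e u) = of_real (\<Sum>e\<in>E. (cmod (ip u e))\<^sup>2)"
    unfolding of_real_sum
  proof (rule sum.cong[OF refl])
    fix e assume "e \<in> E"
    then have "ip e u = cnj (ip u e)" using EV u by (intro ip_cnj) auto
    then show "ip u e * ip e u = complex_of_real ((cmod (ip u e))\<^sup>2)" by (simp only: complex_norm_square)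
  qed
  finally show ?thesis by simp
qed

lemma bessel:
  assumes "finite E" "orthonormal E" "u \<in> V"
  shows "(\<Sum>e\<in>E. (cmod (ip u e))\<^sup>2) \<le> Re (ip u u)"
  using orth_norm[OF assms] ip_nonneg[of "u - (\<Sum>e\<in>E. ip u e \<odot> e)"] orth_proj[OF assms]
  by (simp add: orth_def)

text \<open>A dimension count by Bessel's inequality. If \<open>orth E\<close> held null vectors
  only, each of \<open>card E + 1\<close> orthonormal vectors would have all its mass in
  \<open>E\<close>; summing the squared coefficients in the other order bounds
  \<open>card E + 1\<close> by \<open>card E\<close>.\<close>

lemma orth_nontrivial:
  assumes E: "finite E" "orthonormal E"
  shows "\<exists>u\<in>orth E. ip u u \<noteq> 0"
proof (rule ccontr)
  assume "\<not> ?thesis"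
  then have null: "ip u u = 0" if "u \<in> orth E" for u using that by blast
  obtain f :: "nat \<Rightarrow> 'v" where f: "\<And>i. f i \<in> V" "\<And>i. ip (f i) (f i) = 1" "\<And>i j. j \<noteq> i \<Longrightarrow> ip (f i) (f j) = 0"
    using infinite_dim by blast
  have inj: "inj f" 
    by (rule injI) (metis f(2,3) zero_neq_one)
  define F where "F = f ` {.. card E}"
  have "ip (f i) (f j) = (if f i = f j then 1 else 0)" for i j
    by (metis f(2,3))
  then have F: "orthonormal F" "finite F" "card F = Suc (card E)"
    using f inj by (auto simp: F_def orthonormal_def card_image inj_on_subset)
  have EV: "E \<subseteq> V" using E by (simp add: orthonormal_def)
  have FV: "F \<subseteq> V" using F by (simp add: orthonormal_def)
  have "real (card F) = (\<Sum>g\<in>F. \<Sum>e\<in>E. (cmod (ip g e))\<^sup>2)"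
  proof -
    have "(\<Sum>e\<in>E. (cmod (ip g e))\<^sup>2) = 1" if g: "g \<in> F" for g
      using orth_norm[OF E, of g] null[OF orth_proj[OF E, of g]] g FV F(1) by (auto simp: orthonormal_def)
    then show ?thesis by simp
  qed
  also have "\<dots> = (\<Sum>e\<in>E. \<Sum>g\<in>F. (cmod (ip e g))\<^sup>2)"
  proof (subst sum.swap, intro sum.cong refl)
    fix e g assume "e \<in> E" "g \<in> F"
    then have "ip e g = cnj (ip g e)" using EV FV by (intro ip_cnj) auto
    then show "(cmod (ip g e))\<^sup>2 = (cmod (ip e g))\<^sup>2" by simp
  qed
  also have "\<dots> \<le> (\<Sum>e\<in>E. Re (ip e e))" using bessel[OF F(2,1)] EV by (intro sum_mono) auto
  also have "\<dots> = real (card E)" using E(2) by (simp add: orthonormal_def)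
  finally show False using F(3) by simp
qed

text \<open>The direct method applied to the Rayleigh quotient on \<open>orth E\<close>. A
  minimizing sequence has an \<open>ip\<close>-Cauchy subsequence. In the seminorm of
  \<open>a - lam ip\<close> the sequence itself tends to 0, so \<open>a\<close> of a difference is
  at most a small number plus \<open>lam\<close> times \<open>ip\<close> of it; the subsequence is
  thus Cauchy for \<open>a\<close>, and no weak limits are involved.\<close>

lemma next_eigenvector:
  assumes E: "finite E" "orthonormal E" "\<forall>e\<in>E. \<exists>l. eigenvector l e"
  shows "\<exists>v lam. eigenvector lam v \<and> v \<in> orth E \<and> ip v v = 1
    \<and> (\<forall>u\<in>orth E. lam * Re (ip u u) \<le> Re (a u u))"
proof -
  have EV: "E \<subseteq> V" using E by (simp add: orthonormal_def)
  have oV: "orth E \<subseteq> V" by (auto simp: orth_def)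
  have osc: "c \<odot> u \<in> orth E" if "u \<in> orth E" for c u
    using subspace_scale[OF orth_subspace[OF EV] that] .
  have odiff: "u - w \<in> orth E" if "u \<in> orth E" "w \<in> orth E" for u w
    using subspace_diff[OF orth_subspace[OF EV] that] .
  define R where "R = (\<lambda>u. Re (a u u)) ` {u \<in> orth E. ip u u = 1}"
  have normalize: "\<exists>w\<in>orth E. ip w w = 1 \<and> Re (a w w) * Re (ip u u) = Re (a u u)"
    if u: "u \<in> orth E" "ip u u \<noteq> 0" for u
  proof -
    have uV: "u \<in> V" using u oV by auto
    have pos: "Re (ip u u) > 0" using ip_nonneg[OF uV] ip_self[OF uV] u(2) by (metis less_eq_real_def of_real_0)
    define c where "c = complex_of_real (1 / nrm u)"
    have n: "nrm u > 0" using pos by (simp add: nrm_def)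
    have cc: "c * cnj c * of_real (Re (ip u u)) = 1"
      unfolding c_def using n nrm_sq[OF uV, symmetric] by (simp add: power2_eq_square field_simps)
    have 1: "ip (c \<odot> u) (c \<odot> u) = 1"
      using uV cc ip_self[OF uV] by (simp add: ip_scale ip_scale_right V_scale algebra_simps)
    have "a (c \<odot> u) (c \<odot> u) * of_real (Re (ip u u)) = (c * cnj c * of_real (Re (ip u u))) * a u u"
      using uV by (simp add: f.ip_scale f.ip_scale_right V_scale)
    then have 2: "a (c \<odot> u) (c \<odot> u) * of_real (Re (ip u u)) = a u u" using cc by simp
    have "Re (a (c \<odot> u) (c \<odot> u)) * Re (ip u u) = Re (a u u)"
      using arg_cong[OF 2, of Re] by simp
    then show ?thesis using 1 osc[OF u(1)] by blast
  qed
  obtain u0 where "u0 \<in> orth E" "ip u0 u0 \<noteq> 0" using orth_nontrivial[OF E(1,2)] by blast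
  then have Rne: "R \<noteq> {}" using normalize unfolding R_def by blast
  have Rb: "bdd_below R" unfolding R_def using oV f.ip_nonneg by (intro bdd_belowI[of _ 0]) auto
  define lam where "lam = Inf R"
  have lam0: "lam \<ge> 0" unfolding lam_def using oV f.ip_nonneg by (intro cInf_greatest[OF Rne]) (auto simp: R_def)
  have low: "lam * Re (ip u u) \<le> Re (a u u)" if u: "u \<in> orth E" for u
  proof (cases "ip u u = 0")
    case True
    then show ?thesis using f.ip_nonneg u oV by auto
  next
    case False
    obtain w where w: "w \<in> orth E" "ip w w = 1" "Re (a w w) * Re (ip u u) = Re (a u u)"
      using normalize[OF u False] by blast
    have "lam \<le> Re (a w w)" unfolding lam_def using w by (intro cInf_lower Rb) (auto simp: R_def)
    then show ?thesis using w(3) ip_nonneg[of u] u oV by (metis mult_right_mono subsetD)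
  qed
  interpret q: semi_inner scale "orth E" "\<lambda>u v. a u v - of_real lam * ip u v"
    by (rule orth_shift[OF EV low])
  have "\<exists>u. u \<in> orth E \<and> ip u u = 1 \<and> Re (a u u) < lam + 1 / real (Suc k)" for k
  proof -
    have "\<exists>x\<in>R. x < lam + 1 / real (Suc k)"
      unfolding lam_def using cInf_lessD[OF Rne, of "Inf R + 1 / real (Suc k)"] by auto
    then show ?thesis unfolding R_def by auto
  qed
  then obtain u where u: "\<And>k. u k \<in> orth E" "\<And>k. ip (u k) (u k) = 1"
    "\<And>k. Re (a (u k) (u k)) < lam + 1 / real (Suc k)" by metis
  have uV: "u k \<in> V" for k using u(1) oV by blast
  have bound: "Re (a (u k) (u k)) + Re (ip (u k) (u k)) \<le> lam + 2" for k
  proof -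
    have "1 / real (Suc k) \<le> 1" by simp
    moreover have "Re (ip (u k) (u k)) = 1" using u(2)[of k] by simp
    ultimately show ?thesis using u(3)[of k] by linarith
  qed
  have "\<exists>r :: nat \<Rightarrow> nat. strict_mono r \<and> (\<forall>\<epsilon>>0. \<exists>N. \<forall>m\<ge>N. \<forall>n\<ge>N.
      Re (ip (u (r m) - u (r n)) (u (r m) - u (r n))) < \<epsilon>)"
    by (rule compact[OF uV bound])
  then obtain r :: "nat \<Rightarrow> nat" where r: "strict_mono r" and
    rc: "\<forall>\<epsilon>>0. \<exists>N. \<forall>m\<ge>N. \<forall>n\<ge>N. Re (ip (u (r m) - u (r n)) (u (r m) - u (r n))) < \<epsilon>"
    by (elim exE conjE)
  have qn: "(q.nrm x)\<^sup>2 = Re (a x x) - lam * Re (ip x x)" if "x \<in> orth E" for x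
    using q.nrm_sq[OF that] by simp
  have "(\<lambda>k. (q.nrm (u k))\<^sup>2) \<longlonglongrightarrow> 0"
  proof (rule tendsto_sandwich[OF _ _ tendsto_const LIMSEQ_inverse_real_of_nat])
    show "\<forall>\<^sub>F k in sequentially. (q.nrm (u k))\<^sup>2 \<le> inverse (real (Suc k))"
    proof (intro always_eventually allI)
      fix k
      have "Re (ip (u k) (u k)) = 1" using u(2) by simp
      then show "(q.nrm (u k))\<^sup>2 \<le> inverse (real (Suc k))"
        using u(3)[of k] qn[OF u(1), of k] by (simp only: inverse_eq_divide mult_1_right)
    qed
  qed simp
  then have "(\<lambda>k. sqrt ((q.nrm (u k))\<^sup>2)) \<longlonglongrightarrow> sqrt 0" by (rule tendsto_real_sqrt)
  then have q0: "(\<lambda>k. q.nrm (u k)) \<longlonglongrightarrow> 0" using q.nrm_nonneg[OF u(1)] by simp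
  then have qr: "(\<lambda>k. q.nrm (u (r k))) \<longlonglongrightarrow> 0"
    using LIMSEQ_subseq_LIMSEQ[OF q0 r] by (simp add: o_def)
  have cauchy: "\<exists>N. \<forall>m\<ge>N. \<forall>n\<ge>N. Re (a (u (r m) - u (r n)) (u (r m) - u (r n))) < \<epsilon>
         \<and> Re (ip (u (r m) - u (r n)) (u (r m) - u (r n))) < \<epsilon>" if \<epsilon>: "\<epsilon> > 0" for \<epsilon>
  proof -
    \<comment> \<open>Makes both \<delta> and \<open>lam * \<delta>\<close> at most half of
      \<epsilon>; the summand 1 covers \<open>lam = 0\<close>.\<close>
    define \<delta> where "\<delta> = \<epsilon> / (2 * (lam + 1))"
    have \<delta>: "\<delta> > 0" "\<delta> \<le> \<epsilon> / 2" "lam * \<delta> \<le> \<epsilon> / 2"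
      using \<epsilon> lam0 by (auto simp: \<delta>_def field_simps)
    obtain N1 where N1: "\<And>m n. m \<ge> N1 \<Longrightarrow> n \<ge> N1 \<Longrightarrow> Re (ip (u (r m) - u (r n)) (u (r m) - u (r n))) < \<delta>"
      using rc \<delta>(1) by meson
    have "\<forall>\<^sub>F k in sequentially. q.nrm (u (r k)) < sqrt (\<epsilon>/2) / 2"
      using \<epsilon> by (intro order_tendstoD(2)[OF qr]) simp
    then obtain N2 where N2: "\<And>k. k \<ge> N2 \<Longrightarrow> q.nrm (u (r k)) < sqrt (\<epsilon>/2) / 2"
      by (auto simp: eventually_sequentially)
    have "Re (a (u (r m) - u (r n)) (u (r m) - u (r n))) < \<epsilon>
         \<and> Re (ip (u (r m) - u (r n)) (u (r m) - u (r n))) < \<epsilon>" if mn: "m \<ge> max N1 N2" "n \<ge> max N1 N2" for m n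
    proof -
      let ?d = "u (r m) - u (r n)"
      have d: "?d \<in> orth E" using odiff u by blast
      have ip: "Re (ip ?d ?d) < \<delta>" using N1 mn by simp
      have "q.nrm ?d \<le> q.nrm (u (r m)) + q.nrm (u (r n))" by (rule q.nrm_diff[OF u(1) u(1)])
      also have "\<dots> < sqrt (\<epsilon>/2)" using N2[of m] N2[of n] mn by simp
      finally have "(q.nrm ?d)\<^sup>2 < (sqrt (\<epsilon>/2))\<^sup>2" using q.nrm_nonneg[OF d] by (intro power_strict_mono) auto
      then have "Re (a ?d ?d) - lam * Re (ip ?d ?d) < \<epsilon> / 2" using qn[OF d] \<epsilon> by simp
      moreover have "lam * Re (ip ?d ?d) \<le> lam * \<delta>" using ip lam0 by (intro mult_left_mono) auto
      ultimately show ?thesis using \<delta> ip \<epsilon> by linarith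
    qed
    then show ?thesis by blast
  qed
  obtain v where v: "v \<in> V" "(\<lambda>k. Re (a (u (r k) - v) (u (r k) - v))) \<longlonglongrightarrow> 0"
    "(\<lambda>k. Re (ip (u (r k) - v) (u (r k) - v))) \<longlonglongrightarrow> 0"
    using complete[of "\<lambda>k. u (r k)", OF uV cauchy] by blast
  have nv: "(\<lambda>k. nrm (u (r k) - v)) \<longlonglongrightarrow> 0"
    using tendsto_real_sqrt[OF v(3)] by (simp add: nrm_def)
  have vo: "v \<in> orth E"
  proof -
    have "ip v e = 0" if e: "e \<in> E" for e
    proof -
      have "(\<lambda>k. ip (u (r k)) e) \<longlonglongrightarrow> ip v e" using e EV by (intro ip_tendsto nv uV v(1)) auto
      moreover have "(\<lambda>k. ip (u (r k)) e) = (\<lambda>k. 0)" using u(1) e by (auto simp: orth_def)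
      ultimately show ?thesis by (simp add: LIMSEQ_const_iff)
    qed
    then show ?thesis using v(1) by (simp add: orth_def)
  qed
  have "(\<lambda>k. nrm (u (r k))) \<longlonglongrightarrow> nrm v" by (rule nrm_tendsto[OF uV v(1) nv])
  moreover have "(\<lambda>k. nrm (u (r k))) = (\<lambda>k. 1)" using u(2) by (simp add: nrm_def)
  ultimately have "nrm v = 1" by (simp add: LIMSEQ_const_iff)
  then have v1: "ip v v = 1" using nrm_sq[OF v(1)] ip_self[OF v(1)] by (metis of_real_1 power_one)
  have "(\<lambda>k. (q.nrm (u (r k) - v))\<^sup>2) \<longlonglongrightarrow> 0"
  proof (rule tendsto_sandwich[OF _ _ tendsto_const v(2)])
    show "\<forall>\<^sub>F k in sequentially. (q.nrm (u (r k) - v))\<^sup>2 \<le> Re (a (u (r k) - v) (u (r k) - v))"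
      using qn[OF odiff[OF u(1) vo]] lam0 ip_nonneg[OF V_diff[OF uV v(1)]]
      by (intro always_eventually allI) simp
  qed simp
  then have "(\<lambda>k. sqrt ((q.nrm (u (r k) - v))\<^sup>2)) \<longlonglongrightarrow> sqrt 0" by (rule tendsto_real_sqrt)
  then have "(\<lambda>k. q.nrm (u (r k) - v)) \<longlonglongrightarrow> 0" using q.nrm_nonneg[OF odiff[OF u(1) vo]] by simp
  then have "(\<lambda>k. q.nrm (u (r k))) \<longlonglongrightarrow> q.nrm v" using u(1) vo by (intro q.nrm_tendsto) auto
  then have "q.nrm v = 0" using qr LIMSEQ_unique by blast
  then have "Re (a v v) = lam * Re (ip v v)" using qn[OF vo] by simp
  then have "eigenvector lam v"
    by (intro orth_eigenvector[OF E vo]) (rule orth_minimizer[OF EV low vo])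
  then show ?thesis using vo v1 low by blast
qed

text \<open>The last clause keeps the variational meaning of the construction: \<open>l k\<close>
  bounds the form from below on the orthogonal complement of the first \<open>k\<close> vectors.
  Together with the divergence of \<open>l\<close> it takes the place of a completeness statement
  for \<open>e\<close>. Numbering starts at 0.\<close>

definition eigenbasis :: "(nat \<Rightarrow> 'v) \<Rightarrow> (nat \<Rightarrow> real) \<Rightarrow> bool" where
  "eigenbasis e l \<longleftrightarrow> (\<forall>i. eigenvector (l i) (e i)) \<and> (\<forall>i j. ip (e i) (e j) = (if i = j then 1 else 0)) \<and>
     mono l \<and> filterlim l at_top at_top \<and>
     (\<forall>k. \<forall>u\<in>V. (\<forall>i<k. ip u (e i) = 0) \<longrightarrow> l k * Re (ip u u) \<le> Re (a u u))"

theorem eigenbasis_exists: "\<exists>e l. eigenbasis e l"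
proof -
  define good where "good = (\<lambda>E. finite E \<and> orthonormal E \<and> (\<forall>e\<in>E. \<exists>l. eigenvector l e))"
  define next_ev where "next_ev = (\<lambda>E v lam. eigenvector lam v \<and> v \<in> orth E \<and> ip v v = 1
    \<and> (\<forall>u\<in>orth E. lam * Re (ip u u) \<le> Re (a u u)))"
  have "\<exists>p. good E \<longrightarrow> next_ev E (fst p) (snd p)" for E
    using next_eigenvector[of E] by (auto simp: good_def next_ev_def)
  then obtain pick where pick: "\<And>E. good E \<Longrightarrow> next_ev E (fst (pick E)) (snd (pick E))" by metis
  \<comment> \<open>\<open>S k\<close> collects the first \<open>k\<close> choices, so every new
    eigenvector minimizes over the complement of its predecessors and the values \<open>l k\<close>
    come out in non-decreasing order.\<close>
  define S where "S = rec_nat {} (\<lambda>_ E. insert (fst (pick E)) E)"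
  define e where "e k = fst (pick (S k))" for k
  define l where "l k = snd (pick (S k))" for k
  have S0: "S 0 = {}" and SSuc: "S (Suc k) = insert (e k) (S k)" for k
    by (simp_all add: S_def e_def)
  have S: "S k = e ` {..<k}" for k
    by (induction k) (auto simp: S0 SSuc lessThan_Suc)
  have good: "good (S k)" for k
  proof (induction k)
    case 0
    then show ?case by (simp add: good_def S0 orthonormal_def)
  next
    case (Suc k)
    then have n: "next_ev (S k) (e k) (l k)" using pick by (simp add: e_def l_def)
    then have eV: "e k \<in> V" "\<And>x. x \<in> S k \<Longrightarrow> ip (e k) x = 0" "ip (e k) (e k) = 1"
      by (auto simp: next_ev_def orth_def)
    have "ip x (e k) = 0" if "x \<in> S k" for x
      using ip_cnj[OF eV(1), of x] eV(2)[OF that] that Suc by (auto simp: good_def orthonormal_def)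
    then have "orthonormal (S (Suc k))" using Suc eV unfolding SSuc orthonormal_def good_def
      by (metis (no_types, lifting) insert_iff insert_subset zero_neq_one)
    then show ?case using Suc n by (auto simp: good_def SSuc next_ev_def)
  qed
  have n: "next_ev (S k) (e k) (l k)" for k using pick[OF good] by (simp add: e_def l_def)
  have eV: "e k \<in> V" for k using n by (auto simp: next_ev_def orth_def)
  have lt: "ip (e k) (e i) = 0" if "i < k" for i k
    using n[of k] that by (auto simp: next_ev_def orth_def S)
  have on: "ip (e i) (e j) = (if i = j then 1 else 0)" for i j
  proof (cases i j rule: linorder_cases)
    case less
    then show ?thesis using lt ip_cnj[OF eV eV, of j i] by simp
  next
    case greater
    then show ?thesis using lt by simp
  next
    case equal
    then show ?thesis using n by (auto simp: next_ev_def)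
  qed
  have ev: "eigenvector (l i) (e i)" for i using n by (auto simp: next_ev_def)
  have low: "l k * Re (ip u u) \<le> Re (a u u)" if "u \<in> V" "\<forall>i<k. ip u (e i) = 0" for k u
    using n[of k] that by (auto simp: next_ev_def orth_def S)
  have ae: "Re (a (e k) (e k)) = l k" for k using ev on eV by (simp add: eigenvector_def)
  have mono: "mono l"
  proof (rule incseq_SucI)
    fix k show "l k \<le> l (Suc k)"
      using low[OF eV, of k "Suc k"] on ae by simp
  qed
  \<comment> \<open>Were \<open>l\<close> bounded, the orthonormal sequence \<open>e\<close> would
    be bounded in the form norm and have a Cauchy subsequence, although any two of its members have
    squared distance 2.\<close>
  have "\<exists>k. Z \<le> l k" for Z
  proof (rule ccontr)
    assume "\<not> ?thesis"
    then have "Re (a (e k) (e k)) + Re (ip (e k) (e k)) \<le> Z + 1" for k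
      using ae on by (simp add: not_le less_imp_le)
    then obtain r :: "nat \<Rightarrow> nat" where r: "strict_mono r"
      "\<exists>N. \<forall>m\<ge>N. \<forall>n\<ge>N. Re (ip (e (r m) - e (r n)) (e (r m) - e (r n))) < 1"
      using compact[of e "Z + 1", OF eV] zero_less_one by blast
    then obtain N where N: "Re (ip (e (r N) - e (r (Suc N))) (e (r N) - e (r (Suc N)))) < 1" by (meson le_refl le_SucI)
    have "r N \<noteq> r (Suc N)" using strict_monoD[OF r(1), of N "Suc N"] by simp
    then show False using N by (simp add: ip_diff ip_diff_right eV V_diff on)
  qed
  then have "filterlim l at_top at_top"
    using mono unfolding filterlim_at_top eventually_sequentially by (meson monoD order_trans)
  then show ?thesis using ev on mono low unfolding eigenbasis_def by blast
qed

lemma eigenvalue_finite: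
  assumes "eigenbasis e l"
  shows "finite {k. l k = \<mu>}"
proof -
  have "eventually (\<lambda>k. \<mu> + 1 \<le> l k) sequentially"
    using assms by (auto simp: eigenbasis_def filterlim_at_top)
  then obtain N where "\<And>k. k \<ge> N \<Longrightarrow> \<mu> + 1 \<le> l k" by (auto simp: eventually_sequentially)
  then have "{k. l k = \<mu>} \<subseteq> {..<N}" by (force simp: not_less[symmetric])
  then show ?thesis using finite_subset by blast
qed

text \<open>The remainder satisfies the eigenvalue equation for \<mu> and is orthogonal to every
  \<open>e k\<close>: to those with \<open>l k = \<mu>\<close> by subtraction, to the others because
  the form is Hermitian. Hence \<open>l k\<close> times its squared norm stays below
  \<open>a r r\<close> for all \<open>k\<close>, which is absurd for a non-null vector as
  \<open>l\<close> diverges.\<close>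

lemma eigenspace_expansion:
  assumes b: "eigenbasis e l" and u: "eigenvector \<mu> u"
  defines "r \<equiv> u - (\<Sum>k | l k = \<mu>. ip u (e k) \<odot> e k)"
  shows "ip r r = 0"
proof -
  note fin = eigenvalue_finite[OF b, of \<mu>]
  have eV: "e k \<in> V" for k using b by (auto simp: eigenbasis_def eigenvector_def)
  have on: "ip (e i) (e j) = (if i = j then 1 else 0)" for i j using b by (auto simp: eigenbasis_def)
  have uV: "u \<in> V" using u by (simp add: eigenvector_def)
  let ?s = "\<Sum>k | l k = \<mu>. ip u (e k) \<odot> e k"
  have S: "?s \<in> V" using eV by (auto intro!: V_sum V_scale)
  have rV: "r \<in> V" unfolding r_def using S uV by (rule V_diff[rotated])
  have ak: "a (e k) v = of_real (l k) * ip (e k) v" if "v \<in> V" for k v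
    using b that by (simp add: eigenbasis_def eigenvector_def)
  have ar: "a r v = of_real \<mu> * ip r v" if v: "v \<in> V" for v
  proof -
    have "a r v = a u v - (\<Sum>k | l k = \<mu>. ip u (e k) * a (e k) v)"
      unfolding r_def using uV S v eV by (simp add: f.ip_diff f.ip_sum f.ip_scale V_scale)
    also have "(\<Sum>k | l k = \<mu>. ip u (e k) * a (e k) v) = (\<Sum>k | l k = \<mu>. of_real \<mu> * (ip u (e k) * ip (e k) v))"
      by (intro sum.cong refl) (simp add: ak v)
    also have "a u v - \<dots> = of_real \<mu> * (ip u v - (\<Sum>k | l k = \<mu>. ip u (e k) * ip (e k) v))"
      using u v by (simp add: eigenvector_def sum_distrib_left algebra_simps)
    also have "\<dots> = of_real \<mu> * ip r v"
      unfolding r_def using uV S v eV by (simp add: ip_diff ip_sum ip_scale V_scale)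
    finally show ?thesis .
  qed
  have rk: "ip r (e k) = 0" for k
  proof (cases "l k = \<mu>")
    case True
    have "ip r (e k) = ip u (e k) - (\<Sum>i | l i = \<mu>. ip u (e i) * ip (e i) (e k))"
      unfolding r_def using uV S eV by (simp add: ip_diff ip_sum ip_scale V_scale)
    also have "(\<Sum>i | l i = \<mu>. ip u (e i) * ip (e i) (e k)) = (\<Sum>i | l i = \<mu>. if k = i then ip u (e i) else 0)"
      by (intro sum.cong) (auto simp: on)
    finally show ?thesis using fin True by (simp add: sum.delta')
  next
    case False
    have "of_real \<mu> * ip r (e k) = a r (e k)" using ar eV by simp
    also have "\<dots> = cnj (of_real (l k) * ip (e k) r)" using f.ip_cnj[OF eV rV, of k] ak[OF rV] by simp
    also have "\<dots> = of_real (l k) * ip r (e k)" using ip_cnj[OF eV rV, of k] by simp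
    finally show ?thesis using False by simp
  qed
  have "Re (ip r r) = 0"
  proof (rule ccontr)
    assume "Re (ip r r) \<noteq> 0"
    then have pos: "Re (ip r r) > 0" using ip_nonneg[OF rV] by simp
    have "eventually (\<lambda>k. (Re (a r r) / Re (ip r r)) + 1 \<le> l k) sequentially"
      using b by (auto simp: eigenbasis_def filterlim_at_top)
    then obtain k where k: "Re (a r r) / Re (ip r r) + 1 \<le> l k" by (auto simp: eventually_sequentially)
    have "l k * Re (ip r r) \<le> Re (a r r)" using b rV rk by (simp add: eigenbasis_def)
    then have "l k \<le> Re (a r r) / Re (ip r r)" using pos by (simp add: field_simps)
    then show False using k by simp
  qed
  then show ?thesis using ip_self[OF rV] by simp
qed

end

section \<open>Comparison of eigenvalues by counting dimensions\<close>

lemma homogeneous_system_nontrivial: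
  fixes A :: "nat \<Rightarrow> nat \<Rightarrow> 'a::field"
  assumes "m < n"
  shows "\<exists>c. (\<exists>i<n. c i \<noteq> 0) \<and> (\<forall>k<m. (\<Sum>i<n. c i * A k i) = 0)"
  using assms
proof (induction m arbitrary: n A)
  case 0
  then show ?case by (intro exI[of _ "\<lambda>_. 1"]) auto
next
  case (Suc m)
  show ?case
  proof (cases "\<forall>i<n. A m i = 0")
    case True
    obtain c where "\<exists>i<n. c i \<noteq> 0" "\<forall>k<m. (\<Sum>i<n. c i * A k i) = 0"
      using Suc.IH[of n A] Suc.prems by auto
    then show ?thesis using True by (intro exI[of _ c]) (auto simp: less_Suc_eq)
  next
    case False
    then obtain p where p: "p < n" "A m p \<noteq> 0" by blast
    define g where "g i = (if i < p then i else Suc i)" for i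
    have g: "bij_betw g {..<n - 1} ({..<n} - {p})"
    proof (rule bij_betw_byWitness[where f' = "\<lambda>i. if i < p then i else i - 1"])
    qed (use p in \<open>auto simp: g_def\<close>)
    have "m < n - 1" using Suc.prems by linarith
    from Suc.IH[OF this, of "\<lambda>k i. A k (g i) - A m (g i) * A k p / A m p"]
    obtain c' where c': "\<exists>i<n - 1. c' i \<noteq> 0"
      "\<forall>k<m. (\<Sum>i<n - 1. c' i * (A k (g i) - A m (g i) * A k p / A m p)) = 0"
      by (erule_tac exE) (erule conjE, rule that)
    define h where "h = the_inv_into {..<n - 1} g"
    define S where "S = (\<Sum>i<n - 1. c' i * A m (g i))"
    \<comment> \<open>Equation \<open>m\<close> determines the eliminated unknown.\<close>
    define c where "c i = (if i = p then - S / A m p else c' (h i))" for i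
    have cg: "c (g i) = c' i" if "i < n - 1" for i
      using that g bij_betwE[OF g] by (auto simp: c_def h_def the_inv_into_f_f bij_betw_def)
    have sum: "(\<Sum>i<n. c i * A k i) = - S / A m p * A k p + (\<Sum>i<n - 1. c' i * A k (g i))" for k
    proof -
      have "(\<Sum>i<n. c i * A k i) = c p * A k p + (\<Sum>i\<in>{..<n} - {p}. c i * A k i)"
        using p by (intro sum.remove) auto
      also have "(\<Sum>i\<in>{..<n} - {p}. c i * A k i) = (\<Sum>i<n - 1. c (g i) * A k (g i))"
        by (rule sum.reindex_bij_betw[OF g, symmetric])
      also have "\<dots> = (\<Sum>i<n - 1. c' i * A k (g i))" by (intro sum.cong) (auto simp: cg)
      finally show ?thesis by (simp add: c_def)
    qed
    have "(\<Sum>i<n. c i * A k i) = 0" if k: "k < Suc m" for k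
    proof (cases "k = m")
      case True
      then show ?thesis using p by (simp add: sum S_def)
    next
      case False
      then have "(\<Sum>i<n - 1. c' i * (A k (g i) - A m (g i) * A k p / A m p)) = 0" using c' k by simp
      also have "(\<Sum>i<n - 1. c' i * (A k (g i) - A m (g i) * A k p / A m p))
          = (\<Sum>i<n - 1. c' i * A k (g i)) - S * (A k p / A m p)"
        unfolding S_def sum_distrib_right sum_subtractf[symmetric] by (intro sum.cong) (auto simp: algebra_simps)
      finally show ?thesis by (simp add: sum)
    qed
    moreover obtain i where "i < n - 1" "c' i \<noteq> 0" using c' by blast
    then have "g i < n" "c (g i) \<noteq> 0" using cg bij_betwE[OF g] by auto
    ultimately show ?thesis by blast
  qed
qed

context compact_form begin

text \<open>In the form \<open>q = a - \<mu> ip\<close> the vector \<open>U\<close> is orthogonal to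
  all \<open>d i\<close>, so \<open>q v v\<close> is the sum of the terms
  \<open>(\<nu> k - \<mu>) |c k|^2\<close> and of \<open>|c j|^2 q U U\<close>, without mixed terms.
  None of these is positive, while the choice of \<open>v\<close> makes the total non-negative;
  since \<open>q U U\<close> is strictly negative, \<open>c j = 0\<close>, and the vector found is a
  combination of the \<open>d i\<close> alone.\<close>

lemma eigenvalue_comparison:
  assumes b: "eigenbasis e l"
    and d: "\<And>i. i < j \<Longrightarrow> d i \<in> V" "\<And>i k. i < j \<Longrightarrow> k < j \<Longrightarrow> ip (d i) (d k) = (if i = k then 1 else 0)"
      "\<And>i k. i < j \<Longrightarrow> k < j \<Longrightarrow> a (d i) (d k) = of_real (\<nu> i) * ip (d i) (d k)" "\<And>i. i < j \<Longrightarrow> \<nu> i \<le> \<mu>"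
    and U: "U \<in> V" "\<And>i. i < j \<Longrightarrow> a (d i) U = of_real \<mu> * ip (d i) U" "Re (a U U) < \<mu> * Re (ip U U)"
    and l: "\<mu> \<le> l j"
  shows "\<exists>c. (\<exists>i<j. c i \<noteq> 0) \<and> eigenvector \<mu> (\<Sum>i<j. c i \<odot> d i)"
proof -
  \<comment> \<open>The vectors \<open>e k\<close> with \<open>k < m\<close> are those whose
    eigenvalue is below \<mu>. As numbering starts at 0, \<open>l j\<close> is eigenvalue number j +
    1, and \<open>m \<le> j\<close> leaves at most j conditions on the j + 1 coefficients, the one
    of \<open>U\<close> carrying the index j.\<close>
  define m where "m = (LEAST k. \<mu> \<le> l k)"
  have m: "\<mu> \<le> l m" "m \<le> j" unfolding m_def using l by (auto intro: LeastI Least_le)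
  define u where "u i = (if i < j then d i else U)" for i
  have uV: "u i \<in> V" for i using d U by (simp add: u_def)
  have eV: "e k \<in> V" for k using b by (auto simp: eigenbasis_def eigenvector_def)
  define E where "E = e ` {..<m}"
  have E: "finite E" "orthonormal E" "\<forall>x\<in>E. \<exists>l. eigenvector l x"
  proof -
    have "ip (e i) (e k) = (if e i = e k then 1 else 0)" for i k
      using b unfolding eigenbasis_def by (metis zero_neq_one)
    then show "orthonormal E" using eV by (auto simp: E_def orthonormal_def)
  qed (use b in \<open>auto simp: E_def eigenbasis_def\<close>)
  have EV: "E \<subseteq> V" using E by (simp add: orthonormal_def)
  have low: "\<mu> * Re (ip w w) \<le> Re (a w w)" if w: "w \<in> orth E" for w
  proof -
    have "l m * Re (ip w w) \<le> Re (a w w)" using b w by (auto simp: eigenbasis_def orth_def E_def)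
    moreover have "\<mu> * Re (ip w w) \<le> l m * Re (ip w w)"
      using m ip_nonneg[of w] w by (intro mult_right_mono) (auto simp: orth_def)
    ultimately show ?thesis by linarith
  qed
  obtain c where c: "\<exists>i<Suc j. c i \<noteq> 0" "\<forall>k<m. (\<Sum>i<Suc j. c i * ip (u i) (e k)) = 0"
    using homogeneous_system_nontrivial[of m "Suc j" "\<lambda>k i. ip (u i) (e k)"] m by auto
  define s where "s = (\<Sum>i<j. c i \<odot> d i)"
  have sV: "s \<in> V" unfolding s_def using d by (auto intro!: V_sum V_scale)
  define v where "v = s + c j \<odot> U"
  have vV: "v \<in> V" unfolding v_def using sV U by (auto intro!: V_add V_scale)
  have "v = (\<Sum>i<Suc j. c i \<odot> u i)" unfolding v_def s_def by (simp add: u_def)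
  then have "ip v (e k) = (\<Sum>i<Suc j. c i * ip (u i) (e k))" for k
    using uV eV by (simp add: ip_sum ip_scale V_scale V_sum ip_add)
  then have vo: "v \<in> orth E" using c(2) vV by (auto simp: orth_def E_def)
  define q where "q = (\<lambda>x y. a x y - of_real \<mu> * ip x y)"
  have ips: "ip s w = (\<Sum>i<j. c i * ip (d i) w)" "a s w = (\<Sum>i<j. c i * a (d i) w)" if "w \<in> V" for w
    unfolding s_def using d(1) that
    by (subst ip_sum f.ip_sum; auto intro!: sum.cong simp: ip_scale f.ip_scale V_scale)+
  have ips_right: "ip w s = (\<Sum>i<j. cnj (c i) * ip w (d i))" "a w s = (\<Sum>i<j. cnj (c i) * a w (d i))" if "w \<in> V" for w
    unfolding s_def using d(1) that
    by (subst ip_sum_right f.ip_sum_right; auto intro!: sum.cong simp: ip_scale_right f.ip_scale_right V_scale)+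
  have aU: "a s U = of_real \<mu> * ip s U"
    using U(2) by (simp add: ips[OF U(1)] sum_distrib_left ac_simps)
  have sU: "q s U = 0" using aU by (simp add: q_def)
  have Us: "q U s = 0" using aU ip_cnj[OF sV U(1)] f.ip_cnj[OF sV U(1)] by (simp add: q_def)
  have qsd: "q s (d k) = c k * of_real (\<nu> k - \<mu>)" if k: "k < j" for k
  proof -
    have "q s (d k) = (\<Sum>i<j. c i * (a (d i) (d k) - of_real \<mu> * ip (d i) (d k)))"
      unfolding q_def ips[OF d(1)[OF k]] by (simp add: sum_distrib_left sum_subtractf algebra_simps)
    also have "\<dots> = (\<Sum>i<j. if i = k then c i * of_real (\<nu> k - \<mu>) else 0)"
      using d(2,3) k by (intro sum.cong) auto
    finally show ?thesis using k by simp
  qed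
  have "q s s = (\<Sum>k<j. cnj (c k) * q s (d k))"
    unfolding q_def ips_right[OF sV] by (simp add: sum_distrib_left sum_subtractf algebra_simps)
  also have "\<dots> = (\<Sum>k<j. of_real ((\<nu> k - \<mu>) * (cmod (c k))\<^sup>2))"
  proof (intro sum.cong refl)
    fix k assume "k \<in> {..<j}"
    then have "cnj (c k) * q s (d k) = (c k * cnj (c k)) * of_real (\<nu> k - \<mu>)" using qsd by simp
    then show "cnj (c k) * q s (d k) = of_real ((\<nu> k - \<mu>) * (cmod (c k))\<^sup>2)"
      by (simp add: complex_norm_square[symmetric] del: of_real_power)
  qed
  finally have qss: "q s s = of_real (\<Sum>k<j. (\<nu> k - \<mu>) * (cmod (c k))\<^sup>2)" by simp
  have "q v v = q s s + c j * q U s + cnj (c j) * q s U + (c j * cnj (c j)) * q U U"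
    unfolding v_def q_def using sV U(1)
    by (simp add: ip_add ip_add_right ip_scale ip_scale_right f.ip_add f.ip_add_right f.ip_scale f.ip_scale_right
        V_scale V_add algebra_simps)
  then have qv: "Re (q v v) = (\<Sum>k<j. (\<nu> k - \<mu>) * (cmod (c k))\<^sup>2) + (cmod (c j))\<^sup>2 * Re (q U U)"
    by (simp add: sU Us qss complex_norm_square[symmetric] del: of_real_power)
  have q0: "Re (q v v) \<ge> 0" using low[OF vo] by (simp add: q_def)
  have QU: "Re (q U U) < 0" using U(3) by (simp add: q_def)
  have t: "(\<nu> k - \<mu>) * (cmod (c k))\<^sup>2 \<le> 0" if "k < j" for k
    using d(4)[OF that] by (simp add: mult_nonpos_nonneg)
  have S: "(\<Sum>k<j. (\<nu> k - \<mu>) * (cmod (c k))\<^sup>2) \<le> 0" using t by (intro sum_nonpos) auto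
  have "(cmod (c j))\<^sup>2 * Re (q U U) \<le> 0" using QU by (simp add: mult_nonneg_nonpos)
  then have "(cmod (c j))\<^sup>2 * Re (q U U) = 0" and S0: "(\<Sum>k<j. (\<nu> k - \<mu>) * (cmod (c k))\<^sup>2) = 0"
    using q0 qv S by linarith+
  then have cj: "c j = 0" using QU by simp
  have vs: "v = s" using cj by (simp add: v_def)
  have "Re (a v v) = \<mu> * Re (ip v v)" using qv S0 cj by (simp add: q_def)
  then have "eigenvector \<mu> v"
    by (intro orth_eigenvector[OF E vo]) (rule orth_minimizer[OF EV low vo])
  moreover have "\<exists>i<j. c i \<noteq> 0" using c(1) cj less_Suc_eq by blast
  ultimately show ?thesis by (auto simp: vs s_def)
qed

end

section \<open>Square-integrable functions\<close>

text \<open>The Riesz-Fischer theorem, with square-integrability asked of differences only. A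
  rapidly convergent subsequence has a pointwise limit almost everywhere, and Fatou's lemma along it
  carries the Cauchy estimate over to the limit.\<close>

lemma square_integrable_complete:
  fixes u :: "nat \<Rightarrow> 'a \<Rightarrow> 'b::{banach, second_countable_topology}"
  assumes [measurable]: "\<And>k. u k \<in> borel_measurable M"
    and int: "\<And>m n. integrable M (\<lambda>p. (norm (u m p - u n p))\<^sup>2)"
    and cauchy: "\<And>\<epsilon>. \<epsilon> > 0 \<Longrightarrow> \<exists>N. \<forall>m\<ge>N. \<forall>n\<ge>N. (LINT p|M. (norm (u m p - u n p))\<^sup>2) < \<epsilon>"
  obtains v where "v \<in> borel_measurable M" "\<And>m. integrable M (\<lambda>p. (norm (u m p - v p))\<^sup>2)"
    "(\<lambda>m. LINT p|M. (norm (u m p - v p))\<^sup>2) \<longlonglongrightarrow> 0"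
proof -
  have "\<forall>k. \<exists>N. \<forall>m\<ge>N. \<forall>n\<ge>N. (LINT p|M. (norm (u m p - u n p))\<^sup>2) < (1/8)^k"
    using cauchy by simp
  then obtain N :: "nat \<Rightarrow> nat" where N: "\<forall>k. \<forall>m\<ge>N k. \<forall>n\<ge>N k. (LINT p|M. (norm (u m p - u n p))\<^sup>2) < (1/8)^k"
    by (rule choice[THEN exE])
  define r where "r = rec_nat (N 0) (\<lambda>k x. max (Suc x) (N (Suc k)))"
  have rSuc: "r (Suc k) = max (Suc (r k)) (N (Suc k))" and r0: "r 0 = N 0" for k by (simp_all add: r_def)
  have rN: "r k \<ge> N k" for k by (cases k) (auto simp: rSuc r0)
  have r_mono: "strict_mono r" by (rule strict_monoI_Suc) (simp add: rSuc)
  define g where "g k p = (norm (u (r (Suc k)) p - u (r k) p))\<^sup>2" for k p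
  have gi: "integrable M (g k)" for k unfolding g_def by (rule int)
  \<comment> \<open>The rate 1/8 leaves room for weights \<open>4^k\<close>: the weighted integrals
    sum like \<open>(1/2)^k\<close>, so almost everywhere \<open>4^k * g k p\<close> is bounded and
    the increments of the subsequence are dominated by a geometric series.\<close>
  have g8: "(LINT p|M. g k p) < (1/8)^k" for k
    using N rN[of k] strict_mono_less_eq[OF r_mono, of k "Suc k"] unfolding g_def
    by (meson le_SucI order_refl order_trans)
  have [measurable]: "g k \<in> borel_measurable M" for k unfolding g_def by measurable
  have "(\<integral>\<^sup>+p. (\<Sum>k. ennreal (4^k * g k p)) \<partial>M) = (\<Sum>k. \<integral>\<^sup>+p. ennreal (4^k * g k p) \<partial>M)"
    by (rule nn_integral_suminf) measurable
  also have "\<dots> \<le> (\<Sum>k. ennreal ((1/2)^k))"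
  proof (intro suminf_le allI)
    fix k
    have "(\<integral>\<^sup>+p. ennreal (4^k * g k p) \<partial>M) = ennreal (LINT p|M. 4^k * g k p)"
      by (intro nn_integral_eq_integral integrable_mult_right gi) (auto simp: g_def)
    also have "\<dots> \<le> ennreal (4^k * (1/8)^k)"
      using g8[of k] by (intro ennreal_leI) (simp add: less_imp_le)
    also have "4^k * (1/8)^k = ((1/2)^k :: real)" by (simp add: power_mult_distrib[symmetric])
    finally show "(\<integral>\<^sup>+p. ennreal (4^k * g k p) \<partial>M) \<le> ennreal ((1/2)^k)" .
  qed auto
  also have "\<dots> = ennreal (\<Sum>k. (1/2)^k)" by (intro suminf_ennreal2) (auto simp: summable_geometric)
  also have "\<dots> < \<infinity>" by simp
  finally have "AE p in M. (\<Sum>k. ennreal (4^k * g k p)) \<noteq> \<infinity>"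
    by (intro nn_integral_PInf_AE) (auto simp: less_top)
  then have conv: "AE p in M. (\<lambda>k. u (r k) p) \<longlonglongrightarrow> lim (\<lambda>k. u (r k) p)"
  proof eventually_elim
    case (elim p)
    then have sm: "summable (\<lambda>k. 4^k * g k p)" by (intro summable_suminf_not_top) (auto simp: g_def)
    have "Bseq (\<lambda>k. 4^k * g k p)" using summable_LIMSEQ_zero[OF sm] convergent_imp_Bseq convergentI by blast
    then obtain C where C: "C > 0" "\<And>k. norm (4^k * g k p) \<le> C" by (auto simp: Bseq_def)
    have "norm (u (r (Suc k)) p - u (r k) p) \<le> sqrt C * (1/2)^k" for k
    proof -
      have "(2^k * norm (u (r (Suc k)) p - u (r k) p))\<^sup>2 = 4^k * g k p"
        by (simp add: g_def power_mult_distrib power2_eq_square power_mult_distrib[symmetric])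
      also have "\<dots> \<le> (sqrt C)\<^sup>2" using C(2)[of k] C(1) by simp
      finally have "2^k * norm (u (r (Suc k)) p - u (r k) p) \<le> sqrt C"
        by (rule power2_le_imp_le) (use C(1) in simp)
      then show ?thesis by (simp add: field_simps)
    qed
    moreover have "summable (\<lambda>k. sqrt C * (1/2)^k)" by (intro summable_mult summable_geometric) simp
    ultimately have "summable (\<lambda>k. u (r (Suc k)) p - u (r k) p)"
      by (rule summable_comparison_test'[where N = 0, rotated])
    then have "convergent (\<lambda>n. \<Sum>k<n. u (r (Suc k)) p - u (r k) p)" by (simp add: summable_iff_convergent)
    then have "convergent (\<lambda>n. u (r n) p - u (r 0) p)" by (simp add: sum_lessThan_telescope[of "\<lambda>n. u (r n) p"])
    then have "convergent (\<lambda>n. (u (r n) p - u (r 0) p) + u (r 0) p)" by (rule convergent_add[OF _ convergent_const])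
    then show ?case by (simp add: convergent_LIMSEQ_iff)
  qed
  define v where "v p = lim (\<lambda>k. u (r k) p)" for p
  have vm[measurable]: "v \<in> borel_measurable M" unfolding v_def by measurable
  \<comment> \<open>Fatou's lemma in the index \<open>r k\<close>, with \<open>m\<close> held fixed:
    a Cauchy bound valid from \<open>L\<close> on also bounds the distance to the limit.\<close>
  have key: "(\<integral>\<^sup>+p. ennreal ((norm (u m p - v p))\<^sup>2) \<partial>M) \<le> ennreal \<epsilon>"
    if \<epsilon>: "\<forall>n\<ge>L. (LINT p|M. (norm (u m p - u n p))\<^sup>2) < \<epsilon>" for m L \<epsilon>
  proof -
    have "(\<integral>\<^sup>+p. ennreal ((norm (u m p - v p))\<^sup>2) \<partial>M)
        = (\<integral>\<^sup>+p. liminf (\<lambda>k. ennreal ((norm (u m p - u (r k) p))\<^sup>2)) \<partial>M)"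
    proof (rule nn_integral_cong_AE)
      show "AE p in M. ennreal ((norm (u m p - v p))\<^sup>2) = liminf (\<lambda>k. ennreal ((norm (u m p - u (r k) p))\<^sup>2))"
        using conv
      proof eventually_elim
        case (elim p)
        then have "(\<lambda>k. ennreal ((norm (u m p - u (r k) p))\<^sup>2)) \<longlonglongrightarrow> ennreal ((norm (u m p - v p))\<^sup>2)"
          unfolding v_def[symmetric] by (intro tendsto_intros)
        then show ?case by (rule lim_imp_Liminf[symmetric, rotated]) simp
      qed
    qed
    also have "\<dots> \<le> liminf (\<lambda>k. \<integral>\<^sup>+p. ennreal ((norm (u m p - u (r k) p))\<^sup>2) \<partial>M)"
      by (rule nn_integral_liminf) measurable
    also have "\<dots> \<le> ennreal \<epsilon>"
    proof (rule Liminf_le)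
      show "\<forall>\<^sub>F k in sequentially. (\<integral>\<^sup>+p. ennreal ((norm (u m p - u (r k) p))\<^sup>2) \<partial>M) \<le> ennreal \<epsilon>"
        unfolding eventually_sequentially
      proof (intro exI allI impI)
        fix k assume "L \<le> k"
        then have "L \<le> r k" using strict_mono_imp_increasing[OF r_mono, of k] by simp
        then have "(LINT p|M. (norm (u m p - u (r k) p))\<^sup>2) \<le> \<epsilon>" using \<epsilon> by (simp add: less_imp_le)
        then show "(\<integral>\<^sup>+p. ennreal ((norm (u m p - u (r k) p))\<^sup>2) \<partial>M) \<le> ennreal \<epsilon>"
          by (subst nn_integral_eq_integral[OF int]) (auto intro: ennreal_leI)
      qed
    qed simp
    finally show ?thesis .
  qed
  have vint0: "integrable M (\<lambda>p. (norm (u m p - v p))\<^sup>2)" if m: "\<forall>n\<ge>L. (LINT p|M. (norm (u m p - u n p))\<^sup>2) < \<epsilon>" for m L \<epsilon>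
    using key[OF m] by (intro integrableI_nonneg) (auto intro: le_less_trans)
  have vle: "(LINT p|M. (norm (u m p - v p))\<^sup>2) \<le> \<epsilon>" if m: "\<forall>n\<ge>L. (LINT p|M. (norm (u m p - u n p))\<^sup>2) < \<epsilon>" for m L \<epsilon>
  proof -
    have "0 \<le> (LINT p|M. (norm (u m p - u L p))\<^sup>2)" by simp
    then have e: "0 \<le> \<epsilon>" using m by (meson le_refl less_imp_le order_trans)
    have "ennreal (LINT p|M. (norm (u m p - v p))\<^sup>2) \<le> ennreal \<epsilon>"
      using key[OF m] nn_integral_eq_integral[OF vint0[OF m]] by simp
    then show ?thesis using e by simp
  qed
  have vint: "integrable M (\<lambda>p. (norm (u m p - v p))\<^sup>2)" for m
  proof -
    obtain L where L: "\<forall>m\<ge>L. \<forall>n\<ge>L. (LINT p|M. (norm (u m p - u n p))\<^sup>2) < 1" using cauchy[of 1] by auto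
    then have i: "integrable M (\<lambda>p. (norm (u L p - v p))\<^sup>2)" by (intro vint0[of L]) auto
    show ?thesis
    proof (rule Bochner_Integration.integrable_bound)
      show "integrable M (\<lambda>p. 2 * (norm (u m p - u L p))\<^sup>2 + 2 * (norm (u L p - v p))\<^sup>2)"
        using i int by simp
      have "(norm (u m p - v p))\<^sup>2 \<le> 2 * (norm (u m p - u L p))\<^sup>2 + 2 * (norm (u L p - v p))\<^sup>2" for p
      proof -
        have "norm (u m p - v p) \<le> norm (u m p - u L p) + norm (u L p - v p)"
          using norm_triangle_ineq[of "u m p - u L p" "u L p - v p"] by simp
        then have "(norm (u m p - v p))\<^sup>2 \<le> (norm (u m p - u L p) + norm (u L p - v p))\<^sup>2" by (simp add: power_mono)
        also have "\<dots> \<le> 2 * (norm (u m p - u L p))\<^sup>2 + 2 * (norm (u L p - v p))\<^sup>2"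
          using zero_le_power2[of "norm (u m p - u L p) - norm (u L p - v p)"]
          unfolding power2_sum power2_diff by linarith
        finally show ?thesis .
      qed
      then show "AE p in M. norm ((norm (u m p - v p))\<^sup>2) \<le> norm (2 * (norm (u m p - u L p))\<^sup>2 + 2 * (norm (u L p - v p))\<^sup>2)"
        by simp
    qed measurable
  qed
  have "(\<lambda>m. LINT p|M. (norm (u m p - v p))\<^sup>2) \<longlonglongrightarrow> 0"
  proof (rule LIMSEQ_I)
    fix \<epsilon> :: real assume "\<epsilon> > 0"
    then obtain L where L: "\<forall>m\<ge>L. \<forall>n\<ge>L. (LINT p|M. (norm (u m p - u n p))\<^sup>2) < \<epsilon>/2" using cauchy[of "\<epsilon>/2"] by auto
    have "norm ((LINT p|M. (norm (u m p - v p))\<^sup>2) - 0) < \<epsilon>" if "m \<ge> L" for m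
    proof -
      have "(LINT p|M. (norm (u m p - v p))\<^sup>2) \<le> \<epsilon>/2" using L that by (intro vle[of L]) auto
      then show ?thesis using \<open>\<epsilon> > 0\<close> by simp
    qed
    then show "\<exists>L. \<forall>m\<ge>L. norm ((LINT p|M. (norm (u m p - v p))\<^sup>2) - 0) < \<epsilon>" by blast
  qed
  then show thesis using that vm vint by blast
qed

section \<open>The space of square-integrable functions as a semi-inner product space\<close>

abbreviation (input) fscale :: "complex \<Rightarrow> ('a \<Rightarrow> complex) \<Rightarrow> 'a \<Rightarrow> complex" where
  "fscale c u \<equiv> (\<lambda>p. c * u p)"

lemma vector_space_fscale: "vector_space fscale"
  by unfold_locales (auto simp: fun_eq_iff algebra_simps)

lemma sum_fun_apply: "(\<Sum>i\<in>A. f i) p = (\<Sum>i\<in>A. f i p :: 'b::ab_group_add)"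
  by (induction A rule: infinite_finite_induct) auto

lemma L2D: "u \<in> L2 \<Omega> \<Longrightarrow> u \<in> borel_measurable (lebesgue_on \<Omega>)"
  "u \<in> L2 \<Omega> \<Longrightarrow> integrable (lebesgue_on \<Omega>) (\<lambda>p. (norm (u p))\<^sup>2)"
  by (auto simp: L2_def)

lemma L2_mult_integrable:
  assumes "u \<in> L2 \<Omega>" "v \<in> L2 \<Omega>"
  shows "integrable (lebesgue_on \<Omega>) (\<lambda>p. u p * v p)"
proof (rule Bochner_Integration.integrable_bound)
  note [measurable] = L2D(1)[OF assms(1)] L2D(1)[OF assms(2)]
  show "integrable (lebesgue_on \<Omega>) (\<lambda>p. (norm (u p))\<^sup>2 + (norm (v p))\<^sup>2)"
    using assms by (intro Bochner_Integration.integrable_add L2D)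
  have "norm (u p * v p) \<le> (norm (u p))\<^sup>2 + (norm (v p))\<^sup>2" for p
  proof -
    have "2 * (norm (u p) * norm (v p)) \<le> (norm (u p))\<^sup>2 + (norm (v p))\<^sup>2"
      using sum_squares_bound[of "norm (u p)" "norm (v p)"] by simp
    moreover have "0 \<le> norm (u p) * norm (v p)" by simp
    ultimately show ?thesis unfolding norm_mult by linarith
  qed
  then show "AE p in lebesgue_on \<Omega>. norm (u p * v p) \<le> norm ((norm (u p))\<^sup>2 + (norm (v p))\<^sup>2)"
    by (simp add: order_trans[OF _ abs_ge_self])
  show "(\<lambda>p. u p * v p) \<in> borel_measurable (lebesgue_on \<Omega>)" by measurable
qed

lemma L2_cnj: "u \<in> L2 \<Omega> \<Longrightarrow> (\<lambda>p. cnj (u p)) \<in> L2 \<Omega>"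
  using measurable_compose[of u "lebesgue_on \<Omega>" borel cnj borel, OF _ borel_measurable_continuous_onI]
  by (auto simp: L2_def continuous_on_cnj)

lemma L2_inner_integrable:
  "u \<in> L2 \<Omega> \<Longrightarrow> v \<in> L2 \<Omega> \<Longrightarrow> integrable (lebesgue_on \<Omega>) (\<lambda>p. u p * cnj (v p))"
  by (intro L2_mult_integrable L2_cnj)

lemma L2_scale: "u \<in> L2 \<Omega> \<Longrightarrow> fscale c u \<in> L2 \<Omega>"
  by (auto simp: L2_def norm_mult power_mult_distrib)

lemma L2_add:
  assumes "u \<in> L2 \<Omega>" "v \<in> L2 \<Omega>"
  shows "(\<lambda>p. u p + v p) \<in> L2 \<Omega>"
proof -
  note [measurable] = L2D(1)[OF assms(1)] L2D(1)[OF assms(2)]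
  have "integrable (lebesgue_on \<Omega>) (\<lambda>p. (norm (u p + v p))\<^sup>2)"
  proof (rule Bochner_Integration.integrable_bound)
    show "integrable (lebesgue_on \<Omega>) (\<lambda>p. 2 * (norm (u p))\<^sup>2 + 2 * (norm (v p))\<^sup>2)"
      using L2D(2)[OF assms(1)] L2D(2)[OF assms(2)] by simp
    have "(norm (u p + v p))\<^sup>2 \<le> 2 * (norm (u p))\<^sup>2 + 2 * (norm (v p))\<^sup>2" for p
    proof -
      have "(norm (u p + v p))\<^sup>2 \<le> (norm (u p) + norm (v p))\<^sup>2" by (simp add: power_mono norm_triangle_ineq)
      also have "\<dots> \<le> 2 * (norm (u p))\<^sup>2 + 2 * (norm (v p))\<^sup>2"
        using zero_le_power2[of "norm (u p) - norm (v p)"] unfolding power2_sum power2_diff by linarith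
      finally show ?thesis .
    qed
    then show "AE p in lebesgue_on \<Omega>. norm ((norm (u p + v p))\<^sup>2) \<le> norm (2 * (norm (u p))\<^sup>2 + 2 * (norm (v p))\<^sup>2)"
      by simp
  qed measurable
  then show ?thesis by (auto simp: L2_def)
qed

lemma L2_zero: "(\<lambda>p. 0) \<in> L2 \<Omega>"
  by (auto simp: L2_def)

lemma L2_diff: "u \<in> L2 \<Omega> \<Longrightarrow> v \<in> L2 \<Omega> \<Longrightarrow> (\<lambda>p. u p - v p) \<in> L2 \<Omega>"
  using L2_add[of u \<Omega> "fscale (-1) v"] L2_scale[of v \<Omega> "-1"] by simp

lemma L2_inner_self: "L2_inner \<Omega> u u = of_real (LINT p|lebesgue_on \<Omega>. (norm (u p))\<^sup>2)"
  unfolding L2_inner_def complex_norm_square[symmetric] by (rule integral_complex_of_real)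

lemma Re_L2_inner_self: "Re (L2_inner \<Omega> u u) = (L2_norm \<Omega> u)\<^sup>2"
  by (simp add: L2_inner_self L2_norm_def)

lemma L2_semi_inner: "semi_inner fscale (L2 \<Omega>) (L2_inner \<Omega>)"
  for \<Omega> :: "'a::euclidean_space set"
proof -
  interpret vector_space "fscale :: complex \<Rightarrow> ('a \<Rightarrow> complex) \<Rightarrow> 'a \<Rightarrow> complex" by (rule vector_space_fscale)
  show "semi_inner fscale (L2 \<Omega>) (L2_inner \<Omega>)"
  proof unfold_locales
    show "subspace (L2 \<Omega>)"
      by (intro subspaceI) (auto simp: plus_fun_def zero_fun_def L2_add L2_scale L2_zero)
  next
    fix u v w assume "u \<in> L2 \<Omega>" "v \<in> L2 \<Omega>" "w \<in> L2 \<Omega>"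
    then show "L2_inner \<Omega> (u + v) w = L2_inner \<Omega> u w + L2_inner \<Omega> v w"
      by (simp add: L2_inner_def L2_inner_integrable distrib_right)
  next
    fix u v show "L2_inner \<Omega> v u = cnj (L2_inner \<Omega> u v)"
      unfolding L2_inner_def by (subst Bochner_Integration.integral_cnj[symmetric]) (simp add: mult.commute)
  qed (auto simp: L2_inner_def mult.assoc Re_L2_inner_self[unfolded L2_inner_def])
qed

lemma L2_nrm: "semi_inner.nrm (L2_inner \<Omega>) u = L2_norm \<Omega> u"
  by (simp add: semi_inner.nrm_def[OF L2_semi_inner] Re_L2_inner_self L2_norm_def)

lemma L2_complete:
  assumes u: "\<And>k. u k \<in> L2 \<Omega>"
    and cauchy: "\<And>\<epsilon>. \<epsilon> > 0 \<Longrightarrow> \<exists>N. \<forall>m\<ge>N. \<forall>n\<ge>N. (L2_norm \<Omega> (\<lambda>p. u m p - u n p))\<^sup>2 < \<epsilon>"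
  obtains v where "v \<in> L2 \<Omega>" "(\<lambda>k. L2_norm \<Omega> (\<lambda>p. u k p - v p)) \<longlonglongrightarrow> 0"
proof -
  have sq: "(L2_norm \<Omega> w)\<^sup>2 = (LINT p|lebesgue_on \<Omega>. (norm (w p))\<^sup>2)" for w by (simp add: L2_norm_def)
  obtain v where v: "v \<in> borel_measurable (lebesgue_on \<Omega>)"
    "\<And>m. integrable (lebesgue_on \<Omega>) (\<lambda>p. (norm (u m p - v p))\<^sup>2)"
    "(\<lambda>m. LINT p|lebesgue_on \<Omega>. (norm (u m p - v p))\<^sup>2) \<longlonglongrightarrow> 0"
    by (rule square_integrable_complete[of u "lebesgue_on \<Omega>"])
      (use u cauchy in \<open>auto simp: sq intro: L2D(1) L2D(2)[OF L2_diff]\<close>)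
  have "(\<lambda>p. u 0 p - v p) \<in> L2 \<Omega>" using v L2D(1)[OF u] by (auto simp: L2_def)
  from L2_diff[OF u[of 0] this] have "v \<in> L2 \<Omega>" by simp
  moreover have "(\<lambda>k. L2_norm \<Omega> (\<lambda>p. u k p - v p)) \<longlonglongrightarrow> 0"
    unfolding L2_norm_def using tendsto_real_sqrt[OF v(3)] by simp
  ultimately show thesis by (rule that)
qed

lemma L2_inner_cong_AE:
  assumes "AE p in lebesgue_on \<Omega>. u p = u' p" "AE p in lebesgue_on \<Omega>. v p = v' p"
    and "u \<in> L2 \<Omega>" "u' \<in> L2 \<Omega>" "v \<in> L2 \<Omega>" "v' \<in> L2 \<Omega>"
  shows "L2_inner \<Omega> u v = L2_inner \<Omega> u' v'"
  unfolding L2_inner_def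
proof (rule integral_cong_AE)
  show "AE p in lebesgue_on \<Omega>. u p * cnj (v p) = u' p * cnj (v' p)"
    using assms(1,2) by eventually_elim simp
qed (use assms in \<open>auto intro!: borel_measurable_integrable L2_inner_integrable\<close>)

lemma L2_norm_eq_0_iff:
  assumes "u \<in> L2 \<Omega>"
  shows "L2_norm \<Omega> u = 0 \<longleftrightarrow> (AE p in lebesgue_on \<Omega>. u p = 0)"
  using integral_nonneg_eq_0_iff_AE[OF L2D(2)[OF assms]] by (simp add: L2_norm_def)

section \<open>Smooth functions\<close>

lemma partial_deriv_eq: "(\<phi> has_derivative D) (at p) \<Longrightarrow> partial_deriv b \<phi> p = D b"
  unfolding partial_deriv_def by (simp add: frechet_derivative_at[symmetric])

lemma C_k_continuous: "C_k k \<phi> \<Longrightarrow> continuous_on UNIV \<phi>"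
  by (cases k) (auto intro!: continuous_at_imp_continuous_on differentiable_imp_continuous_within)

lemma C_k_mono: "C_k (Suc k) \<phi> \<Longrightarrow> C_k k \<phi>"
proof (induction k arbitrary: \<phi>)
  case 0
  then show ?case using C_k_continuous[OF 0] by simp
next
  case (Suc k)
  then show ?case by (metis C_k.simps(2))
qed

lemma C_k_const: "C_k k (\<lambda>p. c)"
proof (induction k arbitrary: c)
  case (Suc k)
  have "partial_deriv b (\<lambda>p. c) = (\<lambda>p. 0)" for b :: 'a
    by (rule ext, subst partial_deriv_eq[OF has_derivative_const]) simp
  then show ?case using Suc by simp
qed simp

lemma partial_deriv_add:
  "\<phi> differentiable (at p) \<Longrightarrow> \<psi> differentiable (at p) \<Longrightarrow>
    partial_deriv b (\<lambda>p. \<phi> p + \<psi> p) p = partial_deriv b \<phi> p + partial_deriv b \<psi> p"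
  by (subst partial_deriv_eq[OF has_derivative_add[OF frechet_derivative_works[THEN iffD1] frechet_derivative_works[THEN iffD1]]])
    (auto simp: partial_deriv_def)

lemma partial_deriv_mult:
  "\<phi> differentiable (at p) \<Longrightarrow> \<psi> differentiable (at p) \<Longrightarrow>
    partial_deriv b (\<lambda>p. \<phi> p * \<psi> p) p = \<phi> p * partial_deriv b \<psi> p + partial_deriv b \<phi> p * \<psi> p"
  by (subst partial_deriv_eq[OF has_derivative_mult[OF frechet_derivative_works[THEN iffD1] frechet_derivative_works[THEN iffD1]]])
    (auto simp: partial_deriv_def)

lemma partial_deriv_bounded_linear:
  assumes "bounded_linear L" "\<phi> differentiable (at p)"
  shows "partial_deriv b (\<lambda>p. L (\<phi> p)) p = L (partial_deriv b \<phi> p)"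
  by (subst partial_deriv_eq[OF bounded_linear.has_derivative[OF assms(1) frechet_derivative_works[THEN iffD1, OF assms(2)]]])
    (auto simp: partial_deriv_def)

lemma C_k_add: "C_k k \<phi> \<Longrightarrow> C_k k \<psi> \<Longrightarrow> C_k k (\<lambda>p. \<phi> p + \<psi> p)"
proof (induction k arbitrary: \<phi> \<psi>)
  case 0
  then show ?case by (auto intro: continuous_on_add)
next
  case (Suc k)
  then have "partial_deriv b (\<lambda>p. \<phi> p + \<psi> p) = (\<lambda>p. partial_deriv b \<phi> p + partial_deriv b \<psi> p)" for b
    by (auto simp: partial_deriv_add)
  then show ?case using Suc by auto
qed

lemma C_k_mult: "C_k k \<phi> \<Longrightarrow> C_k k \<psi> \<Longrightarrow> C_k k (\<lambda>p. \<phi> p * \<psi> p)"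
proof (induction k arbitrary: \<phi> \<psi>)
  case 0
  then show ?case by (auto intro: continuous_on_mult)
next
  case (Suc k)
  then have "partial_deriv b (\<lambda>p. \<phi> p * \<psi> p) = (\<lambda>p. \<phi> p * partial_deriv b \<psi> p + partial_deriv b \<phi> p * \<psi> p)" for b
    by (auto simp: partial_deriv_mult)
  then show ?case using Suc C_k_mono[OF Suc.prems(1)] C_k_mono[OF Suc.prems(2)]
    by (auto intro!: C_k_add differentiable_mult)
qed

lemma C_k_bounded_linear: "bounded_linear L \<Longrightarrow> C_k k \<phi> \<Longrightarrow> C_k k (\<lambda>p. L (\<phi> p))"
proof (induction k arbitrary: \<phi>)
  case 0
  then show ?case by (auto intro: bounded_linear.continuous_on)
next
  case (Suc k)
  then have "partial_deriv b (\<lambda>p. L (\<phi> p)) = (\<lambda>p. L (partial_deriv b \<phi> p))" for b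
    by (auto simp: partial_deriv_bounded_linear)
  moreover have "(\<lambda>p. L (\<phi> p)) differentiable (at p)" for p
  proof -
    have "(\<phi> has_derivative frechet_derivative \<phi> (at p)) (at p)"
      using Suc.prems(2) by (simp add: frechet_derivative_works[symmetric])
    then show ?thesis by (rule differentiableI[OF bounded_linear.has_derivative[OF Suc.prems(1)]])
  qed
  ultimately show ?case using Suc by simp
qed

lemma C_k_diff: "C_k k \<phi> \<Longrightarrow> C_k k \<psi> \<Longrightarrow> C_k k (\<lambda>p. \<phi> p - \<psi> p)"
  using C_k_add[of k \<phi> "\<lambda>p. (- 1) * \<psi> p"] C_k_mult[OF C_k_const[of k "- 1"], of \<psi>] by simp

lemma C_k_linear:
  fixes L :: "'a::euclidean_space \<Rightarrow> complex"
  assumes "bounded_linear L"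
  shows "C_k k L"
proof (cases k)
  case 0
  then show ?thesis using assms by (simp add: linear_continuous_on)
next
  case (Suc m)
  have d: "(L has_derivative L) (at p)" for p using assms by (rule bounded_linear_imp_has_derivative)
  then have "partial_deriv b L = (\<lambda>p. L b)" for b by (auto simp: partial_deriv_eq)
  then show ?thesis using d by (auto simp: Suc C_k_const differentiable_def)
qed

lemma C_k_prod: "(\<And>i. i \<in> A \<Longrightarrow> C_k k (\<phi> i)) \<Longrightarrow> C_k k (\<lambda>p. \<Prod>i\<in>A. \<phi> i p)"
  by (induction A rule: infinite_finite_induct) (auto simp: C_k_const intro!: C_k_mult)

lemma C_k_sum: "(\<And>i. i \<in> A \<Longrightarrow> C_k k (\<phi> i)) \<Longrightarrow> C_k k (\<lambda>p. \<Sum>i\<in>A. \<phi> i p)"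
  by (induction A rule: infinite_finite_induct) (auto simp: C_k_const intro!: C_k_add)

lemma C_k_exp: "C_k k \<phi> \<Longrightarrow> C_k k (\<lambda>p. exp (\<phi> p))"
proof (induction k)
  case 0
  then show ?case by (auto intro: continuous_on_exp)
next
  case (Suc k)
  have d: "((\<lambda>p. exp (\<phi> p)) has_derivative (\<lambda>h. exp (\<phi> p) * frechet_derivative \<phi> (at p) h)) (at p)" for p
  proof (rule has_derivative_compose[OF _ DERIV_exp[unfolded has_field_derivative_def]])
    show "(\<phi> has_derivative frechet_derivative \<phi> (at p)) (at p)"
      using Suc.prems by (simp add: frechet_derivative_works[symmetric])
  qed
  have "partial_deriv b (\<lambda>p. exp (\<phi> p)) = (\<lambda>p. exp (\<phi> p) * partial_deriv b \<phi> p)" for b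
    by (rule ext, subst partial_deriv_eq[OF d], simp add: partial_deriv_def)
  then show ?case using Suc C_k_mono[OF Suc.prems] d by (auto intro!: C_k_mult simp: differentiable_def)
qed

text \<open>The span of these functions is closed under differentiation.\<close>

definition flat :: "nat \<Rightarrow> real \<Rightarrow> real" where
  "flat m x = (if x > 0 then inverse x ^ m * exp (- inverse x) else 0)"

text \<open>The term of degree \<open>m + 2\<close> in the exponential series at \<open>1/x\<close>
  outweighs the negative power. Order 2 at the origin is what the difference quotient in
  \<open>flat_deriv\<close> needs.\<close>

lemma flat_bound: "\<bar>flat m x\<bar> \<le> fact (m + 2) * x\<^sup>2"
proof (cases "x > 0")
  case True
  define t where "t = inverse x"
  have t: "t > 0" using True by (simp add: t_def)
  have "(\<Sum>n\<in>{m+2}. t ^ n /\<^sub>R fact n) \<le> (\<Sum>n. t ^ n /\<^sub>R fact n)"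
    using t by (intro sum_le_suminf sums_summable[OF exp_converges]) auto
  then have "t ^ (m + 2) / fact (m + 2) \<le> exp t" using exp_converges[of t] by (simp add: sums_iff divide_inverse mult.commute)
  then have "t ^ m * t\<^sup>2 \<le> fact (m + 2) * exp t" by (simp add: field_simps power_add power2_eq_square del: fact_Suc)
  then have "t ^ m * exp (- t) \<le> fact (m + 2) / t\<^sup>2" using t by (simp add: field_simps exp_minus del: fact_Suc)
  also have "fact (m + 2) / t\<^sup>2 = fact (m + 2) * x\<^sup>2" by (simp add: t_def power_inverse divide_inverse)
  finally show ?thesis using True t by (simp add: flat_def t_def[symmetric] del: fact_Suc)
qed (simp add: flat_def)

lemma flat_deriv: "(flat m has_real_derivative (flat (m + 2) x - of_nat m * flat (m + 1) x)) (at x)"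
proof (cases x "0 :: real" rule: linorder_cases)
  case less
  have "((\<lambda>x. 0) has_real_derivative 0) (at x)" by simp
  then have "(flat m has_real_derivative 0) (at x)"
    by (rule has_field_derivative_transform_within_open[of _ _ _ "{..<0}"]) (use less in \<open>auto simp: flat_def\<close>)
  then show ?thesis using less by (simp add: flat_def)
next
  case greater
  have "((\<lambda>x. inverse x ^ m * exp (- inverse x)) has_real_derivative
      (of_nat m * inverse x ^ (m - 1) * (- (inverse x * inverse x)) * exp (- inverse x)
        + inverse x ^ m * (exp (- inverse x) * (inverse x * inverse x)))) (at x)"
    using greater by (auto intro!: derivative_eq_intros)
  also have "of_nat m * inverse x ^ (m - 1) * (- (inverse x * inverse x)) * exp (- inverse x)
        + inverse x ^ m * (exp (- inverse x) * (inverse x * inverse x)) = flat (m + 2) x - of_nat m * flat (m + 1) x"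
    using greater by (cases m) (simp_all add: flat_def algebra_simps)
  finally have "((\<lambda>x. inverse x ^ m * exp (- inverse x)) has_real_derivative
      (flat (m + 2) x - of_nat m * flat (m + 1) x)) (at x)" .
  then show ?thesis
    by (rule has_field_derivative_transform_within_open[of _ _ _ "{0<..}"]) (use greater in \<open>auto simp: flat_def\<close>)
next
  case equal
  have "((\<lambda>h. (flat m (0 + h) - flat m 0) / h) \<longlongrightarrow> 0) (at 0)"
  proof (rule Lim_null_comparison)
    show "\<forall>\<^sub>F h in at 0. norm ((flat m (0 + h) - flat m 0) / h) \<le> fact (m + 2) * \<bar>h\<bar>"
      using flat_bound[of m] 
      by (intro always_eventually allI) (auto simp: flat_def[of m 0] divide_simps power2_eq_square abs_mult mult.assoc simp del: fact_Suc)
    show "((\<lambda>h. fact (m + 2) * \<bar>h\<bar>) \<longlongrightarrow> 0) (at (0::real))"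
      by (intro tendsto_eq_intros) auto
  qed
  then show ?thesis using equal by (simp add: DERIV_def flat_def)
qed

text \<open>The induction runs over all \<open>m\<close> at once, because one differentiation of
  \<open>flat m\<close> produces \<open>flat (m + 1)\<close> and \<open>flat (m + 2)\<close>, times
  a derivative of \<open>q\<close>.\<close>

lemma C_k_flat:
  fixes q :: "'a::euclidean_space \<Rightarrow> real"
  assumes "\<And>k. C_k k (\<lambda>p. complex_of_real (q p))" "\<And>p. q differentiable (at p)"
  shows "C_k k (\<lambda>p. complex_of_real (flat m (q p)))"
proof (induction k arbitrary: m)
  case 0
  have "continuous_on UNIV (flat m)"
    using flat_deriv by (meson DERIV_isCont continuous_at_imp_continuous_on)
  moreover have "continuous_on UNIV q"
    using assms(2) by (meson continuous_at_imp_continuous_on differentiable_imp_continuous_within)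
  ultimately have "continuous_on UNIV (\<lambda>p. flat m (q p))" by (rule continuous_on_compose2) simp
  then show ?case by (simp add: continuous_on_of_real)
next
  case (Suc k)
  have dq: "(q has_derivative frechet_derivative q (at p)) (at p)" for p
    using assms(2) frechet_derivative_works by blast
  let ?D = "\<lambda>p. flat (m + 2) (q p) - of_nat m * flat (m + 1) (q p)"
  have d: "((\<lambda>p. complex_of_real (flat m (q p))) has_derivative
      (\<lambda>h. complex_of_real (?D p * frechet_derivative q (at p) h))) (at p)" for p
    by (intro has_derivative_of_real has_derivative_eq_rhs[OF has_derivative_compose[OF dq flat_deriv[unfolded has_field_derivative_def]]])
      (simp add: fun_eq_iff)
  have pq: "complex_of_real (frechet_derivative q (at p) b) = partial_deriv b (\<lambda>p. complex_of_real (q p)) p" for p b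
    using partial_deriv_eq[OF has_derivative_of_real[OF dq]] by simp
  have "partial_deriv b (\<lambda>p. complex_of_real (flat m (q p))) = (\<lambda>p. 
      (complex_of_real (flat (m + 2) (q p)) - of_nat m * complex_of_real (flat (m + 1) (q p)))
        * partial_deriv b (\<lambda>p. complex_of_real (q p)) p)" for b
    by (rule ext) (simp add: partial_deriv_eq[OF d] pq[symmetric])
  moreover have "C_k k (partial_deriv b (\<lambda>p. complex_of_real (q p)))" if "b \<in> Basis" for b
    using assms(1)[of "Suc k"] that by simp
  ultimately show ?case using d Suc.IH by (auto simp: differentiable_def intro!: C_k_mult C_k_diff C_k_const)
qed

text \<open>A smooth function carried by the box with corners \<open>l\<close> and \<open>u\<close>.
  Since \<open>flat 0 x = exp (- 1/x)\<close> for positive \<open>x\<close>, the factor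
  \<open>N\<close> drives the values inside to 1, so integrals over boxes become limits of integrals
  against test functions.\<close>

definition bump :: "nat \<Rightarrow> 'a::euclidean_space \<Rightarrow> 'a \<Rightarrow> 'a \<Rightarrow> complex" where
  "bump N l u p = (\<Prod>b\<in>Basis. of_real (flat 0 (real N * ((p \<bullet> b - l \<bullet> b) * (u \<bullet> b - p \<bullet> b)))))"

lemma C_k_bump: "C_k k (bump N l u)"
proof -
  have "C_k k (\<lambda>p. complex_of_real (flat 0 (real N * ((p \<bullet> b - l \<bullet> b) * (u \<bullet> b - p \<bullet> b)))))" for b :: 'a and k
  proof (rule C_k_flat)
    fix k
    have "bounded_linear (\<lambda>p::'a. complex_of_real (p \<bullet> b))"
      by (intro bounded_linear_compose[OF bounded_linear_of_real] bounded_linear_inner_left)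
    then have 1: "C_k k (\<lambda>p::'a. complex_of_real (p \<bullet> b))" by (rule C_k_linear)
    have "C_k k (\<lambda>p. of_nat N * ((complex_of_real (p \<bullet> b) + of_real (- (l \<bullet> b))) * (of_real (u \<bullet> b) + (-1) * complex_of_real (p \<bullet> b))))"
      by (intro C_k_mult C_k_add C_k_const 1)
    then show "C_k k (\<lambda>p. complex_of_real (real N * ((p \<bullet> b - l \<bullet> b) * (u \<bullet> b - p \<bullet> b))))" by simp
  next
    fix p show "(\<lambda>p. real N * ((p \<bullet> b - l \<bullet> b) * (u \<bullet> b - p \<bullet> b))) differentiable (at p)"
      by (intro differentiable_mult differentiable_diff differentiable_const
          bounded_linear_imp_differentiable bounded_linear_inner_left)
  qed
  then show ?thesis unfolding bump_def[abs_def] by (intro C_k_prod)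
qed

text \<open>With the corners in order the two factors in an argument of \<open>flat 0\<close> cannot
  both be negative, so their product is positive only between the corners.\<close>

lemma bump_nonzero_iff: "N > 0 \<Longrightarrow> (\<forall>b\<in>Basis. l \<bullet> b \<le> u \<bullet> b) \<Longrightarrow> bump N l u p \<noteq> 0 \<longleftrightarrow> p \<in> box l u"
  by (auto simp: bump_def flat_def mem_box zero_less_mult_iff) (smt (verit))+

lemma bump_bounded: "cmod (bump N l u p) \<le> 1"
proof -
  have "\<bar>flat 0 x\<bar> \<le> 1" for x by (simp add: flat_def)
  then show ?thesis unfolding bump_def prod_norm[symmetric]
    by (intro prod_le_1) auto
qed

lemma bump_tendsto:
  assumes lu: "\<forall>b\<in>Basis. l \<bullet> b \<le> u \<bullet> b"
  shows "(\<lambda>N. bump N l u p) \<longlonglongrightarrow> indicator (box l u) p"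
proof (cases "p \<in> box l u")
  case False
  then have "bump N l u p = 0" for N using bump_nonzero_iff[OF _ lu, of N p]
    by (cases "N = 0") (auto simp: bump_def flat_def)
  then show ?thesis using False by simp
next
  case True
  have "(\<lambda>N. complex_of_real (flat 0 (real N * ((p \<bullet> b - l \<bullet> b) * (u \<bullet> b - p \<bullet> b))))) \<longlonglongrightarrow> of_real 1" if b: "b \<in> Basis" for b
  proof (rule tendsto_of_real)
    define c where "c = (p \<bullet> b - l \<bullet> b) * (u \<bullet> b - p \<bullet> b)"
    have c: "c > 0" using True b by (auto simp: c_def mem_box)
    have "(\<lambda>N. exp (- (inverse (real N) * inverse c))) \<longlonglongrightarrow> exp (- (0 * inverse c))"
      by (intro tendsto_intros lim_inverse_n)
    then have "(\<lambda>N. exp (- inverse (real N * c))) \<longlonglongrightarrow> 1" by simp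
    then show "(\<lambda>N. flat 0 (real N * c)) \<longlonglongrightarrow> 1"
    proof (rule Lim_transform_eventually)
      show "\<forall>\<^sub>F N in sequentially. exp (- inverse (real N * c)) = flat 0 (real N * c)"
        using eventually_gt_at_top[of "0::nat"] by eventually_elim (use c in \<open>simp add: flat_def\<close>)
    qed
  qed
  then have "(\<lambda>N. bump N l u p) \<longlonglongrightarrow> (\<Prod>b\<in>(Basis::'a set). of_real 1)" unfolding bump_def by (rule tendsto_prod)
  then show ?thesis using True by simp
qed

section \<open>Test functions and the fundamental lemma of the calculus of variations\<close>

lemma test_funI:
  assumes "\<And>k. C_k k \<phi>" "compact K" "\<And>p. \<phi> p \<noteq> 0 \<Longrightarrow> p \<in> K" "K \<subseteq> \<Omega>"
  shows "\<phi> \<in> test_fun \<Omega>"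
proof -
  have "closure {p. \<phi> p \<noteq> 0} \<subseteq> K" using assms by (intro closure_minimal compact_imp_closed) auto
  moreover from this have "compact (closure {p. \<phi> p \<noteq> 0})"
    using compact_Int_closed[OF assms(2) closed_closure] by (metis inf.absorb2)
  ultimately show ?thesis using assms by (auto simp: test_fun_def)
qed

lemma test_funE:
  assumes "\<phi> \<in> test_fun \<Omega>"
  obtains K where "\<And>k. C_k k \<phi>" "compact K" "\<And>p. p \<notin> K \<Longrightarrow> \<phi> p = 0" "K \<subseteq> \<Omega>"
  by (rule that[of "closure {p. \<phi> p \<noteq> 0}"]) (use assms closure_subset[of "{p. \<phi> p \<noteq> 0}"] in \<open>auto simp: test_fun_def\<close>)

lemma bump_test_fun: "\<forall>b\<in>Basis. l \<bullet> b \<le> u \<bullet> b \<Longrightarrow> cbox l u \<subseteq> \<Omega> \<Longrightarrow> bump N l u \<in> test_fun \<Omega>"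
  using box_subset_cbox[of l u] bump_nonzero_iff[of N l u]
  by (intro test_funI[of _ "cbox l u"] C_k_bump) (cases "N = 0"; auto simp: bump_def flat_def)+

lemma test_fun_mult:
  "\<phi> \<in> test_fun \<Omega> \<Longrightarrow> (\<And>k. C_k k \<psi>) \<Longrightarrow> (\<lambda>p. \<phi> p * \<psi> p) \<in> test_fun \<Omega>"
proof (erule test_funE)
  fix K assume "\<And>k. C_k k \<phi>" "\<And>k. C_k k \<psi>" "compact K" "\<And>p. p \<notin> K \<Longrightarrow> \<phi> p = 0" "K \<subseteq> \<Omega>"
  then show ?thesis by (intro test_funI[of _ K] C_k_mult) auto
qed

lemma test_fun_add: 
  assumes "\<phi> \<in> test_fun \<Omega>" "\<psi> \<in> test_fun \<Omega>"
  shows "(\<lambda>p. \<phi> p + \<psi> p) \<in> test_fun \<Omega>"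
proof -
  obtain K where K: "\<And>k. C_k k \<phi>" "compact K" "\<And>p. p \<notin> K \<Longrightarrow> \<phi> p = 0" "K \<subseteq> \<Omega>" by (rule test_funE[OF assms(1)]) (rule that)
  obtain L where L: "\<And>k. C_k k \<psi>" "compact L" "\<And>p. p \<notin> L \<Longrightarrow> \<psi> p = 0" "L \<subseteq> \<Omega>" by (rule test_funE[OF assms(2)]) (rule that)
  have "p \<in> K \<union> L" if "\<phi> p + \<psi> p \<noteq> 0" for p using K(3)[of p] L(3)[of p] that by (cases "p \<in> K"; cases "p \<in> L") auto
  then show ?thesis using K L by (intro test_funI[of _ "K \<union> L"] C_k_add) auto
qed

lemma compact_support_bounded:
  fixes \<phi> :: "'a::euclidean_space \<Rightarrow> complex"
  assumes "continuous_on UNIV \<phi>" "compact K" "\<And>p. p \<notin> K \<Longrightarrow> \<phi> p = 0"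
  obtains B where "\<And>p. cmod (\<phi> p) \<le> B" "B \<ge> 0"
proof -
  have "bounded (\<phi> ` K)"
    using assms by (intro compact_imp_bounded compact_continuous_image continuous_on_subset[OF assms(1)]) auto
  then obtain B where B: "\<And>p. p \<in> K \<Longrightarrow> cmod (\<phi> p) \<le> B" by (auto simp: bounded_iff)
  then have "cmod (\<phi> p) \<le> max B 0" for p using assms(3) by (cases "p \<in> K") (auto simp: le_max_iff_disj)
  then show thesis by (rule that) simp
qed

lemma compact_support_integrable:
  fixes f :: "'a::euclidean_space \<Rightarrow> complex"
  assumes "continuous_on UNIV f" "compact K" "\<And>p. p \<notin> K \<Longrightarrow> f p = 0"
  shows "integrable lborel f"
proof -
  have "integrable lborel (\<lambda>p. indicator K p *\<^sub>R f p)"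
    by (rule borel_integrable_compact[OF assms(2)]) (rule continuous_on_subset[OF assms(1)], simp)
  also have "(\<lambda>p. indicator K p *\<^sub>R f p) = f" using assms(3) by (auto simp: fun_eq_iff indicator_def)
  finally show ?thesis .
qed

lemma derivative_zero_outside:
  assumes "closed K" "\<And>p. p \<notin> K \<Longrightarrow> f p = 0" "p \<notin> K"
  shows "frechet_derivative f (at p) = (\<lambda>_. 0)"
proof -
  have "(f has_derivative (\<lambda>_. 0)) (at p)"
    by (rule has_derivative_transform_within_open[OF has_derivative_const[of 0], of "- K"])
      (use assms in auto)
  then show ?thesis by (rule frechet_derivative_at[symmetric])
qed

text \<open>Difference quotients in direction \<open>b\<close> have integral zero by translation
  invariance of Lebesgue measure, and they converge to the derivative under a common bound; so the
  integral is never sliced along \<open>b\<close>.\<close>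

lemma integral_partial_deriv_zero:
  fixes f :: "'a::euclidean_space \<Rightarrow> complex"
  assumes d: "\<And>p. f differentiable (at p)" and c: "continuous_on UNIV (partial_deriv b f)"
    and K: "compact K" "\<And>p. p \<notin> K \<Longrightarrow> f p = 0"
  shows "(LINT p|lborel. partial_deriv b f p) = 0"
proof -
  have fc: "continuous_on UNIV f"
    using d by (meson continuous_at_imp_continuous_on differentiable_imp_continuous_within)
  have z: "partial_deriv b f p = 0" if "p \<notin> K" for p
    using derivative_zero_outside[OF compact_imp_closed[OF K(1)] K(2) that] by (simp add: partial_deriv_def)
  obtain M where M: "\<And>p. cmod (partial_deriv b f p) \<le> M" "M \<ge> 0" by (rule compact_support_bounded[OF c K(1) z]) auto
  obtain R where R: "\<And>p. p \<in> K \<Longrightarrow> norm p \<le> R" using compact_imp_bounded[OF K(1)] by (auto simp: bounded_iff)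
  define g where "g k p = real (Suc k) *\<^sub>R (f (p + inverse (real (Suc k)) *\<^sub>R b) - f p)" for k p
  have line: "((\<lambda>s. f (p + s *\<^sub>R b)) has_vector_derivative partial_deriv b f (p + s *\<^sub>R b)) (at s within S)" for p s S
  proof -
    have "(f has_derivative frechet_derivative f (at (p + s *\<^sub>R b))) (at (p + s *\<^sub>R b))"
      using d frechet_derivative_works by blast
    then have "((\<lambda>s. f (p + s *\<^sub>R b)) has_derivative (\<lambda>h. frechet_derivative f (at (p + s *\<^sub>R b)) (h *\<^sub>R b))) (at s within S)"
      by (intro has_derivative_compose[where f = "\<lambda>s. p + s *\<^sub>R b" and g = f]) (auto intro!: derivative_eq_intros)
    moreover have "frechet_derivative f (at q) (h *\<^sub>R b) = h *\<^sub>R partial_deriv b f q" for h q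
      using linear_frechet_derivative[OF d] by (simp add: partial_deriv_def linear_cmul)
    ultimately show ?thesis by (simp add: has_vector_derivative_def)
  qed
  have "(\<lambda>k. LINT p|lborel. g k p) \<longlonglongrightarrow> (LINT p|lborel. partial_deriv b f p)"
  proof (rule integral_dominated_convergence)
    show "partial_deriv b f \<in> borel_measurable lborel" using c by (simp add: borel_measurable_continuous_onI)
    have "continuous_on UNIV (g k)" for k
      unfolding g_def by (intro continuous_intros continuous_on_compose2[OF fc]) auto
    then show "g k \<in> borel_measurable lborel" for k by (simp add: borel_measurable_continuous_onI)
    \<comment> \<open>Only points of this ball can lie in \<open>K\<close> or be moved into
      \<open>K\<close> by a shift of at most the length of \<open>b\<close>.\<close>
    show "integrable lborel (\<lambda>p. M * indicator (cball 0 (R + norm b)) p)"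
      by (intro integrable_mult_right integrable_real_indicator emeasure_lborel_cball_finite) auto
    show "AE p in lborel. (\<lambda>k. g k p) \<longlonglongrightarrow> partial_deriv b f p"
    proof (rule AE_I2)
      fix p
      let ?F = "\<lambda>s. f (p + s *\<^sub>R b)" and ?d = "partial_deriv b f p" and ?h = "\<lambda>k. inverse (real (Suc k))"
      have "(\<lambda>h. norm (?F (0 + h) - ?F 0 - h *\<^sub>R ?d) / norm h) \<midarrow>0\<rightarrow> 0"
        using line[of p 0 UNIV] by (simp add: has_vector_derivative_def has_derivative_at)
      moreover have "filterlim ?h (at 0) sequentially"
        by (rule filterlim_atI[OF LIMSEQ_inverse_real_of_nat]) (auto intro!: always_eventually)
      ultimately have "(\<lambda>k. norm (?F (0 + ?h k) - ?F 0 - ?h k *\<^sub>R ?d) / norm (?h k)) \<longlonglongrightarrow> 0"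
        by (rule filterlim_compose)
      moreover have "norm (?F (0 + ?h k) - ?F 0 - ?h k *\<^sub>R ?d) / norm (?h k) = norm (g k p - ?d)" for k
      proof -
        have "real (Suc k) *\<^sub>R (?h k *\<^sub>R ?d) = ?d" by (simp only: scaleR_scaleR) simp
        then have "g k p - ?d = real (Suc k) *\<^sub>R (?F (0 + ?h k) - ?F 0 - ?h k *\<^sub>R ?d)"
          by (simp only: g_def scaleR_diff_right add_0 scaleR_zero_left add_0_right)
        then have "norm (g k p - ?d) = real (Suc k) * norm (?F (0 + ?h k) - ?F 0 - ?h k *\<^sub>R ?d)"
          by (simp only: norm_scaleR abs_of_nat)
        also have "\<dots> = norm (?F (0 + ?h k) - ?F 0 - ?h k *\<^sub>R ?d) / norm (?h k)"
          by (simp only: real_norm_def abs_inverse abs_of_nat divide_inverse inverse_inverse_eq mult.commute)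
        finally show ?thesis by (rule sym)
      qed
      ultimately have "(\<lambda>k. norm (g k p - ?d)) \<longlonglongrightarrow> 0" by (simp only:)
      then show "(\<lambda>k. g k p) \<longlonglongrightarrow> ?d" by (rule LIM_zero_cancel[OF tendsto_norm_zero_cancel])
    qed
    show "AE p in lborel. norm (g k p) \<le> M * indicator (cball 0 (R + norm b)) p" for k
    proof (rule AE_I2)
      fix p
      let ?h = "inverse (real (Suc k))"
      show "norm (g k p) \<le> M * indicator (cball 0 (R + norm b)) p"
      proof (cases "p \<in> cball 0 (R + norm b)")
        case True
        have "norm (f (p + ?h *\<^sub>R b) - f (p + 0 *\<^sub>R b)) \<le> M * norm (?h - 0)"
        proof (rule differentiable_bound[OF convex_UNIV])
          fix s show "((\<lambda>s. f (p + s *\<^sub>R b)) has_derivative (\<lambda>x. x *\<^sub>R partial_deriv b f (p + s *\<^sub>R b))) (at s within UNIV)"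
            using line by (simp add: has_vector_derivative_def)
          show "onorm (\<lambda>x. x *\<^sub>R partial_deriv b f (p + s *\<^sub>R b)) \<le> M"
            by (rule onorm_bound[OF M(2)]) (simp add: mult.commute[of M] mult_left_mono M(1))
        qed auto
        then have "real (Suc k) * norm (f (p + ?h *\<^sub>R b) - f p) \<le> real (Suc k) * (M * ?h)" by (intro mult_left_mono) auto
        also have "real (Suc k) * (M * ?h) = M" by (simp add: field_simps)
        finally have "norm (g k p) \<le> M" unfolding g_def norm_scaleR abs_of_nat .
        then show ?thesis using True by simp
      next
        case False
        then have n: "norm p > R + norm b" by simp
        have "norm (?h *\<^sub>R b) \<le> norm b" by (simp add: field_simps mult_le_cancel_left1)
        then have "norm (p + ?h *\<^sub>R b) > R" using n norm_diff_ineq[of p "?h *\<^sub>R b"] by linarith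
        moreover have "norm p > R" using n norm_ge_zero[of b] by linarith
        ultimately have "p \<notin> K" "p + ?h *\<^sub>R b \<notin> K" using R by (auto simp: not_le[symmetric])
        then show ?thesis using False K(2) by (simp add: g_def)
      qed
    qed
  qed
  moreover have "(LINT p|lborel. g k p) = 0" for k
  proof -
    let ?h = "inverse (real (Suc k)) *\<^sub>R b"
    have fi: "integrable lborel f" by (rule compact_support_integrable[OF fc K])
    have "integrable (distr lborel borel ((+) ?h)) f" using fi by (simp add: lborel_distr_plus)
    then have i: "integrable lborel (\<lambda>p. f (?h + p))" by (subst (asm) integrable_distr_eq) (use fc in \<open>auto simp: borel_measurable_continuous_onI\<close>)
    have "(LINT p|lborel. f p) = (LINT p|distr lborel borel ((+) ?h). f p)" by (simp add: lborel_distr_plus)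
    also have "\<dots> = (LINT p|lborel. f (?h + p))" by (rule integral_distr) (use fc in \<open>auto simp: borel_measurable_continuous_onI\<close>)
    finally show ?thesis using fi i unfolding g_def by (simp add: add.commute)
  qed
  ultimately show ?thesis by (simp add: LIMSEQ_const_iff)
qed

text \<open>\<open>ennreal\<close> cuts off negative values, so the two densities are the positive
  and the negative part of \<open>w\<close>. The measures they define agree on boxes, an
  intersection-stable generator of the Borel sets, hence everywhere; and densities are unique almost
  everywhere.\<close>

lemma AE_zero_if_box_integrals_zero:
  fixes w :: "'a::euclidean_space \<Rightarrow> real"
  assumes w: "integrable lborel w" and z: "\<And>l u. (LINT p|lborel. indicator (box l u) p * w p) = 0"
  shows "AE p in lborel. w p = 0"
proof -
  have wm [measurable]: "w \<in> borel_measurable borel" using w by auto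
  have "density lborel (\<lambda>p. ennreal (w p)) = density lborel (\<lambda>p. ennreal (- w p))"
  proof (rule measure_eqI_generator_eq[where A = "\<lambda>i::nat. box (- (real i *\<^sub>R One)) (real i *\<^sub>R One)"
        and E = "range (\<lambda>(l, u). box l u)" and \<Omega> = UNIV])
    show "Int_stable (range (\<lambda>(l, u). box l u :: 'a set))"
      by (auto simp: Int_stable_def box_Int_box)
    show "sets (density lborel (\<lambda>p. ennreal (w p))) = sigma_sets UNIV (range (\<lambda>(l, u). box l u))"
      "sets (density lborel (\<lambda>p. ennreal (- w p))) = sigma_sets UNIV (range (\<lambda>(l, u). box l u))"
      by (simp_all add: borel_eq_box)
    fix X :: "'a set" assume "X \<in> range (\<lambda>(l, u). box l u)"
    then obtain l u where X: "X = box l u" by auto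
    have i1: "integrable lborel (\<lambda>p. indicator X p * max 0 (w p))" "integrable lborel (\<lambda>p. indicator X p * max 0 (- w p))"
      using w integrable_mult_indicator[of X lborel "\<lambda>p. max 0 (w p)"] integrable_mult_indicator[of X lborel "\<lambda>p. max 0 (- w p)"]
      by (auto simp: X intro!: integrable_max)
    have "(LINT p|lborel. indicator X p * max 0 (w p)) - (LINT p|lborel. indicator X p * max 0 (- w p))
        = (LINT p|lborel. indicator X p * w p)"
      by (subst Bochner_Integration.integral_diff[OF i1, symmetric]) (auto intro!: Bochner_Integration.integral_cong simp: max_def)
    then have eq: "(LINT p|lborel. indicator X p * max 0 (w p)) = (LINT p|lborel. indicator X p * max 0 (- w p))"
      using z X by simp
    have "emeasure (density lborel (\<lambda>p. ennreal (w p))) X = (\<integral>\<^sup>+p. ennreal (indicator X p * max 0 (w p)) \<partial>lborel)"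
      unfolding X by (subst emeasure_density) (auto intro!: nn_integral_cong simp: indicator_def max_def ennreal_neg)
    also have "\<dots> = (\<integral>\<^sup>+p. ennreal (indicator X p * max 0 (- w p)) \<partial>lborel)"
      by (simp add: nn_integral_eq_integral[OF i1(1)] nn_integral_eq_integral[OF i1(2)] eq)
    also have "\<dots> = emeasure (density lborel (\<lambda>p. ennreal (- w p))) X"
      unfolding X by (subst emeasure_density) (auto intro!: nn_integral_cong simp: indicator_def max_def ennreal_neg)
    finally show "emeasure (density lborel (\<lambda>p. ennreal (w p))) X = emeasure (density lborel (\<lambda>p. ennreal (- w p))) X" .
  next
    fix i
    have "emeasure (density lborel (\<lambda>p. ennreal (w p))) (box (- (real i *\<^sub>R One)) (real i *\<^sub>R One)) \<le> (\<integral>\<^sup>+p. ennreal (norm (w p)) \<partial>lborel)"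
      by (subst emeasure_density) (auto intro!: nn_integral_mono simp: indicator_def intro: ennreal_leI)
    also have "\<dots> < \<infinity>" using w by (simp add: integrable_iff_bounded)
    finally show "emeasure (density lborel (\<lambda>p. ennreal (w p))) (box (- (real i *\<^sub>R One)) (real i *\<^sub>R One)) \<noteq> \<infinity>" by simp
  qed (auto simp: UN_box_eq_UNIV)
  then have "AE p in lborel. ennreal (w p) = ennreal (- w p)"
    by (intro sigma_finite_measure.density_unique[OF lborel.sigma_finite_measure_axioms]) auto
  then show ?thesis
  proof eventually_elim
    case (elim p)
    then show ?case by (cases "w p \<ge> 0") (auto simp: ennreal_neg ennreal_eq_0_iff not_le)
  qed
qed

text \<open>Reduction to the Borel case: real and imaginary parts are treated separately, each
  replaced by a Borel function equal to it almost everywhere.\<close>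

lemma AE_zero_if_box_integrals_zero_lebesgue:
  fixes w :: "'a::euclidean_space \<Rightarrow> complex"
  assumes w: "integrable lebesgue w" and z: "\<And>l u. (LINT p|lebesgue. indicator (box l u) p *\<^sub>R w p) = 0"
  shows "AE p in lebesgue. w p = 0"
proof -
  have real: "AE p in lebesgue. v p = 0" 
    if v: "integrable lebesgue v" "\<And>l u. (LINT p|lebesgue. indicator (box l u) p * v p) = 0" for v :: "'a \<Rightarrow> real"
  proof -
    obtain v' where v': "v' \<in> borel_measurable lborel" "AE p in lborel. v p = v' p"
      using completion_ex_borel_measurable_real[of v lborel] v(1) by auto
    have ae: "AE p in lebesgue. v p = v' p" using v'(2) by (rule AE_completion)
    have m: "v' \<in> borel_measurable lebesgue" using v'(1) by (rule measurable_completion)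
    have "integrable lebesgue v'" using integrable_cong_AE_imp[OF v(1) m] ae by auto
    then have i: "integrable lborel v'" using v'(1) by (simp add: integrable_completion)
    have "(LINT p|lborel. indicator (box l u) p * v' p) = 0" for l u
    proof -
      have "(LINT p|lborel. indicator (box l u) p * v' p) = (LINT p|lebesgue. indicator (box l u) p * v' p)"
        using v'(1) by (subst integral_completion) auto
      also have "\<dots> = (LINT p|lebesgue. indicator (box l u) p * v p)"
      proof (rule integral_cong_AE)
        show "(\<lambda>p. indicator (box l u) p * v' p) \<in> borel_measurable lebesgue"
          "(\<lambda>p. indicator (box l u) p * v p) \<in> borel_measurable lebesgue"
          by (intro borel_measurable_times borel_measurable_indicator m borel_measurable_integrable[OF v(1)]; simp)+
      qed (use ae in auto)
      finally show ?thesis using v(2) by simp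
    qed
    then have "AE p in lborel. v' p = 0" by (rule AE_zero_if_box_integrals_zero[OF i])
    then have "AE p in lebesgue. v' p = 0" by (rule AE_completion)
    then show ?thesis using ae by eventually_elim simp
  qed
  have iw: "integrable lebesgue (\<lambda>p. indicator (box l u) p *\<^sub>R w p)" for l u
    using w by (intro integrable_mult_indicator) auto
  have "AE p in lebesgue. Re (w p) = 0"
    using w z[THEN arg_cong[of _ _ Re]] integral_Re[OF iw, symmetric] by (intro real) auto
  moreover have "AE p in lebesgue. Im (w p) = 0"
    using w z[THEN arg_cong[of _ _ Im]] integral_Im[OF iw, symmetric] by (intro real) auto
  ultimately show ?thesis by eventually_elim (simp add: complex_eq_iff)
qed

lemma compact_support_L2:
  fixes \<phi> :: "'a::euclidean_space \<Rightarrow> complex"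
  assumes c: "continuous_on UNIV \<phi>" and K: "compact K" "\<And>p. p \<notin> K \<Longrightarrow> \<phi> p = 0" and [measurable]: "\<Omega> \<in> sets lebesgue"
  shows "\<phi> \<in> L2 \<Omega>"
proof -
  have "integrable lborel (\<lambda>p. \<phi> p * cnj (\<phi> p))"
    by (rule compact_support_integrable[OF _ K(1)]) (use c K in \<open>auto intro!: continuous_intros\<close>)
  then have "integrable lborel (\<lambda>p. complex_of_real ((cmod (\<phi> p))\<^sup>2))" by (simp only: complex_norm_square)
  then have "integrable lborel (\<lambda>p. (cmod (\<phi> p))\<^sup>2)" by (auto dest: integrable_Re)
  then have "integrable lebesgue (\<lambda>p. (cmod (\<phi> p))\<^sup>2)"
    using borel_measurable_continuous_onI[OF c] by (subst integrable_completion) auto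
  then have "integrable (lebesgue_on \<Omega>) (\<lambda>p. (cmod (\<phi> p))\<^sup>2)"
    using integrable_mult_indicator[of \<Omega> lebesgue "\<lambda>p. (cmod (\<phi> p))\<^sup>2"]
    by (subst integrable_restrict_space) auto
  moreover have "\<phi> \<in> borel_measurable (lebesgue_on \<Omega>)"
    using borel_measurable_continuous_onI[OF c] by (intro measurable_restrict_space1 measurable_completion) simp
  ultimately show ?thesis by (simp add: L2_def)
qed

lemma test_fun_in_L2: "\<phi> \<in> test_fun \<Omega> \<Longrightarrow> \<Omega> \<in> sets lebesgue \<Longrightarrow> \<phi> \<in> L2 \<Omega>"
  by (erule test_funE) (rule compact_support_L2[OF C_k_continuous])

text \<open>The argument is local. On a closed box in \<Omega> with bump function \<xi>, the product
  of \<xi> with any further bump function is again a test function, although the second box may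
  leave \<Omega>; in the limit \<open>g \<xi>\<close> integrates to zero over every box. Hence
  \<open>g = 0\<close> almost everywhere where \<xi> is non-zero, and countably many boxes fill
  \<Omega>.\<close>

lemma AE_zero_if_test_integrals_zero:
  fixes g :: "'a::euclidean_space \<Rightarrow> complex"
  assumes \<Omega>: "open \<Omega>" and g: "g \<in> L2 \<Omega>"
    and z: "\<And>\<phi>. \<phi> \<in> test_fun \<Omega> \<Longrightarrow> (LINT p|lebesgue_on \<Omega>. g p * \<phi> p) = 0"
  shows "AE p in lebesgue_on \<Omega>. g p = 0"
proof -
  have [measurable]: "\<Omega> \<in> sets lebesgue" using \<Omega> by (simp add: borel_open)
  have cb: "AE p in lebesgue. p \<in> cbox l u \<longrightarrow> g p = 0" if lu: "cbox l u \<subseteq> \<Omega>" for l u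
  proof (cases "\<forall>b\<in>Basis. l \<bullet> b \<le> u \<bullet> b")
    case False
    then have "cbox l u = {}" by (auto simp: box_eq_empty not_le)
    then show ?thesis by simp
  next
    case True
    define \<xi> where "\<xi> = bump 1 l u"
    have \<xi>: "\<xi> \<in> test_fun \<Omega>" unfolding \<xi>_def by (rule bump_test_fun[OF True lu])
    have \<xi>C: "C_k k \<xi>" for k unfolding \<xi>_def by (rule C_k_bump)
    have i: "integrable (lebesgue_on \<Omega>) (\<lambda>p. g p * \<xi> p)"
      by (intro L2_mult_integrable g test_fun_in_L2 \<xi>) simp
    define w where "w p = indicator \<Omega> p *\<^sub>R (g p * \<xi> p)" for p
    have "AE p in lebesgue. w p = 0"
    proof (rule AE_zero_if_box_integrals_zero_lebesgue)
      show "integrable lebesgue w" using i unfolding w_def by (subst (asm) integrable_restrict_space) auto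
      fix l' u' :: 'a
      have eq: "(LINT p|lebesgue. indicator (box l' u') p *\<^sub>R w p) = (LINT p|lebesgue_on \<Omega>. indicator (box l' u') p *\<^sub>R (g p * \<xi> p))"
        unfolding w_def by (subst integral_restrict_space) (auto intro!: Bochner_Integration.integral_cong)
      show "(LINT p|lebesgue. indicator (box l' u') p *\<^sub>R w p) = 0"
      proof (cases "\<forall>b\<in>Basis. l' \<bullet> b \<le> u' \<bullet> b")
        case False
        then have "box l' u' = {}" by (meson box_eq_empty(1) less_imp_le not_le)
        then show ?thesis by simp
      next
        case t: True
        have "(\<lambda>N. LINT p|lebesgue_on \<Omega>. g p * (\<xi> p * bump N l' u' p)) \<longlonglongrightarrow> (LINT p|lebesgue_on \<Omega>. indicator (box l' u') p *\<^sub>R (g p * \<xi> p))"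
        proof (rule integral_dominated_convergence)
          show "integrable (lebesgue_on \<Omega>) (\<lambda>p. norm (g p * \<xi> p))" using i by (rule integrable_norm)
          show "(\<lambda>p. indicator (box l' u') p *\<^sub>R (g p * \<xi> p)) \<in> borel_measurable (lebesgue_on \<Omega>)"
            using i by (intro borel_measurable_scaleR borel_measurable_indicator borel_measurable_integrable measurable_restrict_space1) (auto simp: sets_restrict_space)
          fix N
          show "(\<lambda>p. g p * (\<xi> p * bump N l' u' p)) \<in> borel_measurable (lebesgue_on \<Omega>)"
            by (intro borel_measurable_integrable L2_mult_integrable g test_fun_in_L2 test_fun_mult \<xi> C_k_bump) simp
          show "AE p in lebesgue_on \<Omega>. norm (g p * (\<xi> p * bump N l' u' p)) \<le> norm (g p * \<xi> p)"
            using bump_bounded[of N l' u'] by (auto simp: norm_mult mult.assoc[symmetric] intro!: mult_left_le)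
        next
          show "AE p in lebesgue_on \<Omega>. (\<lambda>N. g p * (\<xi> p * bump N l' u' p)) \<longlonglongrightarrow> indicator (box l' u') p *\<^sub>R (g p * \<xi> p)"
          proof (rule AE_I2)
            fix p
            have "(\<lambda>N. g p * (\<xi> p * bump N l' u' p)) \<longlonglongrightarrow> g p * (\<xi> p * indicator (box l' u') p)"
              by (intro tendsto_intros bump_tendsto[OF t])
            then show "(\<lambda>N. g p * (\<xi> p * bump N l' u' p)) \<longlonglongrightarrow> indicator (box l' u') p *\<^sub>R (g p * \<xi> p)"
              by (cases "p \<in> box l' u'") simp_all
          qed
        qed
        moreover have "(LINT p|lebesgue_on \<Omega>. g p * (\<xi> p * bump N l' u' p)) = 0" for N
          by (intro z test_fun_mult \<xi> C_k_bump)
        ultimately show ?thesis unfolding eq by (simp add: LIMSEQ_const_iff)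
      qed
    qed
    \<comment> \<open>On the faces of the box \<xi> vanishes and gives no information about
      \<open>g\<close>; they form a null set.\<close>
    moreover have "AE p in lebesgue. p \<notin> cbox l u - box l u"
      by (intro AE_not_in) (simp add: negligible_iff_null_sets[symmetric] negligible_frontier_interval)
    ultimately show ?thesis
    proof eventually_elim
      case (elim p)
      show ?case
      proof
        assume p: "p \<in> cbox l u"
        then have "p \<in> box l u" "p \<in> \<Omega>" using elim lu by auto
        then have "\<xi> p \<noteq> 0" using bump_nonzero_iff[OF _ True, of 1 p] by (simp add: \<xi>_def)
        then show "g p = 0" using elim(1) \<open>p \<in> \<Omega>\<close> by (simp add: w_def)
      qed
    qed
  qed
  obtain D where D: "countable D" "D \<subseteq> Pow \<Omega>" "\<And>X. X \<in> D \<Longrightarrow> \<exists>a b. X = cbox a b" "\<Union>D = \<Omega>"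
    using open_countable_Union_open_cbox[OF \<Omega>] by metis
  have "AE p in lebesgue. \<forall>X\<in>D. p \<in> X \<longrightarrow> g p = 0"
  proof (subst AE_ball_countable[OF D(1)], intro ballI)
    fix X assume "X \<in> D"
    then show "AE p in lebesgue. p \<in> X \<longrightarrow> g p = 0" using D(2,3) cb by blast
  qed
  then have "AE p in lebesgue. p \<in> \<Omega> \<longrightarrow> g p = 0"
    by eventually_elim (use D(4) in blast)
  then show ?thesis by (subst AE_restrict_space_iff) auto
qed

section \<open>Horizontal derivatives\<close>

lemma C_k_1D:
  assumes "C_k 1 f"
  shows "f differentiable (at p)" "b \<in> Basis \<Longrightarrow> continuous_on UNIV (partial_deriv b f)"
  using assms by auto

text \<open>The fields \<open>X\<^sub>j\<close> and \<open>Y\<^sub>j\<close> are treated uniformly, indexed by \<open>Inl j\<close> and \<open>Inr j\<close>: they are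
  \<open>hdir i + hcoef i \<partial>/\<partial>t\<close>.\<close>

definition hdir :: "'n::finite + 'n \<Rightarrow> 'n heis" where
  "hdir i = (case i of Inl j \<Rightarrow> (axis j 1, 0, 0) | Inr j \<Rightarrow> (0, axis j 1, 0))"

definition hcoef :: "'n::finite + 'n \<Rightarrow> 'n heis \<Rightarrow> real" where
  "hcoef i p = (case i of Inl j \<Rightarrow> 2 * fst (snd p) $ j | Inr j \<Rightarrow> - 2 * fst p $ j)"

definition vdir :: "'n::finite heis" where "vdir = (0, 0, 1)"

definition vf :: "'n::finite + 'n \<Rightarrow> ('n heis \<Rightarrow> complex) \<Rightarrow> 'n heis \<Rightarrow> complex" where
  "vf i \<phi> p = partial_deriv (hdir i) \<phi> p + of_real (hcoef i p) * partial_deriv vdir \<phi> p"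

lemma vf_X_eq: "vf_X j \<phi> = vf (Inl j) \<phi>" and vf_Y_eq: "vf_Y j \<phi> = vf (Inr j) \<phi>"
  by (auto simp: vf_X_def vf_Y_def vf_def hdir_def hcoef_def vdir_def fun_eq_iff)

lemma hdir_Basis: "hdir i \<in> Basis" and vdir_Basis: "vdir \<in> Basis"
  by (simp_all add: hdir_def vdir_def Basis_prod_def image_iff axis_in_Basis_iff zero_prod_def split: sum.split)

lemma hcoef_linear: "bounded_linear (hcoef i)"
proof (cases i)
  case (Inl j)
  have "bounded_linear (\<lambda>p::'a heis. 2 * fst (snd p) $ j)"
    by (intro bounded_linear_const_mult bounded_linear_vec_nth[THEN bounded_linear_compose]
        bounded_linear_fst[THEN bounded_linear_compose] bounded_linear_snd)
  then show ?thesis by (simp add: Inl hcoef_def[abs_def])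
next
  case (Inr j)
  have "bounded_linear (\<lambda>p::'a heis. - 2 * fst p $ j)"
    by (intro bounded_linear_const_mult bounded_linear_vec_nth[THEN bounded_linear_compose] bounded_linear_fst)
  then show ?thesis by (simp add: Inr hcoef_def[abs_def])
qed

lemma hcoef_vdir: "hcoef i vdir = 0"
  by (auto simp: hcoef_def vdir_def split: sum.split)

lemma C_k_hcoef: "C_k k (\<lambda>p. complex_of_real (hcoef i p))"
  by (intro C_k_linear bounded_linear_compose[OF bounded_linear_of_real hcoef_linear])

lemma C_k_vf: "C_k (Suc k) \<phi> \<Longrightarrow> C_k k (vf i \<phi>)"
  unfolding vf_def[abs_def] using hdir_Basis[of i] vdir_Basis
  by (intro C_k_add C_k_mult C_k_hcoef) auto

lemma vf_mult:
  "\<phi> differentiable (at p) \<Longrightarrow> \<psi> differentiable (at p) \<Longrightarrow>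
    vf i (\<lambda>p. \<phi> p * \<psi> p) p = \<phi> p * vf i \<psi> p + vf i \<phi> p * \<psi> p"
  by (simp add: vf_def partial_deriv_mult algebra_simps)

lemma vf_has_derivative: "(\<phi> has_derivative D) (at p) \<Longrightarrow> vf i \<phi> p = D (hdir i) + of_real (hcoef i p) * D vdir"
  by (simp add: vf_def partial_deriv_eq)

lemma vf_zero_outside:
  assumes "closed K" "\<And>p. p \<notin> K \<Longrightarrow> f p = 0" "p \<notin> K"
  shows "vf i f p = 0"
  using derivative_zero_outside[OF assms] by (simp add: vf_def partial_deriv_def)

text \<open>The coefficient \<open>hcoef i\<close> does not depend on t and can be moved under the
  derivative in that direction. This writes \<open>vf i f\<close> as a sum of two partial
  derivatives of compactly supported functions.\<close>

lemma integral_vf_zero: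
  assumes f: "C_k 1 f" and K: "compact K" "\<And>p. p \<notin> K \<Longrightarrow> f p = 0"
  shows "(LINT p|lborel. vf i f p) = 0"
proof -
  have f': "f differentiable (at p)" "b \<in> Basis \<Longrightarrow> continuous_on UNIV (partial_deriv b f)" for p b using C_k_1D[OF f] by blast+
  define h where "h p = complex_of_real (hcoef i p) * f p" for p
  have h: "C_k (Suc 0) h" unfolding h_def using f by (intro C_k_mult C_k_hcoef) simp
  have dh: "((\<lambda>p. complex_of_real (hcoef i p)) has_derivative (\<lambda>v. complex_of_real (hcoef i v))) (at p)" for p
    by (intro has_derivative_of_real bounded_linear_imp_has_derivative hcoef_linear)
  have hv: "partial_deriv vdir h p = of_real (hcoef i p) * partial_deriv vdir f p" for p
    unfolding h_def
    by (subst partial_deriv_mult[OF differentiableI[OF dh] f'(1)]) (simp add: partial_deriv_eq[OF dh] hcoef_vdir)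
  have z: "partial_deriv b f p = 0" "partial_deriv b h p = 0" if "p \<notin> K" for p b
    using derivative_zero_outside[OF compact_imp_closed[OF K(1)] _ that, of f]
      derivative_zero_outside[OF compact_imp_closed[OF K(1)] _ that, of h] K(2)
    by (auto simp: partial_deriv_def h_def)
  have "(LINT p|lborel. vf i f p) = (LINT p|lborel. partial_deriv (hdir i) f p + partial_deriv vdir h p)"
    by (simp add: vf_def hv)
  also have "\<dots> = (LINT p|lborel. partial_deriv (hdir i) f p) + (LINT p|lborel. partial_deriv vdir h p)"
    by (intro Bochner_Integration.integral_add compact_support_integrable[OF _ K(1)]
        f'(2) C_k_1D(2)[OF h[folded One_nat_def]] hdir_Basis vdir_Basis z)
  also have "(LINT p|lborel. partial_deriv (hdir i) f p) = 0"
    by (rule integral_partial_deriv_zero[OF f'(1) f'(2)[OF hdir_Basis] K])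
  also have "(LINT p|lborel. partial_deriv vdir h p) = 0"
    by (rule integral_partial_deriv_zero[OF C_k_1D(1)[OF h[folded One_nat_def]] C_k_1D(2)[OF h[folded One_nat_def] vdir_Basis] K(1)])
      (simp add: h_def K(2))
  also have "0 + 0 = (0 :: complex)" by simp
  finally show ?thesis .
qed

lemma integral_lebesgue_on_eq_lborel:
  fixes f :: "'a::euclidean_space \<Rightarrow> complex"
  assumes "\<Omega> \<in> sets lebesgue" "\<And>p. p \<notin> \<Omega> \<Longrightarrow> f p = 0" "f \<in> borel_measurable borel"
  shows "(LINT p|lebesgue_on \<Omega>. f p) = (LINT p|lborel. f p)"
proof -
  have "(LINT p|lebesgue_on \<Omega>. f p) = (LINT p|lebesgue. indicator \<Omega> p *\<^sub>R f p)"
    using assms(1) by (intro integral_restrict_space) simp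
  also have "(\<lambda>p. indicator \<Omega> p *\<^sub>R f p) = f" using assms(2) by (auto simp: fun_eq_iff indicator_def)
  also have "(LINT p|lebesgue. f p) = (LINT p|lborel. f p)" using assms(3) by (intro integral_completion) simp
  finally show ?thesis .
qed

lemma vf_integration_by_parts:
  assumes \<phi>: "\<phi> \<in> test_fun \<Omega>" and \<psi>: "C_k 1 \<psi>" and \<Omega>: "\<Omega> \<in> sets lebesgue"
  shows "(LINT p|lebesgue_on \<Omega>. vf i \<phi> p * \<psi> p) = - (LINT p|lebesgue_on \<Omega>. \<phi> p * vf i \<psi> p)"
proof -
  obtain K where K: "\<And>k. C_k k \<phi>" "compact K" "\<And>p. p \<notin> K \<Longrightarrow> \<phi> p = 0" "K \<subseteq> \<Omega>"
    by (rule test_funE[OF \<phi>]) (rule that)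
  have z: "vf i \<phi> p = 0" if "p \<notin> K" for p
    by (rule vf_zero_outside[OF compact_imp_closed[OF K(2)] K(3) that])
  have d: "\<phi> differentiable (at p)" "\<psi> differentiable (at p)" for p using C_k_1D(1)[OF K(1)] C_k_1D(1)[OF \<psi>] by blast+
  have c: "continuous_on UNIV (vf i \<phi>)" "continuous_on UNIV \<psi>" "continuous_on UNIV \<phi>" "continuous_on UNIV (vf i \<psi>)"
    using C_k_continuous[OF C_k_vf[OF K(1)[of 1, unfolded One_nat_def]]] C_k_continuous[OF \<psi>] C_k_continuous[OF K(1)[of 0]]
      C_k_continuous[OF C_k_vf[OF \<psi>[unfolded One_nat_def]]] by blast+
  have i: "integrable lborel (\<lambda>p. \<phi> p * vf i \<psi> p)" "integrable lborel (\<lambda>p. vf i \<phi> p * \<psi> p)"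
    by (intro compact_support_integrable[OF _ K(2)] continuous_on_mult c; simp add: K(3) z)+
  have "C_k 1 (\<lambda>p. \<phi> p * \<psi> p)" by (intro C_k_mult \<psi> K)
  then have "(LINT p|lborel. vf i (\<lambda>p. \<phi> p * \<psi> p) p) = 0" by (rule integral_vf_zero[OF _ K(2)]) (simp add: K(3))
  then have "(LINT p|lborel. \<phi> p * vf i \<psi> p) + (LINT p|lborel. vf i \<phi> p * \<psi> p) = 0"
    by (simp add: vf_mult[OF d] Bochner_Integration.integral_add[OF i])
  moreover have "(LINT p|lebesgue_on \<Omega>. \<phi> p * vf i \<psi> p) = (LINT p|lborel. \<phi> p * vf i \<psi> p)"
    "(LINT p|lebesgue_on \<Omega>. vf i \<phi> p * \<psi> p) = (LINT p|lborel. vf i \<phi> p * \<psi> p)"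
    using K(3,4) z i by (auto intro!: integral_lebesgue_on_eq_lborel[OF \<Omega>] simp: subset_iff) (metis K(3) z)+
  ultimately show ?thesis by (simp add: add_eq_0_iff2)
qed

section \<open>Weak horizontal derivatives\<close>

definition is_weak :: "'n::finite heis set \<Rightarrow> 'n + 'n \<Rightarrow> ('n heis \<Rightarrow> complex) \<Rightarrow> ('n heis \<Rightarrow> complex) \<Rightarrow> bool" where
  "is_weak \<Omega> i u g \<longleftrightarrow> g \<in> L2 \<Omega> \<and> (\<forall>\<phi>\<in>test_fun \<Omega>.
     (LINT p|lebesgue_on \<Omega>. g p * \<phi> p) = - (LINT p|lebesgue_on \<Omega>. u p * vf i \<phi> p))"

definition weak :: "'n::finite heis set \<Rightarrow> 'n + 'n \<Rightarrow> ('n heis \<Rightarrow> complex) \<Rightarrow> 'n heis \<Rightarrow> complex" where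
  "weak \<Omega> i u = (SOME g. is_weak \<Omega> i u g)"

lemma is_weak_X_eq: "is_weak_X \<Omega> j u g \<longleftrightarrow> is_weak \<Omega> (Inl j) u g"
  and is_weak_Y_eq: "is_weak_Y \<Omega> j u g \<longleftrightarrow> is_weak \<Omega> (Inr j) u g"
  by (simp_all add: is_weak_X_def is_weak_Y_def is_weak_def vf_X_eq vf_Y_eq)

lemma weak_X_eq: "weak_X \<Omega> j u = weak \<Omega> (Inl j) u" and weak_Y_eq: "weak_Y \<Omega> j u = weak \<Omega> (Inr j) u"
  by (simp_all add: weak_X_def weak_Y_def weak_def is_weak_X_eq is_weak_Y_eq)

lemma sum_UNIV_Plus: "(\<Sum>i\<in>UNIV. f i) = (\<Sum>j\<in>UNIV. f (Inl j)) + (\<Sum>j\<in>UNIV. f (Inr j))"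
  for f :: "'a::finite + 'b::finite \<Rightarrow> 'c::comm_monoid_add"
  using sum.Plus[of "UNIV :: 'a set" "UNIV :: 'b set" f] by (simp add: UNIV_Plus_UNIV)

lemma sub_form_eq: "sub_form \<Omega> u v = (\<Sum>i\<in>UNIV. L2_inner \<Omega> (weak \<Omega> i u) (weak \<Omega> i v))"
  by (simp add: sub_form_def weak_X_eq weak_Y_eq sum_UNIV_Plus sum.distrib)

lemma S1_eq: "S1 \<Omega> = {u \<in> L2 \<Omega>. \<forall>i. \<exists>g. is_weak \<Omega> i u g}"
  by (auto simp: S1_def is_weak_X_eq is_weak_Y_eq split_sum_all)

lemma S1_weak: "u \<in> S1 \<Omega> \<Longrightarrow> is_weak \<Omega> i u (weak \<Omega> i u)"
  unfolding weak_def by (rule someI_ex[of "is_weak \<Omega> i u"]) (simp add: S1_eq)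

lemma S1_L2: "u \<in> S1 \<Omega> \<Longrightarrow> u \<in> L2 \<Omega>"
  by (simp add: S1_eq)

lemma S1I: "u \<in> L2 \<Omega> \<Longrightarrow> (\<And>i. is_weak \<Omega> i u (g i)) \<Longrightarrow> u \<in> S1 \<Omega>"
  by (auto simp: S1_eq)

lemma is_weak_L2: "is_weak \<Omega> i u g \<Longrightarrow> g \<in> L2 \<Omega>"
  by (simp add: is_weak_def)

lemma vf_test_L2:
  assumes "\<phi> \<in> test_fun \<Omega>" "\<Omega> \<in> sets lebesgue"
  shows "vf i \<phi> \<in> L2 \<Omega>"
proof -
  obtain K where K: "\<And>k. C_k k \<phi>" "compact K" "\<And>p. p \<notin> K \<Longrightarrow> \<phi> p = 0" "K \<subseteq> \<Omega>"
    by (rule test_funE[OF assms(1)]) (rule that)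
  show ?thesis
    by (rule compact_support_L2[OF C_k_continuous[OF C_k_vf[OF K(1)]] K(2) vf_zero_outside[OF compact_imp_closed[OF K(2)] K(3)] assms(2)])
qed

context
  fixes \<Omega> :: "'n::finite heis set"
  assumes \<Omega>: "open \<Omega>"
begin

lemma open_sets_lebesgue: "\<Omega> \<in> sets lebesgue"
  using \<Omega> by (simp add: borel_open)

text \<open>Two candidates for a weak derivative differ by a function whose integral against every
  test function is zero. Allowing \<open>u\<close> and \<open>v\<close> to differ on a null set
  shows that \<open>weak\<close> depends, up to null sets, on the class of \<open>u\<close>
  only.\<close>

lemma is_weak_unique:
  assumes g: "is_weak \<Omega> i u g" and h: "is_weak \<Omega> i v h" and uv: "AE p in lebesgue_on \<Omega>. u p = v p"
    and u: "u \<in> L2 \<Omega>" "v \<in> L2 \<Omega>"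
  shows "AE p in lebesgue_on \<Omega>. g p = h p"
proof -
  have "AE p in lebesgue_on \<Omega>. g p - h p = 0"
  proof (rule AE_zero_if_test_integrals_zero[OF \<Omega>])
    show "(\<lambda>p. g p - h p) \<in> L2 \<Omega>" using g h by (intro L2_diff is_weak_L2)
    fix \<phi> assume \<phi>: "\<phi> \<in> test_fun \<Omega>"
    note L = test_fun_in_L2[OF \<phi> open_sets_lebesgue] vf_test_L2[OF \<phi> open_sets_lebesgue, of i]
    have "(LINT p|lebesgue_on \<Omega>. (g p - h p) * \<phi> p) = (LINT p|lebesgue_on \<Omega>. g p * \<phi> p) - (LINT p|lebesgue_on \<Omega>. h p * \<phi> p)"
      using g h L by (simp add: left_diff_distrib L2_mult_integrable is_weak_L2)
    also have "\<dots> = (LINT p|lebesgue_on \<Omega>. v p * vf i \<phi> p) - (LINT p|lebesgue_on \<Omega>. u p * vf i \<phi> p)"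
      using g h \<phi> by (simp add: is_weak_def)
    also have "(LINT p|lebesgue_on \<Omega>. v p * vf i \<phi> p) = (LINT p|lebesgue_on \<Omega>. u p * vf i \<phi> p)"
    proof (rule integral_cong_AE)
      show "AE p in lebesgue_on \<Omega>. v p * vf i \<phi> p = u p * vf i \<phi> p" using uv by eventually_elim simp
    qed (use L u in \<open>auto intro!: borel_measurable_integrable L2_mult_integrable\<close>)
    finally show "(LINT p|lebesgue_on \<Omega>. (g p - h p) * \<phi> p) = 0" by simp
  qed
  then show ?thesis by simp
qed

lemma is_weak_add:
  assumes "is_weak \<Omega> i u g" "is_weak \<Omega> i v h" "u \<in> L2 \<Omega>" "v \<in> L2 \<Omega>"
  shows "is_weak \<Omega> i (\<lambda>p. u p + v p) (\<lambda>p. g p + h p)"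
  unfolding is_weak_def
proof (intro conjI ballI)
  show "(\<lambda>p. g p + h p) \<in> L2 \<Omega>" using assms by (intro L2_add is_weak_L2)
  fix \<phi> assume \<phi>: "\<phi> \<in> test_fun \<Omega>"
  note L = test_fun_in_L2[OF \<phi> open_sets_lebesgue] vf_test_L2[OF \<phi> open_sets_lebesgue, of i]
  have "(LINT p|lebesgue_on \<Omega>. g p * \<phi> p) = - (LINT p|lebesgue_on \<Omega>. u p * vf i \<phi> p)"
    "(LINT p|lebesgue_on \<Omega>. h p * \<phi> p) = - (LINT p|lebesgue_on \<Omega>. v p * vf i \<phi> p)"
    using assms \<phi> by (auto simp: is_weak_def)
  then show "(LINT p|lebesgue_on \<Omega>. (g p + h p) * \<phi> p) = - (LINT p|lebesgue_on \<Omega>. (u p + v p) * vf i \<phi> p)"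
    using assms L by (simp add: distrib_right L2_mult_integrable is_weak_L2)
qed

lemma is_weak_scale:
  assumes "is_weak \<Omega> i u g"
  shows "is_weak \<Omega> i (fscale c u) (fscale c g)"
  using assms by (auto simp: is_weak_def L2_scale mult.assoc)

lemma is_weak_diff:
  assumes "is_weak \<Omega> i u g" "is_weak \<Omega> i v h" "u \<in> L2 \<Omega>" "v \<in> L2 \<Omega>"
  shows "is_weak \<Omega> i (\<lambda>p. u p - v p) (\<lambda>p. g p - h p)"
  using is_weak_add[OF assms(1) is_weak_scale[OF assms(2), of "-1"] assms(3) L2_scale[OF assms(4), of "-1"]] by simp

lemma L2_mult_tendsto:
  assumes "\<And>k. u k \<in> L2 \<Omega>" "v \<in> L2 \<Omega>" "w \<in> L2 \<Omega>" "(\<lambda>k. L2_norm \<Omega> (\<lambda>p. u k p - v p)) \<longlonglongrightarrow> 0"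
  shows "(\<lambda>k. LINT p|lebesgue_on \<Omega>. u k p * w p) \<longlonglongrightarrow> (LINT p|lebesgue_on \<Omega>. v p * w p)"
proof -
  interpret L2: semi_inner fscale "L2 \<Omega>" "L2_inner \<Omega>" by (rule L2_semi_inner)
  have "(\<lambda>k. L2_inner \<Omega> (u k) (\<lambda>p. cnj (w p))) \<longlonglongrightarrow> L2_inner \<Omega> v (\<lambda>p. cnj (w p))"
    using assms by (intro L2.ip_tendsto) (auto simp: L2_cnj L2_nrm fun_diff_def)
  then show ?thesis by (simp add: L2_inner_def)
qed

text \<open>Weak differentiation is a closed operator: against a fixed test function both sides of
  its defining identity are continuous in L2.\<close>

lemma is_weak_limit:
  assumes g: "\<And>k. is_weak \<Omega> i (u k) (g k)" and u: "\<And>k. u k \<in> L2 \<Omega>" "v \<in> L2 \<Omega>" and h: "h \<in> L2 \<Omega>"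
    and lim: "(\<lambda>k. L2_norm \<Omega> (\<lambda>p. u k p - v p)) \<longlonglongrightarrow> 0" "(\<lambda>k. L2_norm \<Omega> (\<lambda>p. g k p - h p)) \<longlonglongrightarrow> 0"
  shows "is_weak \<Omega> i v h"
  unfolding is_weak_def
proof (intro conjI ballI h)
  fix \<phi> assume \<phi>: "\<phi> \<in> test_fun \<Omega>"
  note L = test_fun_in_L2[OF \<phi> open_sets_lebesgue] vf_test_L2[OF \<phi> open_sets_lebesgue, of i]
  have "(\<lambda>k. LINT p|lebesgue_on \<Omega>. g k p * \<phi> p) \<longlonglongrightarrow> (LINT p|lebesgue_on \<Omega>. h p * \<phi> p)"
    using is_weak_L2[OF g] h L lim by (intro L2_mult_tendsto)
  moreover have "(\<lambda>k. - (LINT p|lebesgue_on \<Omega>. u k p * vf i \<phi> p)) \<longlonglongrightarrow> - (LINT p|lebesgue_on \<Omega>. v p * vf i \<phi> p)"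
    using u L lim by (intro tendsto_minus L2_mult_tendsto)
  moreover have "(\<lambda>k. LINT p|lebesgue_on \<Omega>. g k p * \<phi> p) = (\<lambda>k. - (LINT p|lebesgue_on \<Omega>. u k p * vf i \<phi> p))"
    using g \<phi> by (simp add: is_weak_def)
  ultimately show "(LINT p|lebesgue_on \<Omega>. h p * \<phi> p) = - (LINT p|lebesgue_on \<Omega>. v p * vf i \<phi> p)"
    using LIMSEQ_unique by simp
qed

lemma is_weak_classical:
  assumes "C_k 1 \<psi>" "vf i \<psi> \<in> L2 \<Omega>"
  shows "is_weak \<Omega> i \<psi> (vf i \<psi>)"
  unfolding is_weak_def using vf_integration_by_parts[OF _ assms(1) open_sets_lebesgue, of _ i] assms(2)
  by (simp add: mult.commute)

lemma test_fun_weak: "\<phi> \<in> test_fun \<Omega> \<Longrightarrow> is_weak \<Omega> i \<phi> (vf i \<phi>)"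
  using vf_test_L2[OF _ open_sets_lebesgue] by (intro is_weak_classical) (blast elim: test_funE)+

lemma test_fun_S1: "\<phi> \<in> test_fun \<Omega> \<Longrightarrow> \<phi> \<in> S1 \<Omega>"
  using test_fun_in_L2[OF _ open_sets_lebesgue] test_fun_weak by (intro S1I)

text \<open>The arbitrary choice made by \<open>weak\<close> drops out of the form. Evaluations of
  the form at sums, dilates and trial functions go through this lemma, with whatever derivatives are
  at hand.\<close>

lemma sub_form_weak:
  assumes "\<And>i. is_weak \<Omega> i u (g i)" "\<And>i. is_weak \<Omega> i v (h i)" "u \<in> L2 \<Omega>" "v \<in> L2 \<Omega>"
  shows "sub_form \<Omega> u v = (\<Sum>i\<in>UNIV. L2_inner \<Omega> (g i) (h i))"
proof -
  have w: "is_weak \<Omega> i u (weak \<Omega> i u)" "is_weak \<Omega> i v (weak \<Omega> i v)" for i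
    using assms by (auto intro!: S1_weak S1I)
  have "L2_inner \<Omega> (weak \<Omega> i u) (weak \<Omega> i v) = L2_inner \<Omega> (g i) (h i)" for i
    using w assms by (intro L2_inner_cong_AE is_weak_L2[OF w(1)] is_weak_L2[OF w(2)] is_weak_L2[OF assms(1)]
        is_weak_L2[OF assms(2)] is_weak_unique[OF w(1) assms(1)] is_weak_unique[OF w(2) assms(2)]) auto
  then show ?thesis by (simp add: sub_form_eq)
qed

end

section \<open>Completeness and compactness for the Neumann and Dirichlet form domains\<close>

context
  fixes \<Omega> :: "'n::finite heis set"
  assumes \<Omega>: "open \<Omega>"
begin

lemma S1_subspace: "module.subspace fscale (S1 \<Omega>)"
proof -
  interpret vector_space "fscale :: complex \<Rightarrow> ('n heis \<Rightarrow> complex) \<Rightarrow> _" by (rule vector_space_fscale)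
  show ?thesis
  proof (rule subspaceI)
    have "is_weak \<Omega> i (\<lambda>p. 0) (\<lambda>p. 0)" for i by (simp add: is_weak_def L2_zero)
    then show "0 \<in> S1 \<Omega>" unfolding zero_fun_def by (intro S1I[OF L2_zero])
    fix u v assume u: "u \<in> S1 \<Omega>" and v: "v \<in> S1 \<Omega>"
    show "u + v \<in> S1 \<Omega>" unfolding plus_fun_def
      by (rule S1I[OF L2_add is_weak_add[OF \<Omega>]]) (use u v in \<open>auto intro: S1_L2 S1_weak\<close>)
  next
    fix c u assume u: "u \<in> S1 \<Omega>"
    show "fscale c u \<in> S1 \<Omega>"
      by (rule S1I[OF L2_scale is_weak_scale[OF \<Omega>]]) (use u in \<open>auto intro: S1_L2 S1_weak\<close>)
  qed
qed

lemma S1_ip: "semi_inner fscale (S1 \<Omega>) (L2_inner \<Omega>)"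
  by (rule semi_inner.semi_inner_subspace[OF L2_semi_inner S1_subspace]) (auto intro: S1_L2)

lemma S1_form: "semi_inner fscale (S1 \<Omega>) (sub_form \<Omega>)"
proof -
  interpret vector_space "fscale :: complex \<Rightarrow> ('n heis \<Rightarrow> complex) \<Rightarrow> _" by (rule vector_space_fscale)
  interpret L2: semi_inner fscale "L2 \<Omega>" "L2_inner \<Omega>" by (rule L2_semi_inner)
  have wL: "weak \<Omega> i u \<in> L2 \<Omega>" if "u \<in> S1 \<Omega>" for i u by (rule is_weak_L2[OF S1_weak[OF that]])
  show ?thesis
  proof unfold_locales
    show "subspace (S1 \<Omega>)" by (rule S1_subspace)
  next
    fix u v w assume u: "u \<in> S1 \<Omega>" and v: "v \<in> S1 \<Omega>" and w: "w \<in> S1 \<Omega>"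
    have "sub_form \<Omega> (u + v) w = (\<Sum>i\<in>UNIV. L2_inner \<Omega> (weak \<Omega> i u + weak \<Omega> i v) (weak \<Omega> i w))"
      unfolding plus_fun_def using u v w
      by (intro sub_form_weak[OF \<Omega>] is_weak_add[OF \<Omega>] S1_weak S1_L2 L2_add)
    then show "sub_form \<Omega> (u + v) w = sub_form \<Omega> u w + sub_form \<Omega> v w"
      using u v w by (simp add: L2.ip_add wL sub_form_eq sum.distrib)
  next
    fix u w c assume u: "u \<in> S1 \<Omega>" and w: "w \<in> S1 \<Omega>"
    have "sub_form \<Omega> (fscale c u) w = (\<Sum>i\<in>UNIV. L2_inner \<Omega> (fscale c (weak \<Omega> i u)) (weak \<Omega> i w))"
      using u w by (intro sub_form_weak[OF \<Omega>] is_weak_scale[OF \<Omega>] S1_weak S1_L2 L2_scale)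
    then show "sub_form \<Omega> (fscale c u) w = c * sub_form \<Omega> u w"
      using u w by (simp add: L2.ip_scale wL sub_form_eq sum_distrib_left)
  next
    fix u w assume u: "u \<in> S1 \<Omega>" and w: "w \<in> S1 \<Omega>"
    show "sub_form \<Omega> w u = cnj (sub_form \<Omega> u w)"
      unfolding sub_form_eq cnj_sum by (intro sum.cong refl L2.ip_cnj wL u w)
  next
    fix u assume u: "u \<in> S1 \<Omega>"
    show "0 \<le> Re (sub_form \<Omega> u u)"
      unfolding sub_form_eq Re_sum by (intro sum_nonneg L2.ip_nonneg wL u)
  qed
qed

lemma S1_total: "semi_inner fscale (S1 \<Omega>) (\<lambda>u v. sub_form \<Omega> u v + L2_inner \<Omega> u v)"
proof -
  interpret a: semi_inner fscale "S1 \<Omega>" "sub_form \<Omega>" by (rule S1_form)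
  interpret b: semi_inner fscale "S1 \<Omega>" "L2_inner \<Omega>" by (rule S1_ip)
  show ?thesis
    by unfold_locales (auto simp: a.ip_add b.ip_add a.ip_scale b.ip_scale a.ip_nonneg b.ip_nonneg algebra_simps
        S1_subspace intro: arg_cong2[where f = "(+)"] a.ip_cnj b.ip_cnj)
qed

lemma Re_sub_form_self: "Re (sub_form \<Omega> u u) = (\<Sum>i\<in>UNIV. (L2_norm \<Omega> (weak \<Omega> i u))\<^sup>2)"
  by (simp add: sub_form_eq Re_L2_inner_self)

lemma S1_norm_eq: "S1_norm \<Omega> u = semi_inner.nrm (\<lambda>u v. sub_form \<Omega> u v + L2_inner \<Omega> u v) u"
  by (simp add: semi_inner.nrm_def[OF S1_total] S1_norm_def Re_L2_inner_self Re_sub_form_self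
      sum_UNIV_Plus sum.distrib weak_X_eq weak_Y_eq)

lemma S1_norm_sq: "u \<in> S1 \<Omega> \<Longrightarrow> (S1_norm \<Omega> u)\<^sup>2 = Re (sub_form \<Omega> u u) + Re (L2_inner \<Omega> u u)"
  by (simp add: S1_norm_eq semi_inner.nrm_sq[OF S1_total])

text \<open>The functions and each of their weak derivatives converge separately in L2; closedness
  of weak differentiation identifies the limits of the latter as derivatives of the limit.\<close>

lemma S1_complete:
  assumes u: "\<And>k. u k \<in> S1 \<Omega>"
    and cauchy: "\<And>\<epsilon>. \<epsilon> > 0 \<Longrightarrow> \<exists>N. \<forall>m\<ge>N. \<forall>n\<ge>N. Re (sub_form \<Omega> (u m - u n) (u m - u n)) < \<epsilon>
         \<and> Re (L2_inner \<Omega> (u m - u n) (u m - u n)) < \<epsilon>"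
  shows "\<exists>v\<in>S1 \<Omega>. (\<lambda>k. Re (sub_form \<Omega> (u k - v) (u k - v))) \<longlonglongrightarrow> 0
    \<and> (\<lambda>k. Re (L2_inner \<Omega> (u k - v) (u k - v))) \<longlonglongrightarrow> 0"
proof -
  have uL: "u k \<in> L2 \<Omega>" for k using u by (rule S1_L2)
  have w: "is_weak \<Omega> i (u k) (weak \<Omega> i (u k))" for i k using u by (rule S1_weak)
  have form_diff: "Re (sub_form \<Omega> (u m - v) (u m - v)) = (\<Sum>i\<in>UNIV. (L2_norm \<Omega> (\<lambda>p. weak \<Omega> i (u m) p - g i p))\<^sup>2)"
    if "\<And>i. is_weak \<Omega> i v (g i)" "v \<in> L2 \<Omega>" for m v g
  proof -
    have "is_weak \<Omega> i (u m - v) (\<lambda>p. weak \<Omega> i (u m) p - g i p)" for i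
      unfolding fun_diff_def by (rule is_weak_diff[OF \<Omega> w that(1) uL that(2)])
    then have "sub_form \<Omega> (u m - v) (u m - v)
        = (\<Sum>i\<in>UNIV. L2_inner \<Omega> (\<lambda>p. weak \<Omega> i (u m) p - g i p) (\<lambda>p. weak \<Omega> i (u m) p - g i p))"
      by (intro sub_form_weak[OF \<Omega>]) (auto simp: fun_diff_def intro!: L2_diff uL that)
    then show ?thesis by (simp add: Re_L2_inner_self)
  qed
  obtain v where v: "v \<in> L2 \<Omega>" "(\<lambda>k. L2_norm \<Omega> (\<lambda>p. u k p - v p)) \<longlonglongrightarrow> 0"
  proof (rule L2_complete[OF uL])
    fix \<epsilon> :: real assume "\<epsilon> > 0"
    from cauchy[OF this] show "\<exists>N. \<forall>m\<ge>N. \<forall>n\<ge>N. (L2_norm \<Omega> (\<lambda>p. u m p - u n p))\<^sup>2 < \<epsilon>"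
      by (simp add: Re_L2_inner_self fun_diff_def) blast
  qed (rule that)
  have "\<exists>g. g \<in> L2 \<Omega> \<and> (\<lambda>k. L2_norm \<Omega> (\<lambda>p. weak \<Omega> i (u k) p - g p)) \<longlonglongrightarrow> 0" for i
  proof (rule L2_complete[of "\<lambda>k. weak \<Omega> i (u k)" \<Omega>, OF is_weak_L2[OF w]])
    fix \<epsilon> :: real assume "\<epsilon> > 0"
    then obtain N where N: "\<forall>m\<ge>N. \<forall>n\<ge>N. Re (sub_form \<Omega> (u m - u n) (u m - u n)) < \<epsilon>
         \<and> Re (L2_inner \<Omega> (u m - u n) (u m - u n)) < \<epsilon>" using cauchy by presburger
    have "(L2_norm \<Omega> (\<lambda>p. weak \<Omega> i (u m) p - weak \<Omega> i (u n) p))\<^sup>2 < \<epsilon>" if "m \<ge> N" "n \<ge> N" for m n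
    proof -
      have "(L2_norm \<Omega> (\<lambda>p. weak \<Omega> i (u m) p - weak \<Omega> i (u n) p))\<^sup>2
          \<le> (\<Sum>i\<in>UNIV. (L2_norm \<Omega> (\<lambda>p. weak \<Omega> i (u m) p - weak \<Omega> i (u n) p))\<^sup>2)"
        by (rule member_le_sum) auto
      also have "\<dots> = Re (sub_form \<Omega> (u m - u n) (u m - u n))" by (rule form_diff[OF w uL, symmetric])
      also have "\<dots> < \<epsilon>" using N that by simp
      finally show ?thesis .
    qed
    then show "\<exists>N. \<forall>m\<ge>N. \<forall>n\<ge>N. (L2_norm \<Omega> (\<lambda>p. weak \<Omega> i (u m) p - weak \<Omega> i (u n) p))\<^sup>2 < \<epsilon>" by blast
  qed blast
  then have "\<exists>g. \<forall>i. g i \<in> L2 \<Omega> \<and> (\<lambda>k. L2_norm \<Omega> (\<lambda>p. weak \<Omega> i (u k) p - g i p)) \<longlonglongrightarrow> 0"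
    by (intro choice allI)
  then obtain g where "\<forall>i. g i \<in> L2 \<Omega> \<and> (\<lambda>k. L2_norm \<Omega> (\<lambda>p. weak \<Omega> i (u k) p - g i p)) \<longlonglongrightarrow> 0"
    by (rule exE)
  then have g: "g i \<in> L2 \<Omega>" "(\<lambda>k. L2_norm \<Omega> (\<lambda>p. weak \<Omega> i (u k) p - g i p)) \<longlonglongrightarrow> 0" for i by simp_all
  have vg: "is_weak \<Omega> i v (g i)" for i by (rule is_weak_limit[OF \<Omega> w uL v(1) g(1) v(2) g(2)])
  have "(\<lambda>k. \<Sum>i\<in>UNIV. (L2_norm \<Omega> (\<lambda>p. weak \<Omega> i (u k) p - g i p))\<^sup>2) \<longlonglongrightarrow> (\<Sum>i\<in>(UNIV::('n+'n) set). 0\<^sup>2)"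
    by (intro tendsto_intros g)
  then have "(\<lambda>k. Re (sub_form \<Omega> (u k - v) (u k - v))) \<longlonglongrightarrow> 0" by (simp add: form_diff[OF vg v(1)])
  moreover have "(\<lambda>k. (L2_norm \<Omega> (\<lambda>p. u k p - v p))\<^sup>2) \<longlonglongrightarrow> 0\<^sup>2" by (intro tendsto_intros v)
  then have "(\<lambda>k. Re (L2_inner \<Omega> (u k - v) (u k - v))) \<longlonglongrightarrow> 0" by (simp add: Re_L2_inner_self fun_diff_def)
  ultimately show ?thesis using S1I[OF v(1) vg] by blast
qed

lemma S1_0_S1: "u \<in> S1_0 \<Omega> \<Longrightarrow> u \<in> S1 \<Omega>"
  by (simp add: S1_0_def)

lemma S1_0_approx:
  assumes "u \<in> S1_0 \<Omega>" "\<epsilon> > 0"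
  obtains \<phi> where "\<phi> \<in> test_fun \<Omega>" "S1_norm \<Omega> (\<lambda>p. u p - \<phi> p) < \<epsilon>"
  using assms by (auto simp: S1_0_def)

lemma test_fun_S1_0: "\<phi> \<in> test_fun \<Omega> \<Longrightarrow> \<phi> \<in> S1_0 \<Omega>"
proof -
  assume \<phi>: "\<phi> \<in> test_fun \<Omega>"
  interpret t: semi_inner fscale "S1 \<Omega>" "\<lambda>u v. sub_form \<Omega> u v + L2_inner \<Omega> u v" by (rule S1_total)
  have "S1_norm \<Omega> (\<lambda>p. \<phi> p - \<phi> p) = 0" using t.nrm_zero by (simp add: S1_norm_eq zero_fun_def)
  then show ?thesis using \<phi> test_fun_S1[OF \<Omega> \<phi>] by (auto simp: S1_0_def intro!: bexI[of _ \<phi>])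
qed

lemma S1_0_subspace: "module.subspace fscale (S1_0 \<Omega>)"
proof -
  interpret t: semi_inner fscale "S1 \<Omega>" "\<lambda>u v. sub_form \<Omega> u v + L2_inner \<Omega> u v" by (rule S1_total)
  show ?thesis
  proof (rule t.subspaceI)
    have "(\<lambda>p. 0) \<in> test_fun \<Omega>" by (rule test_funI[of _ "{}"]) (auto simp: C_k_const)
    then show "0 \<in> S1_0 \<Omega>" unfolding zero_fun_def by (rule test_fun_S1_0)
    fix u v assume u: "u \<in> S1_0 \<Omega>" and v: "v \<in> S1_0 \<Omega>"
    note S = S1_0_S1[OF u] S1_0_S1[OF v]
    have "\<exists>\<phi>\<in>test_fun \<Omega>. S1_norm \<Omega> (\<lambda>p. (u + v) p - \<phi> p) < \<epsilon>" if \<epsilon>: "\<epsilon> > 0" for \<epsilon>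
    proof -
      have e2: "\<epsilon>/2 > 0" using \<epsilon> by simp
      obtain \<phi> where \<phi>: "\<phi> \<in> test_fun \<Omega>" "S1_norm \<Omega> (\<lambda>p. u p - \<phi> p) < \<epsilon>/2"
        by (rule S1_0_approx[OF u e2])
      obtain \<psi> where \<psi>: "\<psi> \<in> test_fun \<Omega>" "S1_norm \<Omega> (\<lambda>p. v p - \<psi> p) < \<epsilon>/2"
        by (rule S1_0_approx[OF v e2])
      have "S1_norm \<Omega> ((u - \<phi>) + (v - \<psi>)) \<le> S1_norm \<Omega> (u - \<phi>) + S1_norm \<Omega> (v - \<psi>)"
        unfolding S1_norm_eq by (intro t.nrm_add t.V_diff S test_fun_S1[OF \<Omega> \<phi>(1)] test_fun_S1[OF \<Omega> \<psi>(1)])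
      moreover have "(u - \<phi>) + (v - \<psi>) = (\<lambda>p. (u + v) p - (\<phi> p + \<psi> p))" by (auto simp: fun_eq_iff)
      ultimately have "S1_norm \<Omega> (\<lambda>p. (u + v) p - (\<phi> p + \<psi> p)) < \<epsilon>"
        using \<phi>(2) \<psi>(2) unfolding fun_diff_def by (simp add: plus_fun_def)
      then show ?thesis by (intro bexI[of _ "\<lambda>p. \<phi> p + \<psi> p"] test_fun_add \<phi>(1) \<psi>(1))
    qed
    then show "u + v \<in> S1_0 \<Omega>" using t.V_add[OF S] by (simp add: S1_0_def)
  next
    fix c u assume u: "u \<in> S1_0 \<Omega>"
    note S = S1_0_S1[OF u]
    have "\<exists>\<phi>\<in>test_fun \<Omega>. S1_norm \<Omega> (\<lambda>p. c * u p - \<phi> p) < \<epsilon>" if \<epsilon>: "\<epsilon> > 0" for \<epsilon>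
    proof -
      have "\<epsilon> / (cmod c + 1) > 0" using \<epsilon> by (simp add: add_nonneg_pos)
      then obtain \<phi> where \<phi>: "\<phi> \<in> test_fun \<Omega>" "S1_norm \<Omega> (\<lambda>p. u p - \<phi> p) < \<epsilon> / (cmod c + 1)"
        by (rule S1_0_approx[OF u])
      have "S1_norm \<Omega> (fscale c (u - \<phi>)) = cmod c * S1_norm \<Omega> (u - \<phi>)"
        unfolding S1_norm_eq by (intro t.nrm_scale t.V_diff S test_fun_S1[OF \<Omega> \<phi>(1)])
      moreover have "cmod c * S1_norm \<Omega> (u - \<phi>) \<le> cmod c * (\<epsilon> / (cmod c + 1))"
        using \<phi>(2) by (intro mult_left_mono) (auto simp: fun_diff_def)
      moreover have "cmod c * (\<epsilon> / (cmod c + 1)) < \<epsilon>" using \<epsilon> by (simp add: pos_divide_less_eq add_nonneg_pos distrib_left mult.commute)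
      moreover have "fscale c (u - \<phi>) = (\<lambda>p. c * u p - \<phi> p * c)" by (auto simp: fun_eq_iff algebra_simps)
      ultimately have "S1_norm \<Omega> (\<lambda>p. c * u p - \<phi> p * c) < \<epsilon>" by simp
      then show ?thesis by (intro bexI[of _ "\<lambda>p. \<phi> p * c"] test_fun_mult \<phi>(1) C_k_const)
    qed
    then show "fscale c u \<in> S1_0 \<Omega>" using t.V_scale[OF S] by (simp add: S1_0_def)
  qed
qed

lemma S1_0_closed:
  assumes u: "\<And>k. u k \<in> S1_0 \<Omega>" and v: "v \<in> S1 \<Omega>"
    and lim: "(\<lambda>k. Re (sub_form \<Omega> (u k - v) (u k - v))) \<longlonglongrightarrow> 0" "(\<lambda>k. Re (L2_inner \<Omega> (u k - v) (u k - v))) \<longlonglongrightarrow> 0"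
  shows "v \<in> S1_0 \<Omega>"
proof -
  interpret t: semi_inner fscale "S1 \<Omega>" "\<lambda>u v. sub_form \<Omega> u v + L2_inner \<Omega> u v" by (rule S1_total)
  note uS = S1_0_S1[OF u]
  have "(\<lambda>k. sqrt (Re (sub_form \<Omega> (u k - v) (u k - v)) + Re (L2_inner \<Omega> (u k - v) (u k - v)))) \<longlonglongrightarrow> sqrt (0 + 0)"
    by (intro tendsto_intros lim)
  then have l: "(\<lambda>k. S1_norm \<Omega> (u k - v)) \<longlonglongrightarrow> 0" by (simp add: S1_norm_eq t.nrm_def)
  have "\<exists>\<phi>\<in>test_fun \<Omega>. S1_norm \<Omega> (\<lambda>p. v p - \<phi> p) < \<epsilon>" if \<epsilon>: "\<epsilon> > 0" for \<epsilon>
  proof -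
    have "eventually (\<lambda>k. S1_norm \<Omega> (u k - v) < \<epsilon>/2) sequentially" using \<epsilon> by (intro order_tendstoD(2)[OF l]) simp
    then obtain k where k: "S1_norm \<Omega> (u k - v) < \<epsilon>/2" by (auto simp: eventually_sequentially)
    obtain \<phi> where \<phi>: "\<phi> \<in> test_fun \<Omega>" "S1_norm \<Omega> (\<lambda>p. u k p - \<phi> p) < \<epsilon>/2"
      using S1_0_approx[OF u[of k], of "\<epsilon>/2"] \<epsilon> by auto
    have "S1_norm \<Omega> (v - \<phi>) \<le> S1_norm \<Omega> (v - u k) + S1_norm \<Omega> (u k - \<phi>)"
      unfolding S1_norm_eq using uS v test_fun_S1[OF \<Omega> \<phi>(1)] by (intro t.nrm_triangle)
    also have "S1_norm \<Omega> (v - u k) = S1_norm \<Omega> (u k - v)"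
      unfolding S1_norm_eq using uS v by (intro t.nrm_minus_commute)
    also have "S1_norm \<Omega> (u k - v) + S1_norm \<Omega> (u k - \<phi>) < \<epsilon>" using k \<phi>(2) unfolding fun_diff_def by simp
    finally show ?thesis unfolding fun_diff_def by (intro bexI[of _ \<phi>] \<phi>(1))
  qed
  then show ?thesis using v by (simp add: S1_0_def)
qed

text \<open>Bumps in pairwise disjoint boxes, normalized. They lie in the smaller form domain, so
  this serves the Dirichlet and the Neumann case alike.\<close>

lemma disjoint_test_funs:
  assumes ne: "\<Omega> \<noteq> {}"
  shows "\<exists>f :: nat \<Rightarrow> 'n heis \<Rightarrow> complex. \<forall>i. f i \<in> test_fun \<Omega> \<and> L2_inner \<Omega> (f i) (f i) = 1
    \<and> (\<forall>j. j \<noteq> i \<longrightarrow> L2_inner \<Omega> (f i) (f j) = 0)"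
proof -
  obtain x where "x \<in> \<Omega>" using ne by blast
  then obtain l u where lu: "x \<in> box l u" "cbox l u \<subseteq> \<Omega>" using open_contains_cbox[OF \<Omega>] by metis
  have lt: "l \<bullet> b < u \<bullet> b" if "b \<in> Basis" for b using lu(1) that by (auto simp: mem_box intro: less_trans)
  obtain b0 :: "'n heis" where b0: "b0 \<in> Basis" using nonempty_Basis by blast
  define d where "d = (u - l) \<bullet> b0"
  have d: "d > 0" using lt[OF b0] by (simp add: d_def inner_diff_left)
  \<comment> \<open>Along \<open>b0\<close>, box number \<open>k\<close> occupies the slab between
    the distances \<open>d/(k+2)\<close> and \<open>d/(k+1)\<close> from the corner
    \<open>l\<close>; the open slabs are disjoint and stay within the original box.\<close>
  define L where "L k = l + (d / (real k + 2)) *\<^sub>R b0" for k :: nat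
  define R where "R k = u - (d - d / (real k + 1)) *\<^sub>R b0" for k :: nat
  have Lb: "L k \<bullet> b = (if b = b0 then l \<bullet> b0 + d / (real k + 2) else l \<bullet> b)" if "b \<in> Basis" for b k
    using that b0 by (simp add: L_def inner_add_left inner_Basis)
  have Rb: "R k \<bullet> b = (if b = b0 then l \<bullet> b0 + d / (real k + 1) else u \<bullet> b)" if "b \<in> Basis" for b k
    using that b0 by (simp add: R_def inner_diff_left inner_Basis d_def)
  have LR: "L k \<bullet> b < R k \<bullet> b" if "b \<in> Basis" for b k
    using lt[OF that] d by (simp add: Lb[OF that] Rb[OF that] divide_strict_left_mono)
  have sub: "cbox (L k) (R k) \<subseteq> \<Omega>" for k
  proof -
    have "l \<bullet> b \<le> L k \<bullet> b" "R k \<bullet> b \<le> u \<bullet> b" if "b \<in> Basis" for b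
    proof -
      show "l \<bullet> b \<le> L k \<bullet> b" using d by (simp add: Lb[OF that])
      have "d / (real k + 1) \<le> d" using d by (simp add: field_simps)
      also have "d = u \<bullet> b0 - l \<bullet> b0" by (simp add: d_def inner_diff_left)
      finally show "R k \<bullet> b \<le> u \<bullet> b" by (simp add: Rb[OF that])
    qed
    then have "cbox (L k) (R k) \<subseteq> cbox l u" by (intro subset_box_imp) auto
    then show ?thesis using lu(2) by blast
  qed
  have disj: "box (L i) (R i) \<inter> box (L j) (R j) = {}" if "i < j" for i j
  proof -
    have "d / (real j + 1) \<le> d / (real i + 2)" using that d by (intro divide_left_mono) auto
    then have "R j \<bullet> b0 \<le> L i \<bullet> b0" by (simp add: Lb[OF b0] Rb[OF b0])
    then show ?thesis using b0 by (fastforce simp: mem_box)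
  qed
  define g where "g k = bump 1 (L k) (R k)" for k
  have gt: "g k \<in> test_fun \<Omega>" for k unfolding g_def by (rule bump_test_fun[OF _ sub]) (auto intro: less_imp_le LR)
  have gnz: "g k p \<noteq> 0 \<longleftrightarrow> p \<in> box (L k) (R k)" for k p
    unfolding g_def by (rule bump_nonzero_iff) (auto intro: less_imp_le LR)
  have gL: "g k \<in> L2 \<Omega>" for k by (rule test_fun_in_L2[OF gt open_sets_lebesgue[OF \<Omega>]])
  have pos: "L2_norm \<Omega> (g k) > 0" for k
  proof -
    have "L2_norm \<Omega> (g k) \<noteq> 0"
    proof
      assume "L2_norm \<Omega> (g k) = 0"
      then have "AE p in lebesgue_on \<Omega>. g k p = 0" using L2_norm_eq_0_iff[OF gL] by blast
      then have "AE p in lebesgue. p \<in> \<Omega> \<longrightarrow> g k p = 0"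
        using open_sets_lebesgue[OF \<Omega>] by (subst (asm) AE_restrict_space_iff) auto
      then have "AE p in lebesgue. p \<notin> box (L k) (R k)"
        by eventually_elim (use gnz sub box_subset_cbox in blast)
      then have "negligible (box (L k) (R k))"
        by (simp add: negligible_iff_null_sets AE_iff_null_sets)
      then show False using LR open_not_negligible[OF open_box, of "L k" "R k"]
        by (auto simp: box_eq_empty not_le less_imp_le)
    qed
    then show ?thesis by (simp add: L2_norm_def less_le)
  qed
  interpret L2: semi_inner fscale "L2 \<Omega>" "L2_inner \<Omega>" by (rule L2_semi_inner)
  define f where "f k = (\<lambda>p. g k p * of_real (1 / L2_norm \<Omega> (g k)))" for k
  have fs: "f k = fscale (of_real (1 / L2_norm \<Omega> (g k))) (g k)" for k by (auto simp: f_def)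
  have "f k \<in> test_fun \<Omega>" for k unfolding f_def by (intro test_fun_mult gt C_k_const)
  moreover have "L2_inner \<Omega> (f k) (f k) = 1" for k
  proof -
    have fL: "f k \<in> L2 \<Omega>" unfolding fs by (rule L2_scale[OF gL])
    have "L2.nrm (f k) = 1" unfolding fs L2.nrm_scale[OF gL] using pos[of k] by (simp add: L2_nrm norm_divide)
    then have "Re (L2_inner \<Omega> (f k) (f k)) = 1" using L2.nrm_sq[OF fL] by simp
    then show ?thesis using L2.ip_self[OF fL] by simp
  qed
  moreover have "L2_inner \<Omega> (f i) (f j) = 0" if "j \<noteq> i" for i j
  proof -
    have "f i p * cnj (f j p) = 0" for p
      using disj[of i j] disj[of j i] that gnz[of i p] gnz[of j p] by (cases "i < j") (auto simp: f_def)
    then show ?thesis unfolding L2_inner_def by (simp only:) simp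
  qed
  ultimately show ?thesis by blast
qed

lemma S1_compact:
  assumes c: "compact_embedding \<Omega>" and u: "\<And>k. u k \<in> S1 \<Omega>"
    and B: "\<And>k::nat. Re (sub_form \<Omega> (u k) (u k)) + Re (L2_inner \<Omega> (u k) (u k)) \<le> B"
  shows "\<exists>r :: nat \<Rightarrow> nat. strict_mono r \<and> (\<forall>\<epsilon>>0. \<exists>N. \<forall>m\<ge>N. \<forall>n\<ge>N.
      Re (L2_inner \<Omega> (u (r m) - u (r n)) (u (r m) - u (r n))) < \<epsilon>)"
proof -
  interpret L2: semi_inner fscale "L2 \<Omega>" "L2_inner \<Omega>" by (rule L2_semi_inner)
  have "S1_norm \<Omega> (u k) \<le> sqrt B" for k
    using B by (simp add: S1_norm_eq semi_inner.nrm_def[OF S1_total])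
  then obtain v r where v: "v \<in> L2 \<Omega>" and r: "strict_mono (r :: nat \<Rightarrow> nat)"
    and lim: "(\<lambda>k. L2_norm \<Omega> (\<lambda>p. u (r k) p - v p)) \<longlonglongrightarrow> 0"
    using c u unfolding compact_embedding_def by blast
  note uL = S1_L2[OF u]
  have "\<exists>N. \<forall>m\<ge>N. \<forall>n\<ge>N. Re (L2_inner \<Omega> (u (r m) - u (r n)) (u (r m) - u (r n))) < \<epsilon>" if \<epsilon>: "\<epsilon> > 0" for \<epsilon>
  proof -
    have "eventually (\<lambda>k. L2_norm \<Omega> (\<lambda>p. u (r k) p - v p) < sqrt \<epsilon> / 2) sequentially"
      using \<epsilon> by (intro order_tendstoD(2)[OF lim]) simp
    then obtain N where N: "\<And>k. k \<ge> N \<Longrightarrow> L2.nrm (u (r k) - v) < sqrt \<epsilon> / 2"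
      by (auto simp: eventually_sequentially L2_nrm fun_diff_def)
    have "Re (L2_inner \<Omega> (u (r m) - u (r n)) (u (r m) - u (r n))) < \<epsilon>" if mn: "m \<ge> N" "n \<ge> N" for m n
    proof -
      have "L2.nrm (u (r m) - u (r n)) \<le> L2.nrm (u (r m) - v) + L2.nrm (v - u (r n))"
        by (rule L2.nrm_triangle[OF uL v uL])
      also have "\<dots> < sqrt \<epsilon>" using N[OF mn(1)] N[OF mn(2)] L2.nrm_minus_commute[OF v uL, of "r n"] by simp
      finally have "(L2.nrm (u (r m) - u (r n)))\<^sup>2 < (sqrt \<epsilon>)\<^sup>2"
        by (intro power_strict_mono L2.nrm_nonneg L2.V_diff uL) auto
      then show ?thesis using \<epsilon> L2.nrm_sq[OF L2.V_diff[OF uL uL]] by simp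
    qed
    then show ?thesis by blast
  qed
  then show ?thesis using r by blast
qed

theorem neumann_compact_form:
  assumes "compact_embedding \<Omega>" "\<Omega> \<noteq> {}"
  shows "compact_form fscale (S1 \<Omega>) (L2_inner \<Omega>) (sub_form \<Omega>)"
  by (intro compact_form.intro compact_form_axioms.intro S1_ip S1_form S1_compact[OF assms(1)] S1_complete)
    (use disjoint_test_funs[OF assms(2)] test_fun_S1[OF \<Omega>] in blast)+

theorem dirichlet_compact_form:
  assumes "compact_embedding \<Omega>" "\<Omega> \<noteq> {}"
  shows "compact_form fscale (S1_0 \<Omega>) (L2_inner \<Omega>) (sub_form \<Omega>)"
proof (intro compact_form.intro compact_form_axioms.intro)
  have S: "S1_0 \<Omega> \<subseteq> S1 \<Omega>" using S1_0_S1 by blast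
  show "semi_inner fscale (S1_0 \<Omega>) (L2_inner \<Omega>)"
    by (rule semi_inner.semi_inner_subspace[OF S1_ip S1_0_subspace S])
  show "semi_inner fscale (S1_0 \<Omega>) (sub_form \<Omega>)"
    by (rule semi_inner.semi_inner_subspace[OF S1_form S1_0_subspace S])
next
  fix u B assume "\<And>k. u k \<in> S1_0 \<Omega>" "\<And>k::nat. Re (sub_form \<Omega> (u k) (u k)) + Re (L2_inner \<Omega> (u k) (u k)) \<le> B"
  then show "\<exists>r :: nat \<Rightarrow> nat. strict_mono r \<and> (\<forall>\<epsilon>>0. \<exists>N. \<forall>m\<ge>N. \<forall>n\<ge>N.
      Re (L2_inner \<Omega> (u (r m) - u (r n)) (u (r m) - u (r n))) < \<epsilon>)"
    by (intro S1_compact[OF assms(1)] S1_0_S1)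
next
  fix u :: "nat \<Rightarrow> 'n heis \<Rightarrow> complex"
  assume u: "\<And>k. u k \<in> S1_0 \<Omega>" and c: "\<And>\<epsilon>. \<epsilon> > 0 \<Longrightarrow> \<exists>N. \<forall>m\<ge>N. \<forall>n\<ge>N. Re (sub_form \<Omega> (u m - u n) (u m - u n)) < \<epsilon>
         \<and> Re (L2_inner \<Omega> (u m - u n) (u m - u n)) < \<epsilon>"
  obtain v where v: "v \<in> S1 \<Omega>" "(\<lambda>k. Re (sub_form \<Omega> (u k - v) (u k - v))) \<longlonglongrightarrow> 0"
    "(\<lambda>k. Re (L2_inner \<Omega> (u k - v) (u k - v))) \<longlonglongrightarrow> 0"
    using S1_complete[OF S1_0_S1[OF u] c] by blast
  then show "\<exists>v\<in>S1_0 \<Omega>. (\<lambda>k. Re (sub_form \<Omega> (u k - v) (u k - v))) \<longlonglongrightarrow> 0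
    \<and> (\<lambda>k. Re (L2_inner \<Omega> (u k - v) (u k - v))) \<longlonglongrightarrow> 0"
    by (intro bexI[OF _ S1_0_closed[where u = u, OF u v]] conjI)
next
  show "\<exists>f :: nat \<Rightarrow> 'n heis \<Rightarrow> complex. \<forall>i. f i \<in> S1_0 \<Omega> \<and> L2_inner \<Omega> (f i) (f i) = 1
    \<and> (\<forall>j. j \<noteq> i \<longrightarrow> L2_inner \<Omega> (f i) (f j) = 0)"
    using disjoint_test_funs[OF assms(2)] test_fun_S1_0 by blast
qed

end

section \<open>Integration by parts in the Dirichlet form domain\<close>

lemma L2_bounded_mult:
  assumes u: "u \<in> L2 \<Omega>" and e: "continuous_on UNIV e" "\<And>p. cmod (e p) \<le> B"
  shows "(\<lambda>p. u p * e p) \<in> L2 \<Omega>"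
proof -
  have em: "e \<in> borel_measurable (lebesgue_on \<Omega>)"
    by (intro measurable_restrict_space1 measurable_completion) (simp add: borel_measurable_continuous_onI e)
  note [measurable] = em L2D(1)[OF u]
  have B: "B \<ge> 0" using e(2) norm_ge_zero order_trans by blast
  have "integrable (lebesgue_on \<Omega>) (\<lambda>p. (cmod (u p * e p))\<^sup>2)"
  proof (rule Bochner_Integration.integrable_bound)
    show "integrable (lebesgue_on \<Omega>) (\<lambda>p. B\<^sup>2 * (cmod (u p))\<^sup>2)" using L2D(2)[OF u] by simp
    have "(cmod (u p * e p))\<^sup>2 \<le> B\<^sup>2 * (cmod (u p))\<^sup>2" for p
      using e(2)[of p] by (simp add: norm_mult power_mult_distrib mult.commute mult_right_mono power_mono)
    then show "AE p in lebesgue_on \<Omega>. norm ((cmod (u p * e p))\<^sup>2) \<le> norm (B\<^sup>2 * (cmod (u p))\<^sup>2)" by simp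
  qed measurable
  then show ?thesis by (simp add: L2_def)
qed

lemma C_k_cnj: "C_k k \<phi> \<Longrightarrow> C_k k (\<lambda>p. cnj (\<phi> p))"
  by (rule C_k_bounded_linear[OF bounded_linear_cnj])

lemma vf_cnj: "\<phi> differentiable (at p) \<Longrightarrow> vf i (\<lambda>p. cnj (\<phi> p)) p = cnj (vf i \<phi> p)"
  by (simp add: vf_def partial_deriv_bounded_linear[OF bounded_linear_cnj])

lemma test_fun_cnj: "\<phi> \<in> test_fun \<Omega> \<Longrightarrow> (\<lambda>p. cnj (\<phi> p)) \<in> test_fun \<Omega>"
  by (erule test_funE) (intro test_funI C_k_cnj; auto)

context
  fixes \<Omega> :: "'n::finite heis set"
  assumes \<Omega>: "open \<Omega>"
begin

lemma S1_norm_bounds: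
  assumes "\<And>i. is_weak \<Omega> i u (g i)" "u \<in> L2 \<Omega>"
  shows "L2_norm \<Omega> u \<le> S1_norm \<Omega> u" "L2_norm \<Omega> (g i) \<le> S1_norm \<Omega> u"
proof -
  have S: "u \<in> S1 \<Omega>" using assms(2,1) by (rule S1I)
  have "(S1_norm \<Omega> u)\<^sup>2 = (\<Sum>i\<in>UNIV. (L2_norm \<Omega> (g i))\<^sup>2) + (L2_norm \<Omega> u)\<^sup>2"
    using sub_form_weak[OF \<Omega> assms(1) assms(1) assms(2) assms(2)]
    by (simp add: S1_norm_sq[OF \<Omega> S] Re_L2_inner_self)
  moreover have "(L2_norm \<Omega> (g i))\<^sup>2 \<le> (\<Sum>i\<in>UNIV. (L2_norm \<Omega> (g i))\<^sup>2)"
    by (rule member_le_sum) auto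
  moreover have "0 \<le> (\<Sum>i\<in>UNIV. (L2_norm \<Omega> (g i))\<^sup>2)" by (rule sum_nonneg) simp
  ultimately have le: "(L2_norm \<Omega> u)\<^sup>2 \<le> (S1_norm \<Omega> u)\<^sup>2" "(L2_norm \<Omega> (g i))\<^sup>2 \<le> (S1_norm \<Omega> u)\<^sup>2"
    using zero_le_power2[of "L2_norm \<Omega> u"] by linarith+
  have "0 \<le> S1_norm \<Omega> u" by (simp add: S1_norm_eq[OF \<Omega>] semi_inner.nrm_nonneg[OF S1_total[OF \<Omega>] S])
  then show "L2_norm \<Omega> u \<le> S1_norm \<Omega> u" "L2_norm \<Omega> (g i) \<le> S1_norm \<Omega> u"
    using le by (auto intro: power2_le_imp_le)
qed

lemma S1_0_sequence:
  assumes u: "u \<in> S1_0 \<Omega>"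
  obtains \<phi> where "\<And>k. \<phi> k \<in> test_fun \<Omega>" "(\<lambda>k. L2_norm \<Omega> (\<lambda>p. \<phi> k p - u p)) \<longlonglongrightarrow> 0"
    "\<And>i. (\<lambda>k. L2_norm \<Omega> (\<lambda>p. vf i (\<phi> k) p - weak \<Omega> i u p)) \<longlonglongrightarrow> 0"
proof -
  interpret t: semi_inner fscale "S1 \<Omega>" "\<lambda>u v. sub_form \<Omega> u v + L2_inner \<Omega> u v" by (rule S1_total[OF \<Omega>])
  have uS: "u \<in> S1 \<Omega>" using u by (rule S1_0_S1[OF \<Omega>])
  have "\<exists>\<phi>. \<phi> \<in> test_fun \<Omega> \<and> S1_norm \<Omega> (\<lambda>p. u p - \<phi> p) < inverse (real (Suc k))" for k
    using S1_0_approx[OF \<Omega> u, of "inverse (real (Suc k))"] by auto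
  then have "\<exists>\<phi>. \<forall>k. \<phi> k \<in> test_fun \<Omega> \<and> S1_norm \<Omega> (\<lambda>p. u p - \<phi> k p) < inverse (real (Suc k))"
    by (intro choice allI)
  then obtain \<phi> where "\<forall>k. \<phi> k \<in> test_fun \<Omega> \<and> S1_norm \<Omega> (\<lambda>p. u p - \<phi> k p) < inverse (real (Suc k))"
    by (rule exE)
  then have \<phi>: "\<phi> k \<in> test_fun \<Omega>" and b: "S1_norm \<Omega> (u - \<phi> k) < inverse (real (Suc k))" for k
    by (simp_all add: fun_diff_def)
  have \<phi>S: "\<phi> k \<in> S1 \<Omega>" for k by (rule test_fun_S1[OF \<Omega> \<phi>])
  have b': "S1_norm \<Omega> (\<lambda>p. \<phi> k p - u p) \<le> inverse (real (Suc k))" for k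
    using b[of k] t.nrm_minus_commute[OF uS \<phi>S, of k] by (simp add: S1_norm_eq[OF \<Omega>] fun_diff_def)
  have w: "is_weak \<Omega> i (\<lambda>p. \<phi> k p - u p) (\<lambda>p. vf i (\<phi> k) p - weak \<Omega> i u p)" for i k
    by (intro is_weak_diff[OF \<Omega>] test_fun_weak[OF \<Omega> \<phi>] S1_weak uS S1_L2 \<phi>S)
  have L: "(\<lambda>p. \<phi> k p - u p) \<in> L2 \<Omega>" for k by (intro L2_diff S1_L2 uS \<phi>S)
  show thesis
  proof (rule that[OF \<phi>])
    show "(\<lambda>k. L2_norm \<Omega> (\<lambda>p. \<phi> k p - u p)) \<longlonglongrightarrow> 0"
      by (rule tendsto_sandwich[OF _ _ tendsto_const LIMSEQ_inverse_real_of_nat];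
          intro always_eventually allI order_trans[OF S1_norm_bounds(1)[OF w L] b'])
        (simp add: L2_norm_def)
    fix i
    show "(\<lambda>k. L2_norm \<Omega> (\<lambda>p. vf i (\<phi> k) p - weak \<Omega> i u p)) \<longlonglongrightarrow> 0"
      by (rule tendsto_sandwich[OF _ _ tendsto_const LIMSEQ_inverse_real_of_nat];
          intro always_eventually allI order_trans[OF S1_norm_bounds(2)[OF w L] b'])
        (simp add: L2_norm_def)
  qed
qed

text \<open>The boundary condition sits in \<open>u\<close>, so the behaviour of \<psi> at the
  boundary is free: with test functions in place of \<open>u\<close> the identity has no boundary
  term, and both sides pass to the limit. This admits as \<psi> the derivatives of a trial function
  that solves the equation on the whole group.\<close>

lemma S1_0_integration_by_parts:
  assumes u: "u \<in> S1_0 \<Omega>" and \<psi>: "C_k 1 \<psi>" "\<psi> \<in> L2 \<Omega>" "vf i \<psi> \<in> L2 \<Omega>"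
  shows "(LINT p|lebesgue_on \<Omega>. weak \<Omega> i u p * \<psi> p) = - (LINT p|lebesgue_on \<Omega>. u p * vf i \<psi> p)"
proof -
  obtain \<phi> where \<phi>: "\<And>k. \<phi> k \<in> test_fun \<Omega>" "(\<lambda>k. L2_norm \<Omega> (\<lambda>p. \<phi> k p - u p)) \<longlonglongrightarrow> 0"
    "\<And>i. (\<lambda>k. L2_norm \<Omega> (\<lambda>p. vf i (\<phi> k) p - weak \<Omega> i u p)) \<longlonglongrightarrow> 0"
    using S1_0_sequence[OF u] by blast
  have uS: "u \<in> S1 \<Omega>" using u by (rule S1_0_S1[OF \<Omega>])
  have "(\<lambda>k. LINT p|lebesgue_on \<Omega>. vf i (\<phi> k) p * \<psi> p) \<longlonglongrightarrow> (LINT p|lebesgue_on \<Omega>. weak \<Omega> i u p * \<psi> p)"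
    by (intro L2_mult_tendsto[OF \<Omega>] \<phi> \<psi> vf_test_L2 open_sets_lebesgue[OF \<Omega>] is_weak_L2[OF S1_weak[OF uS]])
  moreover have "(\<lambda>k. - (LINT p|lebesgue_on \<Omega>. \<phi> k p * vf i \<psi> p)) \<longlonglongrightarrow> - (LINT p|lebesgue_on \<Omega>. u p * vf i \<psi> p)"
    by (intro tendsto_minus L2_mult_tendsto[OF \<Omega>] \<phi> \<psi> test_fun_in_L2 open_sets_lebesgue[OF \<Omega>] S1_L2[OF uS])
  moreover have "(\<lambda>k. LINT p|lebesgue_on \<Omega>. vf i (\<phi> k) p * \<psi> p) = (\<lambda>k. - (LINT p|lebesgue_on \<Omega>. \<phi> k p * vf i \<psi> p))"
    by (intro ext vf_integration_by_parts \<phi> \<psi> open_sets_lebesgue[OF \<Omega>])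
  ultimately show ?thesis using LIMSEQ_unique by simp
qed

text \<open>With \<open>exp (\<i> \<xi> x)\<close> as a multiplier, \<open>X u = 0\<close> forces the Fourier transform in \<open>x\<close> of \<open>\<bar>u\<bar>\<^sup>2\<close> to vanish at
  every \<open>\<xi> \<noteq> 0\<close>, hence by continuity at \<open>\<xi> = 0\<close>.\<close>

lemma S1_0_zero_derivative:
  assumes u: "u \<in> S1_0 \<Omega>" and z: "L2_norm \<Omega> (weak \<Omega> (Inl j) u) = 0"
  shows "L2_norm \<Omega> u = 0"
proof -
  let ?i = "Inl j :: 'n + 'n"
  interpret L2: semi_inner fscale "L2 \<Omega>" "L2_inner \<Omega>" by (rule L2_semi_inner)
  have uL: "u \<in> L2 \<Omega>" using u by (intro S1_L2 S1_0_S1[OF \<Omega>])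
  have wL: "weak \<Omega> ?i u \<in> L2 \<Omega>" using u by (intro is_weak_L2[OF S1_weak] S1_0_S1[OF \<Omega>])
  have w0: "AE p in lebesgue_on \<Omega>. weak \<Omega> ?i u p = 0" using z L2_norm_eq_0_iff[OF wL] by simp
  obtain \<phi> where \<phi>: "\<And>k. \<phi> k \<in> test_fun \<Omega>" "(\<lambda>k. L2_norm \<Omega> (\<lambda>p. \<phi> k p - u p)) \<longlonglongrightarrow> 0"
    "\<And>i. (\<lambda>k. L2_norm \<Omega> (\<lambda>p. vf i (\<phi> k) p - weak \<Omega> i u p)) \<longlonglongrightarrow> 0"
    using S1_0_sequence[OF u] by blast
  define x where "x p = fst p $ j" for p :: "'n heis"
  have xl: "bounded_linear x" unfolding x_def
    by (intro bounded_linear_vec_nth[THEN bounded_linear_compose] bounded_linear_fst)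
  have F0: "(LINT p|lebesgue_on \<Omega>. exp (\<i> * of_real (\<xi> * x p)) * of_real ((cmod (u p))\<^sup>2)) = 0" if \<xi>: "\<xi> \<noteq> 0" for \<xi> :: real
  proof -
    define e where "e p = exp (\<i> * of_real (\<xi> * x p))" for p
    have lin: "bounded_linear (\<lambda>p. \<i> * complex_of_real (\<xi> * x p))"
      by (intro bounded_linear_const_mult bounded_linear_compose[OF bounded_linear_of_real] xl)
    have eC: "C_k k e" for k unfolding e_def by (intro C_k_exp C_k_linear lin)
    have ec: "continuous_on UNIV e" by (rule C_k_continuous[OF eC])
    have e1: "cmod (e p) = 1" for p by (simp add: e_def norm_exp_i_times)
    have de: "(e has_derivative (\<lambda>h. e p * (\<i> * of_real (\<xi> * x h)))) (at p)" for p
      unfolding e_def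
      by (rule has_derivative_compose[OF bounded_linear_imp_has_derivative[OF lin] DERIV_exp[unfolded has_field_derivative_def]])
    have vfe: "vf ?i e p = e p * (\<i> * of_real \<xi>)" for p
      by (simp add: vf_has_derivative[OF de] x_def hdir_def vdir_def)
    have ueL: "(\<lambda>p. u p * e p) \<in> L2 \<Omega>" by (rule L2_bounded_mult[OF uL ec, of 1]) (simp add: e1)
    \<comment> \<open>The function to insert would be \<open>cnj u * e\<close>, which need not be
      smooth; the approximant \<open>\<phi> k\<close> stands in for \<open>u\<close> in the
      conjugate factor. Where the derivative hits \<open>e\<close> it yields the factor
      \<open>\<i> * \<xi>\<close>.\<close>
    have key: "\<i> * of_real \<xi> * L2_inner \<Omega> (\<lambda>p. u p * e p) (\<phi> k) = - L2_inner \<Omega> (\<lambda>p. u p * e p) (vf ?i (\<phi> k))" for k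
    proof -
      define \<psi> where "\<psi> p = cnj (\<phi> k p) * e p" for p
      have \<psi>t: "\<psi> \<in> test_fun \<Omega>" unfolding \<psi>_def by (intro test_fun_mult test_fun_cnj \<phi> eC)
      have C: "C_k 1 \<psi>" "C_k 1 (\<phi> k)" using \<psi>t \<phi>(1)[of k] by (blast elim: test_funE)+
      have d: "\<phi> k differentiable (at p)" "e differentiable (at p)" "(\<lambda>p. cnj (\<phi> k p)) differentiable (at p)" for p
        using C_k_1D(1)[OF C(2)] C_k_1D(1)[OF eC] C_k_1D(1)[OF C_k_cnj[OF C(2)]] by blast+
      have "vf ?i \<psi> p = cnj (\<phi> k p) * (e p * (\<i> * of_real \<xi>)) + cnj (vf ?i (\<phi> k) p) * e p" for p
        unfolding \<psi>_def by (simp add: vf_mult[OF d(3,2)] vf_cnj[OF d(1)] vfe)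
      moreover have "(LINT p|lebesgue_on \<Omega>. weak \<Omega> ?i u p * \<psi> p) = 0"
      proof -
        have "AE p in lebesgue_on \<Omega>. weak \<Omega> ?i u p * \<psi> p = 0" using w0 by eventually_elim simp
        then show ?thesis by (rule integral_eq_zero_AE)
      qed
      ultimately have "(LINT p|lebesgue_on \<Omega>. u p * (cnj (\<phi> k p) * (e p * (\<i> * of_real \<xi>)) + cnj (vf ?i (\<phi> k) p) * e p)) = 0"
        using S1_0_integration_by_parts[OF u C(1), of ?i] test_fun_in_L2[OF \<psi>t open_sets_lebesgue[OF \<Omega>]]
          vf_test_L2[OF \<psi>t open_sets_lebesgue[OF \<Omega>]] by simp
      also have "(\<lambda>p. u p * (cnj (\<phi> k p) * (e p * (\<i> * of_real \<xi>)) + cnj (vf ?i (\<phi> k) p) * e p))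
          = (\<lambda>p. \<i> * of_real \<xi> * ((u p * e p) * cnj (\<phi> k p)) + (u p * e p) * cnj (vf ?i (\<phi> k) p))"
        by (auto simp: algebra_simps)
      also have "(LINT p|lebesgue_on \<Omega>. \<i> * of_real \<xi> * ((u p * e p) * cnj (\<phi> k p)) + (u p * e p) * cnj (vf ?i (\<phi> k) p))
          = \<i> * of_real \<xi> * L2_inner \<Omega> (\<lambda>p. u p * e p) (\<phi> k) + L2_inner \<Omega> (\<lambda>p. u p * e p) (vf ?i (\<phi> k))"
        unfolding L2_inner_def
        by (subst Bochner_Integration.integral_add)
          (auto intro!: integrable_mult_right L2_inner_integrable ueL test_fun_in_L2 vf_test_L2 \<phi> open_sets_lebesgue[OF \<Omega>]
            simp del: mult.assoc)
      finally show ?thesis by (simp add: add_eq_0_iff)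
    qed
    have lim: "(\<lambda>k. L2_inner \<Omega> w (f k)) \<longlonglongrightarrow> L2_inner \<Omega> w g"
      if "\<And>k. f k \<in> L2 \<Omega>" "g \<in> L2 \<Omega>" "w \<in> L2 \<Omega>" "(\<lambda>k. L2_norm \<Omega> (\<lambda>p. f k p - g p)) \<longlonglongrightarrow> 0" for f g w
    proof -
      have "(\<lambda>k. cnj (L2_inner \<Omega> (f k) w)) \<longlonglongrightarrow> cnj (L2_inner \<Omega> g w)"
        using that by (intro tendsto_cnj L2.ip_tendsto) (auto simp: L2_nrm fun_diff_def)
      then show ?thesis using L2.ip_cnj[OF that(1,3)] L2.ip_cnj[OF that(2,3)] by simp
    qed
    have "(\<lambda>k. \<i> * of_real \<xi> * L2_inner \<Omega> (\<lambda>p. u p * e p) (\<phi> k)) \<longlonglongrightarrow> \<i> * of_real \<xi> * L2_inner \<Omega> (\<lambda>p. u p * e p) u"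
      by (intro tendsto_mult tendsto_const lim ueL uL \<phi> test_fun_in_L2 open_sets_lebesgue[OF \<Omega>])
    moreover have "(\<lambda>k. - L2_inner \<Omega> (\<lambda>p. u p * e p) (vf ?i (\<phi> k))) \<longlonglongrightarrow> - L2_inner \<Omega> (\<lambda>p. u p * e p) (weak \<Omega> ?i u)"
      by (intro tendsto_minus lim ueL wL \<phi> vf_test_L2 open_sets_lebesgue[OF \<Omega>])
    ultimately have "\<i> * of_real \<xi> * L2_inner \<Omega> (\<lambda>p. u p * e p) u = - L2_inner \<Omega> (\<lambda>p. u p * e p) (weak \<Omega> ?i u)"
      using LIMSEQ_unique by (simp add: key)
    also have "L2_inner \<Omega> (\<lambda>p. u p * e p) (weak \<Omega> ?i u) = 0"
      unfolding L2_inner_def by (rule integral_eq_zero_AE) (use w0 in eventually_elim, simp)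
    finally have "L2_inner \<Omega> (\<lambda>p. u p * e p) u = 0" using \<xi> by simp
    moreover have "(\<lambda>p. exp (\<i> * of_real (\<xi> * x p)) * of_real ((cmod (u p))\<^sup>2)) = (\<lambda>p. u p * e p * cnj (u p))"
      by (simp only: complex_norm_square e_def ac_simps)
    ultimately show ?thesis unfolding L2_inner_def by simp
  qed
  have iu: "integrable (lebesgue_on \<Omega>) (\<lambda>p. (cmod (u p))\<^sup>2)" by (rule L2D(2)[OF uL])
  \<comment> \<open>Continuity at frequency 0, along \<open>\<xi> = 1/(k+1)\<close>, with
    \<open>|u|^2\<close> itself as the integrable bound.\<close>
  have "(\<lambda>k. LINT p|lebesgue_on \<Omega>. exp (\<i> * of_real (inverse (real (Suc k)) * x p)) * of_real ((cmod (u p))\<^sup>2))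
      \<longlonglongrightarrow> (LINT p|lebesgue_on \<Omega>. of_real ((cmod (u p))\<^sup>2))"
  proof (rule integral_dominated_convergence[OF _ _ iu])
    have "continuous_on UNIV x" by (rule linear_continuous_on[OF xl])
    then have "(\<lambda>p. exp (\<i> * of_real (c * x p))) \<in> borel_measurable borel" for c
      by (intro borel_measurable_continuous_onI continuous_intros)
    then have [measurable]: "(\<lambda>p. exp (\<i> * of_real (c * x p))) \<in> borel_measurable (lebesgue_on \<Omega>)" for c
      by (intro measurable_restrict_space1 measurable_completion) simp
    note [measurable] = L2D(1)[OF uL]
    show "(\<lambda>p. complex_of_real ((cmod (u p))\<^sup>2)) \<in> borel_measurable (lebesgue_on \<Omega>)" by measurable
    show "(\<lambda>p. exp (\<i> * of_real (inverse (real (Suc k)) * x p)) * of_real ((cmod (u p))\<^sup>2)) \<in> borel_measurable (lebesgue_on \<Omega>)" for k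
      by measurable
    show "AE p in lebesgue_on \<Omega>. norm (exp (\<i> * of_real (inverse (real (Suc k)) * x p)) * of_real ((cmod (u p))\<^sup>2)) \<le> (cmod (u p))\<^sup>2" for k
      by (simp only: norm_mult norm_exp_i_times norm_of_real) simp
    show "AE p in lebesgue_on \<Omega>. (\<lambda>k. exp (\<i> * of_real (inverse (real (Suc k)) * x p)) * of_real ((cmod (u p))\<^sup>2)) \<longlonglongrightarrow> of_real ((cmod (u p))\<^sup>2)"
    proof (rule AE_I2)
      fix p
      have "(\<lambda>k. exp (\<i> * of_real (inverse (real (Suc k)) * x p)) * of_real ((cmod (u p))\<^sup>2)) \<longlonglongrightarrow> exp (\<i> * of_real (0 * x p)) * of_real ((cmod (u p))\<^sup>2)"
        by (intro tendsto_mult tendsto_const tendsto_exp tendsto_of_real LIMSEQ_inverse_real_of_nat)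
      then show "(\<lambda>k. exp (\<i> * of_real (inverse (real (Suc k)) * x p)) * of_real ((cmod (u p))\<^sup>2)) \<longlonglongrightarrow> of_real ((cmod (u p))\<^sup>2)"
        by simp
    qed
  qed
  moreover have "(LINT p|lebesgue_on \<Omega>. exp (\<i> * of_real (inverse (real (Suc k)) * x p)) * of_real ((cmod (u p))\<^sup>2)) = 0" for k
    by (rule F0) simp
  ultimately have "(LINT p|lebesgue_on \<Omega>. complex_of_real ((cmod (u p))\<^sup>2)) = 0" by (simp add: LIMSEQ_const_iff)
  then have "(LINT p|lebesgue_on \<Omega>. (cmod (u p))\<^sup>2) = 0" by (simp only: integral_complex_of_real of_real_eq_0_iff)
  then show ?thesis by (simp add: L2_norm_def)
qed

end

section \<open>Dilations\<close>

text \<open>The anisotropic dilations of the group: t is scaled by the square, so that the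
  horizontal fields are homogeneous of degree 1.\<close>

definition dil :: "real \<Rightarrow> 'n::finite heis \<Rightarrow> 'n heis" where
  "dil s p = (s *\<^sub>R fst p, s *\<^sub>R fst (snd p), s\<^sup>2 * snd (snd p))"

definition dil_factor :: "real \<Rightarrow> 'n::finite heis \<Rightarrow> real" where
  "dil_factor s b = (if b = vdir then s\<^sup>2 else s)"

text \<open>Equals \<open>|s|^(2n + 2)\<close>; kept as the product in which the change of variables
  for diagonal maps delivers it.\<close>

definition dil_jac :: "'n::finite itself \<Rightarrow> real \<Rightarrow> real" where
  "dil_jac _ s = (\<Prod>b\<in>(Basis :: 'n heis set). \<bar>dil_factor s b\<bar>)"

lemma dil_inverse: "s \<noteq> 0 \<Longrightarrow> dil s (dil (1/s) p) = p" "s \<noteq> 0 \<Longrightarrow> dil (1/s) (dil s p) = p"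
  by (auto simp: dil_def power2_eq_square)

lemma dil_linear: "bounded_linear (dil s)"
  unfolding dil_def[abs_def]
  by (intro bounded_linear_Pair bounded_linear_scaleR_right[THEN bounded_linear_compose] bounded_linear_const_mult
      bounded_linear_fst bounded_linear_fst[THEN bounded_linear_compose] bounded_linear_snd[THEN bounded_linear_compose] bounded_linear_snd)

lemma dil_Basis: "b \<in> Basis \<Longrightarrow> dil s b = dil_factor s b *\<^sub>R b"
  by (auto simp: dil_def dil_factor_def Basis_prod_def vdir_def zero_prod_def)

lemma dil_expansion: "dil s p = 0 + (\<Sum>b\<in>Basis. (dil_factor s b * (p \<bullet> b)) *\<^sub>R b)"
proof -
  interpret bounded_linear "dil s" by (rule dil_linear)
  have "dil s p = dil s (\<Sum>b\<in>Basis. (p \<bullet> b) *\<^sub>R b)" by (simp only: euclidean_representation)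
  also have "\<dots> = (\<Sum>b\<in>Basis. (p \<bullet> b) *\<^sub>R dil s b)" by (simp add: sum scaleR)
  also have "\<dots> = (\<Sum>b\<in>Basis. (dil_factor s b * (p \<bullet> b)) *\<^sub>R b)"
    by (intro sum.cong refl) (simp add: dil_Basis)
  finally show ?thesis by simp
qed

lemma dil_jac_pos: "s \<noteq> 0 \<Longrightarrow> dil_jac TYPE('n::finite) s > 0"
  by (auto simp: dil_jac_def dil_factor_def intro!: prod_pos)

lemma dil_jac_ge_1: "s \<ge> 1 \<Longrightarrow> dil_jac TYPE('n::finite) s \<ge> 1"
  unfolding dil_jac_def dil_factor_def by (intro prod_ge_1) auto

lemma dil_measurable: "s \<noteq> 0 \<Longrightarrow> dil s \<in> lebesgue \<rightarrow>\<^sub>M lebesgue"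
  unfolding dil_expansion[abs_def] by (rule lebesgue_affine_measurable) (auto simp: dil_factor_def)

lemma dil_density:
  "s \<noteq> 0 \<Longrightarrow> (lebesgue :: 'n::finite heis measure) = density (distr lebesgue lebesgue (dil s)) (\<lambda>_. ennreal (dil_jac TYPE('n) s))"
  unfolding dil_expansion[abs_def] dil_jac_def
  by (rule lebesgue_affine_euclidean) (auto simp: dil_factor_def)

lemma integrable_dil:
  fixes f :: "'n::finite heis \<Rightarrow> 'b::{banach, second_countable_topology}"
  assumes s: "s \<noteq> 0" and f: "integrable lebesgue f"
  shows "integrable lebesgue (\<lambda>p. f (dil s p))"
proof -
  have fm: "f \<in> borel_measurable lebesgue" using f by auto
  have "integrable (density (distr lebesgue lebesgue (dil s)) (\<lambda>_. ennreal (dil_jac TYPE('n) s))) f"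
    using f dil_density[OF s] by metis
  then have "integrable (distr lebesgue lebesgue (dil s)) (\<lambda>p. dil_jac TYPE('n) s *\<^sub>R f p)"
    using dil_jac_pos[OF s, where 'n = 'n] fm by (subst (asm) integrable_density) auto
  then have "integrable (distr lebesgue lebesgue (dil s)) f"
    using dil_jac_pos[OF s, where 'n = 'n]
      integrable_scaleR_right[of "inverse (dil_jac TYPE('n) s)" _ "\<lambda>p. dil_jac TYPE('n) s *\<^sub>R f p"] by simp
  then show ?thesis using dil_measurable[OF s] fm by (subst (asm) integrable_distr_eq) auto
qed

lemma integral_dil:
  fixes f :: "'n::finite heis \<Rightarrow> 'b::{banach, second_countable_topology}"
  assumes s: "s \<noteq> 0" and f: "f \<in> borel_measurable lebesgue"
  shows "dil_jac TYPE('n) s *\<^sub>R (LINT p|lebesgue. f (dil s p)) = (LINT p|lebesgue. f p)"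
proof -
  have "(LINT p|lebesgue. f p) = (LINT p|density (distr lebesgue lebesgue (dil s)) (\<lambda>_. ennreal (dil_jac TYPE('n) s)). f p)"
    using dil_density[OF s] by metis
  also have "\<dots> = (LINT p|distr lebesgue lebesgue (dil s). dil_jac TYPE('n) s *\<^sub>R f p)"
    using dil_jac_pos[OF s, where 'n = 'n] f by (subst integral_density) auto
  also have "\<dots> = dil_jac TYPE('n) s *\<^sub>R (LINT p|lebesgue. f (dil s p))"
    using dil_measurable[OF s] f by (subst integral_distr) auto
  finally show ?thesis by simp
qed

lemma partial_deriv_dil:
  assumes "\<phi> differentiable (at (dil s p))" "b \<in> Basis"
  shows "partial_deriv b (\<lambda>p. \<phi> (dil s p)) p = of_real (dil_factor s b) * partial_deriv b \<phi> (dil s p)"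
proof -
  note f = frechet_derivative_works[THEN iffD1, OF assms(1)]
  have "((\<lambda>p. \<phi> (dil s p)) has_derivative (\<lambda>h. frechet_derivative \<phi> (at (dil s p)) (dil s h))) (at p)"
    by (rule has_derivative_compose[OF bounded_linear_imp_has_derivative[OF dil_linear] f])
  then have "partial_deriv b (\<lambda>p. \<phi> (dil s p)) p = frechet_derivative \<phi> (at (dil s p)) (dil_factor s b *\<^sub>R b)"
    by (simp add: partial_deriv_eq dil_Basis[OF assms(2)])
  also have "\<dots> = dil_factor s b *\<^sub>R frechet_derivative \<phi> (at (dil s p)) b"
    by (rule linear_cmul[OF linear_frechet_derivative[OF assms(1)]])
  finally show ?thesis by (simp add: partial_deriv_def scaleR_conv_of_real)
qed

lemma C_1_dil:
  assumes "C_k 1 \<phi>"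
  shows "C_k 1 (\<lambda>p. \<phi> (dil s p))"
proof -
  have "(\<lambda>p. \<phi> (dil s p)) differentiable (at p)" for p
    using differentiableI[OF has_derivative_compose[OF bounded_linear_imp_has_derivative[OF dil_linear]
      frechet_derivative_works[THEN iffD1, OF C_k_1D(1)[OF assms]]]] .
  moreover have "continuous_on UNIV (partial_deriv b (\<lambda>p. \<phi> (dil s p)))" if "b \<in> Basis" for b
  proof -
    have "continuous_on UNIV (\<lambda>p. of_real (dil_factor s b) * partial_deriv b \<phi> (dil s p))"
      by (intro continuous_on_mult continuous_on_const
          continuous_on_compose2[OF C_k_1D(2)[OF assms that] linear_continuous_on[OF dil_linear]]) auto
    then show ?thesis using partial_deriv_dil[OF C_k_1D(1)[OF assms] that] by presburger
  qed
  ultimately show ?thesis by simp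
qed

text \<open>Differentiation in t brings out \<open>s^2\<close>; one of these factors turns the
  coefficient at \<open>p\<close> into the coefficient at the dilated point, which leaves the same
  factor \<open>s\<close> as in the direction \<open>hdir i\<close>.\<close>

lemma vf_dil:
  assumes "\<phi> differentiable (at (dil s p))"
  shows "vf i (\<lambda>p. \<phi> (dil s p)) p = of_real s * vf i \<phi> (dil s p)"
proof -
  have "hdir i \<noteq> vdir" by (auto simp: hdir_def vdir_def split: sum.split)
  moreover have "hcoef i (dil s p) = s * hcoef i p" by (auto simp: hcoef_def dil_def split: sum.split)
  ultimately show ?thesis
    using partial_deriv_dil[OF assms hdir_Basis] partial_deriv_dil[OF assms vdir_Basis]
    by (simp add: vf_def dil_factor_def algebra_simps power2_eq_square)
qed

section \<open>Extension by zero and the dilation argument\<close>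

definition zext :: "'a set \<Rightarrow> ('a \<Rightarrow> complex) \<Rightarrow> 'a \<Rightarrow> complex" where
  "zext \<Omega> u p = (if p \<in> \<Omega> then u p else 0)"

lemma zext_measurable:
  assumes "\<Omega> \<in> sets lebesgue" "u \<in> borel_measurable (lebesgue_on \<Omega>)"
  shows "zext \<Omega> u \<in> borel_measurable lebesgue"
  using borel_measurable_if_I[OF assms(2,1)] unfolding zext_def[abs_def] .

lemma integral_zext:
  assumes "\<Omega> \<in> sets lebesgue" "\<And>p. p \<in> \<Omega> \<Longrightarrow> f p = g p" "\<And>p. p \<notin> \<Omega> \<Longrightarrow> g p = 0"
  shows "(LINT p|lebesgue_on \<Omega>. f p) = (LINT p|lebesgue. g p :: complex)"
proof -
  have "(LINT p|lebesgue_on \<Omega>. f p) = (LINT p|lebesgue. indicator \<Omega> p *\<^sub>R f p)"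
    using assms(1) by (intro integral_restrict_space) simp
  also have "(\<lambda>p. indicator \<Omega> p *\<^sub>R f p) = g" using assms(2,3) by (auto simp: fun_eq_iff indicator_def)
  finally show ?thesis .
qed

lemma zext_L2:
  assumes \<Omega>: "\<Omega> \<in> sets lebesgue" and u: "u \<in> L2 \<Omega>"
  shows "zext \<Omega> u \<in> L2 UNIV"
proof -
  have "integrable lebesgue (\<lambda>p. indicator \<Omega> p *\<^sub>R (cmod (u p))\<^sup>2)"
    using L2D(2)[OF u] \<Omega> by (subst (asm) integrable_restrict_space) auto
  moreover have "(\<lambda>p. indicator \<Omega> p *\<^sub>R (cmod (u p))\<^sup>2) = (\<lambda>p. (cmod (zext \<Omega> u p))\<^sup>2)"
    by (auto simp: zext_def fun_eq_iff)
  ultimately show ?thesis using zext_measurable[OF \<Omega> L2D(1)[OF u]] by (simp add: L2_def lebesgue_on_UNIV_eq)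
qed

lemma L2_restrict:
  assumes \<Omega>: "\<Omega> \<in> sets lebesgue" and u: "u \<in> L2 UNIV"
  shows "u \<in> L2 \<Omega>"
proof -
  have "integrable lebesgue (\<lambda>p. (cmod (u p))\<^sup>2)" "u \<in> borel_measurable lebesgue"
    using u by (auto simp: L2_def lebesgue_on_UNIV_eq)
  then show ?thesis
    using integrable_mult_indicator[OF \<Omega>, of "\<lambda>p. (cmod (u p))\<^sup>2"] \<Omega>
    by (auto simp: L2_def integrable_restrict_space intro: measurable_restrict_space1)
qed

lemma L2_dil:
  assumes "s \<noteq> 0" "u \<in> L2 UNIV"
  shows "(\<lambda>p. u (dil s p)) \<in> L2 UNIV"
  using assms integrable_dil[of s "\<lambda>p. (cmod (u p))\<^sup>2"] measurable_compose[OF dil_measurable[of s], of u borel]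
  by (auto simp: L2_def lebesgue_on_UNIV_eq)

lemma L2_inner_zext:
  assumes "\<Omega> \<in> sets lebesgue"
  shows "L2_inner \<Omega> u v = L2_inner UNIV (zext \<Omega> u) v"
  unfolding L2_inner_def lebesgue_on_UNIV_eq by (rule integral_zext[OF assms]) (auto simp: zext_def)

text \<open>Substituting the inverse dilation moves it from one argument to the other. This relates
  the parameters \<open>s\<close> and \<open>1/s\<close> and so supplies the second equation in
  \<open>dirichlet_neumann_zero\<close>.\<close>

lemma L2_inner_dil_swap:
  fixes u :: "'n::finite heis \<Rightarrow> complex"
  assumes s: "s \<noteq> 0" and u: "u \<in> L2 UNIV"
  shows "of_real (dil_jac TYPE('n) s) * L2_inner UNIV u (\<lambda>p. u (dil s p)) = cnj (L2_inner UNIV u (\<lambda>p. u (dil (1/s) p)))"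
proof -
  interpret L2: semi_inner fscale "L2 UNIV :: ('n heis \<Rightarrow> complex) set" "L2_inner UNIV" by (rule L2_semi_inner)
  have ud: "(\<lambda>p. u (dil (1/s) p)) \<in> L2 UNIV" using s u by (intro L2_dil) auto
  have m: "(\<lambda>p. u (dil (1/s) p) * cnj (u p)) \<in> borel_measurable lebesgue"
    using borel_measurable_integrable[OF L2_inner_integrable[OF ud u]] by (simp add: lebesgue_on_UNIV_eq)
  have "of_real (dil_jac TYPE('n) s) * L2_inner UNIV u (\<lambda>p. u (dil s p)) = L2_inner UNIV (\<lambda>p. u (dil (1/s) p)) u"
    using integral_dil[OF s m] by (simp add: L2_inner_def lebesgue_on_UNIV_eq dil_inverse[OF s] scaleR_conv_of_real)
  also have "\<dots> = cnj (L2_inner UNIV u (\<lambda>p. u (dil (1/s) p)))" by (rule L2.ip_cnj[OF u ud])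
  finally show ?thesis .
qed

lemma L2_norm_dil:
  fixes u :: "'n::finite heis \<Rightarrow> complex"
  assumes s: "s \<ge> 1" and u: "u \<in> L2 UNIV"
  shows "L2_norm UNIV (\<lambda>p. u (dil s p)) \<le> L2_norm UNIV u"
proof -
  have s0: "s \<noteq> 0" using s by simp
  have "(\<lambda>p. (cmod (u p))\<^sup>2) \<in> borel_measurable lebesgue" using u by (auto simp: L2_def lebesgue_on_UNIV_eq)
  from integral_dil[OF s0 this]
  have "(LINT p|lebesgue. (cmod (u p))\<^sup>2) = dil_jac TYPE('n) s * (LINT p|lebesgue. (cmod (u (dil s p)))\<^sup>2)" by simp
  moreover have "1 * (LINT p|lebesgue. (cmod (u (dil s p)))\<^sup>2) \<le> dil_jac TYPE('n) s * (LINT p|lebesgue. (cmod (u (dil s p)))\<^sup>2)"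
    using dil_jac_ge_1[OF s, where 'n = 'n] by (intro mult_right_mono) auto
  ultimately show ?thesis by (simp add: L2_norm_def lebesgue_on_UNIV_eq)
qed

context
  fixes \<Omega> :: "'n::finite heis set"
  assumes \<Omega>: "open \<Omega>"
begin

text \<open>For \<open>u\<close> in \<open>S1_0\<close> extension by zero creates no boundary term,
  so integration by parts may be done against the transported test function
  \<open>\<phi> (dil (1/s) p)\<close>, whose support can leave \<Omega>. Thus every dilate of the
  extended \<open>u\<close>, restricted to \<Omega>, belongs to \<open>S1\<close>.\<close>

lemma dilated_weak:
  assumes u: "u \<in> S1_0 \<Omega>" and s: "s > 0"
  shows "is_weak \<Omega> i (\<lambda>p. zext \<Omega> u (dil s p)) (\<lambda>p. of_real s * zext \<Omega> (weak \<Omega> i u) (dil s p))"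
proof -
  note \<Omega>L = open_sets_lebesgue[OF \<Omega>]
  have s0: "s \<noteq> 0" "1/s \<noteq> 0" using s by auto
  have uS: "u \<in> S1 \<Omega>" using u by (rule S1_0_S1[OF \<Omega>])
  let ?g = "weak \<Omega> i u"
  have gL: "?g \<in> L2 \<Omega>" by (rule is_weak_L2[OF S1_weak[OF uS]])
  have m: "zext \<Omega> u \<in> borel_measurable lebesgue" "zext \<Omega> ?g \<in> borel_measurable lebesgue"
    using zext_L2[OF \<Omega>L] S1_L2[OF uS] gL by (auto simp: L2_def lebesgue_on_UNIV_eq)
  show ?thesis
    unfolding is_weak_def
  proof (intro conjI ballI)
    show "(\<lambda>p. of_real s * zext \<Omega> ?g (dil s p)) \<in> L2 \<Omega>"
      by (intro L2_scale L2_restrict[OF \<Omega>L] L2_dil s0 zext_L2[OF \<Omega>L] gL)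
    fix \<phi> assume \<phi>: "\<phi> \<in> test_fun \<Omega>"
    obtain K where K: "\<And>k. C_k k \<phi>" "compact K" "\<And>p. p \<notin> K \<Longrightarrow> \<phi> p = 0" "K \<subseteq> \<Omega>"
      by (rule test_funE[OF \<phi>]) (rule that)
    have z: "vf i \<phi> p = 0" if "p \<notin> K" for p by (rule vf_zero_outside[OF compact_imp_closed[OF K(2)] K(3) that])
    define \<psi> where "\<psi> p = \<phi> (dil (1/s) p)" for p
    define K' where "K' = dil s ` K"
    have \<psi>C: "C_k 1 \<psi>" unfolding \<psi>_def by (rule C_1_dil[OF K(1)])
    have K'c: "compact K'" unfolding K'_def by (intro compact_continuous_image linear_continuous_on dil_linear K)
    have \<psi>z: "\<psi> p = 0" if "p \<notin> K'" for p
    proof -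
      have "dil (1/s) p \<notin> K" using that dil_inverse(1)[OF s0(1), of p] unfolding K'_def by (metis imageI)
      then show ?thesis by (simp add: \<psi>_def K)
    qed
    have vf\<psi>: "vf i \<psi> p = of_real (1/s) * vf i \<phi> (dil (1/s) p)" for p
      unfolding \<psi>_def by (rule vf_dil[OF C_k_1D(1)[OF K(1)]])
    have \<psi>L: "\<psi> \<in> L2 \<Omega>" by (rule compact_support_L2[OF C_k_continuous[OF \<psi>C] K'c \<psi>z \<Omega>L])
    have vf\<psi>L: "vf i \<psi> \<in> L2 \<Omega>"
      by (rule compact_support_L2[OF C_k_continuous[OF C_k_vf[OF \<psi>C[unfolded One_nat_def]]] K'c
          vf_zero_outside[OF compact_imp_closed[OF K'c] \<psi>z] \<Omega>L])
    have ibp: "(LINT p|lebesgue. zext \<Omega> ?g p * \<psi> p) = - (LINT p|lebesgue. zext \<Omega> u p * vf i \<psi> p)"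
    proof -
      have "(LINT p|lebesgue_on \<Omega>. ?g p * \<psi> p) = (LINT p|lebesgue. zext \<Omega> ?g p * \<psi> p)"
        "(LINT p|lebesgue_on \<Omega>. u p * vf i \<psi> p) = (LINT p|lebesgue. zext \<Omega> u p * vf i \<psi> p)"
        by (rule integral_zext[OF \<Omega>L]; simp add: zext_def)+
      then show ?thesis using S1_0_integration_by_parts[OF \<Omega> u \<psi>C \<psi>L vf\<psi>L] by simp
    qed
    have mc: "\<psi> \<in> borel_measurable lebesgue" "vf i \<psi> \<in> borel_measurable lebesgue"
      using C_k_continuous[OF \<psi>C] C_k_continuous[OF C_k_vf[OF \<psi>C[unfolded One_nat_def]]]
      by (auto intro!: measurable_completion borel_measurable_continuous_onI)
    let ?J = "dil_jac TYPE('n) s"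
    have \<psi>s: "\<psi> (dil s p) = \<phi> p" "vf i \<psi> (dil s p) = of_real (1/s) * vf i \<phi> p" for p
      unfolding vf\<psi> by (simp_all add: \<psi>_def dil_inverse[OF s0(1)])
    have 1: "?J *\<^sub>R (LINT p|lebesgue. zext \<Omega> ?g (dil s p) * \<phi> p) = (LINT p|lebesgue. zext \<Omega> ?g p * \<psi> p)"
      using integral_dil[OF s0(1) borel_measurable_times[OF m(2) mc(1)]] by (simp only: \<psi>s)
    have "?J *\<^sub>R (LINT p|lebesgue. zext \<Omega> u (dil s p) * (of_real (1/s) * vf i \<phi> p)) = (LINT p|lebesgue. zext \<Omega> u p * vf i \<psi> p)"
      using integral_dil[OF s0(1) borel_measurable_times[OF m(1) mc(2)]] by (simp only: \<psi>s)
    moreover have "(LINT p|lebesgue. zext \<Omega> u (dil s p) * (of_real (1/s) * vf i \<phi> p))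
        = of_real (1/s) * (LINT p|lebesgue. zext \<Omega> u (dil s p) * vf i \<phi> p)"
      by (subst integral_mult_right_zero[symmetric]) (simp only: ac_simps)
    ultimately have 2: "?J *\<^sub>R (of_real (1/s) * (LINT p|lebesgue. zext \<Omega> u (dil s p) * vf i \<phi> p))
        = (LINT p|lebesgue. zext \<Omega> u p * vf i \<psi> p)" by simp
    have "?J *\<^sub>R (LINT p|lebesgue. zext \<Omega> ?g (dil s p) * \<phi> p)
        = ?J *\<^sub>R (- (of_real (1/s) * (LINT p|lebesgue. zext \<Omega> u (dil s p) * vf i \<phi> p)))"
      using ibp 1 2 by simp
    then have "(LINT p|lebesgue. zext \<Omega> ?g (dil s p) * \<phi> p) = - (of_real (1/s) * (LINT p|lebesgue. zext \<Omega> u (dil s p) * vf i \<phi> p))"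
      unfolding scaleR_cancel_left using dil_jac_pos[OF s0(1), where 'n = 'n] by (auto simp only:)
    then have 3: "of_real s * (LINT p|lebesgue. zext \<Omega> ?g (dil s p) * \<phi> p) = - (LINT p|lebesgue. zext \<Omega> u (dil s p) * vf i \<phi> p)"
      using s by simp
    have "(LINT p|lebesgue_on \<Omega>. of_real s * zext \<Omega> ?g (dil s p) * \<phi> p) = (LINT p|lebesgue. of_real s * (zext \<Omega> ?g (dil s p) * \<phi> p))"
      using K(3,4) by (intro integral_zext[OF \<Omega>L]) (auto simp: mult.assoc)
    also have "\<dots> = of_real s * (LINT p|lebesgue. zext \<Omega> ?g (dil s p) * \<phi> p)" by (rule integral_mult_right_zero)
    also have "\<dots> = - (LINT p|lebesgue. zext \<Omega> u (dil s p) * vf i \<phi> p)" by (rule 3)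
    also have "(LINT p|lebesgue. zext \<Omega> u (dil s p) * vf i \<phi> p) = (LINT p|lebesgue_on \<Omega>. zext \<Omega> u (dil s p) * vf i \<phi> p)"
      using z K(4) by (intro integral_zext[OF \<Omega>L, symmetric]) auto
    finally show "(LINT p|lebesgue_on \<Omega>. of_real s * zext \<Omega> ?g (dil s p) * \<phi> p) = - (LINT p|lebesgue_on \<Omega>. zext \<Omega> u (dil s p) * vf i \<phi> p)" .
  qed
qed

text \<open>Testing the equation for \<open>u\<close> against the dilates \<open>u \<circ> \<delta>\<^sub>s\<close> shows that these are orthogonal to \<open>u\<close>
  for \<open>s \<noteq> 1\<close>, since the form has degree 2 under dilations.\<close>

lemma dirichlet_neumann_zero:
  assumes u: "u \<in> S1_0 \<Omega>" and \<mu>: "\<mu> \<noteq> 0"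
    and eq: "\<And>v. v \<in> S1 \<Omega> \<Longrightarrow> sub_form \<Omega> u v = of_real \<mu> * L2_inner \<Omega> u v"
  shows "L2_norm \<Omega> u = 0"
proof -
  note \<Omega>L = open_sets_lebesgue[OF \<Omega>]
  interpret L2: semi_inner fscale "L2 UNIV :: ('n heis \<Rightarrow> complex) set" "L2_inner UNIV" by (rule L2_semi_inner)
  have uS: "u \<in> S1 \<Omega>" using u by (rule S1_0_S1[OF \<Omega>])
  define v where "v = zext \<Omega> u"
  define g where "g i = zext \<Omega> (weak \<Omega> i u)" for i
  have vL: "v \<in> L2 UNIV" unfolding v_def by (rule zext_L2[OF \<Omega>L S1_L2[OF uS]])
  have gL: "g i \<in> L2 UNIV" for i unfolding g_def by (rule zext_L2[OF \<Omega>L is_weak_L2[OF S1_weak[OF uS]]])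
  define A where "A s = (\<Sum>i\<in>UNIV. L2_inner UNIV (g i) (\<lambda>p. g i (dil s p)))" for s
  define B where "B s = L2_inner UNIV v (\<lambda>p. v (dil s p))" for s
  have AB: "of_real s * A s = of_real \<mu> * B s" if s: "s > 0" for s
  proof -
    have s0: "s \<noteq> 0" using s by simp
    let ?v = "\<lambda>p. v (dil s p)" and ?g = "\<lambda>i p. of_real s * g i (dil s p)"
    have w: "is_weak \<Omega> i ?v (?g i)" for i unfolding v_def g_def by (rule dilated_weak[OF u s])
    have vS: "?v \<in> L2 \<Omega>" by (intro L2_restrict[OF \<Omega>L] L2_dil s0 vL)
    have "sub_form \<Omega> u ?v = (\<Sum>i\<in>UNIV. L2_inner \<Omega> (weak \<Omega> i u) (?g i))"
      by (rule sub_form_weak[OF \<Omega> S1_weak[OF uS] w S1_L2[OF uS] vS])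
    also have "\<dots> = (\<Sum>i\<in>UNIV. of_real s * L2_inner UNIV (g i) (\<lambda>p. g i (dil s p)))"
      by (intro sum.cong refl) (simp add: L2_inner_zext[OF \<Omega>L] g_def[symmetric] L2.ip_scale_right L2_dil[OF s0] gL)
    also have "\<dots> = of_real s * A s" by (simp add: A_def sum_distrib_left)
    finally show ?thesis using eq[OF S1I[OF vS w]] by (simp add: L2_inner_zext[OF \<Omega>L] v_def[symmetric] B_def)
  qed
  have swap: "of_real (dil_jac TYPE('n) s) * B s = cnj (B (1/s))" "of_real (dil_jac TYPE('n) s) * A s = cnj (A (1/s))" if "s \<noteq> 0" for s
    unfolding B_def A_def sum_distrib_left cnj_sum by (simp_all add: L2_inner_dil_swap[OF that] vL gL)
  \<comment> \<open>Two relations between \<open>A s\<close> and \<open>B s\<close>: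
    \<open>s A = \<mu> B\<close> directly, and \<open>A = s \<mu> B\<close> from the parameter
    \<open>1/s\<close> after swapping the arguments. Together they give
    \<open>\<mu> (s^2 - 1) B = 0\<close>.\<close>
  have B0: "B s = 0" if s: "s > 0" "s \<noteq> 1" for s
  proof -
    let ?J = "complex_of_real (dil_jac TYPE('n) s)"
    have J: "?J \<noteq> 0" using dil_jac_pos[of s, where 'n = 'n] s by simp
    have "of_real (1/s) * A (1/s) = of_real \<mu> * B (1/s)" using s by (intro AB) simp
    then have "A (1/s) = of_real s * of_real \<mu> * B (1/s)" using s by (simp add: field_simps)
    then have "cnj (A (1/s)) = of_real s * of_real \<mu> * cnj (B (1/s))" by simp
    then have "?J * A s = of_real s * of_real \<mu> * (?J * B s)" using swap[of s] s by simp
    then have "?J * (A s - of_real s * of_real \<mu> * B s) = 0" by (simp add: algebra_simps)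
    then have "A s = of_real s * of_real \<mu> * B s" using J by simp
    then have "of_real s * (of_real s * of_real \<mu> * B s) = of_real \<mu> * B s" using AB[OF s(1)] by simp
    then have "of_real \<mu> * (of_real (s\<^sup>2 - 1) * B s) = 0" by (simp add: algebra_simps power2_eq_square)
    moreover have "s\<^sup>2 - 1 \<noteq> 0" using s by (simp add: power2_eq_1_iff)
    ultimately show ?thesis using \<mu> by (simp del: of_real_diff)
  qed
  \<comment> \<open>The passage \<open>s \<rightarrow> 1\<close>, carried out on a test function
    \<phi> within \<epsilon> of \<open>v\<close>. As \<open>s\<close> decreases to 1 the inner
    product of \<phi> with its dilate tends to the squared norm of \<phi>, while by
    \<open>B0\<close> it is of order \<epsilon> for \<open>s > 1\<close>; and the norms of \<phi>
    and \<open>v\<close> differ by at most \<epsilon>.\<close>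
  have small: "(L2.nrm v)\<^sup>2 \<le> \<epsilon> * (4 * L2.nrm v + 4 * \<epsilon>)" if \<epsilon>: "\<epsilon> > 0" for \<epsilon>
  proof -
    obtain \<phi>s where \<phi>s: "\<And>k. \<phi>s k \<in> test_fun \<Omega>" "(\<lambda>k. L2_norm \<Omega> (\<lambda>p. \<phi>s k p - u p)) \<longlonglongrightarrow> 0"
      by (rule S1_0_sequence[OF \<Omega> u]) (rule that)
    have "eventually (\<lambda>k. L2_norm \<Omega> (\<lambda>p. \<phi>s k p - u p) < \<epsilon>) sequentially" by (rule order_tendstoD(2)[OF \<phi>s(2) \<epsilon>])
    then obtain k where k: "L2_norm \<Omega> (\<lambda>p. \<phi>s k p - u p) < \<epsilon>" by (auto simp: eventually_sequentially)
    define \<phi> where "\<phi> = \<phi>s k"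
    have \<phi>: "\<phi> \<in> test_fun \<Omega>" unfolding \<phi>_def by (rule \<phi>s)
    obtain K where K: "\<And>k. C_k k \<phi>" "compact K" "\<And>p. p \<notin> K \<Longrightarrow> \<phi> p = 0" "K \<subseteq> \<Omega>"
      by (rule test_funE[OF \<phi>]) (rule that)
    have c: "continuous_on UNIV \<phi>" by (rule C_k_continuous[OF K(1)])
    have \<phi>0: "\<phi> p = 0" if "p \<notin> \<Omega>" for p using K(3,4) that by blast
    have \<phi>L: "\<phi> \<in> L2 UNIV" by (rule compact_support_L2[OF c K(2,3) open_sets_lebesgue[OF open_UNIV]])
    have dL: "\<phi> - v \<in> L2 UNIV" by (intro L2.V_diff \<phi>L vL)
    have "L2_inner \<Omega> (\<lambda>p. \<phi> p - u p) (\<lambda>p. \<phi> p - u p) = L2_inner UNIV (\<phi> - v) (\<phi> - v)"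
      unfolding L2_inner_def lebesgue_on_UNIV_eq
      by (intro integral_zext[OF \<Omega>L]) (simp_all add: v_def zext_def \<phi>0)
    then have dn: "L2.nrm (\<phi> - v) < \<epsilon>"
      using k by (simp add: \<phi>_def[symmetric] L2_nrm[symmetric] semi_inner.nrm_def[OF L2_semi_inner])
    obtain M where M: "\<And>p. cmod (\<phi> p) \<le> M" "M \<ge> 0" by (rule compact_support_bounded[OF c K(2,3)]) auto
    \<comment> \<open>Approach from above: dilations with \<open>s \<ge> 1\<close> do not increase
      the L2 norm, and \<open>s = 1\<close>, where \<open>B0\<close> is silent, is never
      attained.\<close>
    define s where "s k = 1 + inverse (real (Suc k))" for k
    have s1: "s k \<ge> 1" "s k \<noteq> 0" "s k > 0" "s k \<noteq> 1" for k
    proof -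
      have "inverse (real (Suc k)) > 0" by simp
      then show "s k \<ge> 1" "s k \<noteq> 0" "s k > 0" "s k \<noteq> 1" unfolding s_def by linarith+
    qed
    have sl: "s \<longlonglongrightarrow> 1" unfolding s_def using tendsto_add[OF tendsto_const LIMSEQ_inverse_real_of_nat, of 1] by simp
    have bound: "cmod (L2_inner UNIV \<phi> (\<lambda>p. \<phi> (dil (s k) p))) \<le> \<epsilon> * (L2.nrm \<phi> + L2.nrm v)" for k
    proof -
      note D = L2_dil[OF s1(2)[of k]]
      have nd: "L2.nrm (\<lambda>p. f (dil (s k) p)) \<le> L2.nrm f" if "f \<in> L2 UNIV" for f
        using L2_norm_dil[OF s1(1) that, of k] by (simp add: L2_nrm)
      have "L2_inner UNIV \<phi> (\<lambda>p. \<phi> (dil (s k) p)) = L2_inner UNIV (\<phi> - v) (\<lambda>p. \<phi> (dil (s k) p)) + L2_inner UNIV v (\<lambda>p. \<phi> (dil (s k) p))"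
        by (subst L2.ip_diff[OF \<phi>L vL D[OF \<phi>L]]) simp
      also have "L2_inner UNIV v (\<lambda>p. \<phi> (dil (s k) p)) = L2_inner UNIV v (\<lambda>p. (\<phi> - v) (dil (s k) p)) + B (s k)"
        using L2.ip_diff_right[OF D[OF \<phi>L] D[OF vL] vL] by (simp add: B_def fun_diff_def)
      also have "B (s k) = 0" by (rule B0[OF s1(3,4)])
      finally have e: "L2_inner UNIV \<phi> (\<lambda>p. \<phi> (dil (s k) p)) =
          L2_inner UNIV (\<phi> - v) (\<lambda>p. \<phi> (dil (s k) p)) + L2_inner UNIV v (\<lambda>p. (\<phi> - v) (dil (s k) p))"
        by (simp only: add_0_right)
      have "cmod (L2_inner UNIV \<phi> (\<lambda>p. \<phi> (dil (s k) p)))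
          \<le> cmod (L2_inner UNIV (\<phi> - v) (\<lambda>p. \<phi> (dil (s k) p))) + cmod (L2_inner UNIV v (\<lambda>p. (\<phi> - v) (dil (s k) p)))"
        unfolding e by (rule norm_triangle_ineq)
      also have "cmod (L2_inner UNIV (\<phi> - v) (\<lambda>p. \<phi> (dil (s k) p))) \<le> L2.nrm (\<phi> - v) * L2.nrm (\<lambda>p. \<phi> (dil (s k) p))"
        by (rule L2.cauchy_schwarz[OF dL D[OF \<phi>L]])
      also have "\<dots> \<le> \<epsilon> * L2.nrm \<phi>" using dn \<epsilon> nd[OF \<phi>L] D[OF \<phi>L] by (intro mult_mono) auto
      also have "cmod (L2_inner UNIV v (\<lambda>p. (\<phi> - v) (dil (s k) p))) \<le> L2.nrm v * L2.nrm (\<lambda>p. (\<phi> - v) (dil (s k) p))"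
        by (rule L2.cauchy_schwarz[OF vL D[OF dL]])
      also have "\<dots> \<le> L2.nrm v * \<epsilon>" using nd[OF dL] dn vL by (intro mult_left_mono) auto
      finally show ?thesis by (simp add: algebra_simps)
    qed
    have "(\<lambda>k. L2_inner UNIV \<phi> (\<lambda>p. \<phi> (dil (s k) p))) \<longlonglongrightarrow> L2_inner UNIV \<phi> \<phi>"
      unfolding L2_inner_def lebesgue_on_UNIV_eq
    proof (rule integral_dominated_convergence[where w = "\<lambda>p. M * cmod (\<phi> p)"])
      have il: "integrable lborel \<phi>" by (rule compact_support_integrable[OF c K(2,3)])
      then have "integrable lebesgue \<phi>" by (subst integrable_completion) (auto simp: borel_measurable_continuous_onI c)
      then show "integrable lebesgue (\<lambda>p. M * cmod (\<phi> p))" by simp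
      show "(\<lambda>p. \<phi> p * cnj (\<phi> p)) \<in> borel_measurable lebesgue"
        by (intro measurable_completion) (simp, intro borel_measurable_continuous_onI continuous_intros c)
      show "(\<lambda>p. \<phi> p * cnj (\<phi> (dil (s k) p))) \<in> borel_measurable lebesgue" for k
        by (intro measurable_completion) (simp, intro borel_measurable_continuous_onI continuous_intros c
            continuous_on_compose2[OF c linear_continuous_on[OF dil_linear]] subset_UNIV)
      show "AE p in lebesgue. norm (\<phi> p * cnj (\<phi> (dil (s k) p))) \<le> M * cmod (\<phi> p)" for k
      proof (rule AE_I2)
        fix p
        have "cmod (\<phi> p) * cmod (\<phi> (dil (s k) p)) \<le> cmod (\<phi> p) * M" by (intro mult_left_mono M) simp
        then show "norm (\<phi> p * cnj (\<phi> (dil (s k) p))) \<le> M * cmod (\<phi> p)"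
          by (simp only: norm_mult complex_mod_cnj mult.commute)
      qed
      show "AE p in lebesgue. (\<lambda>k. \<phi> p * cnj (\<phi> (dil (s k) p))) \<longlonglongrightarrow> \<phi> p * cnj (\<phi> p)"
      proof (rule AE_I2)
        fix p :: "'n heis"
        have "(\<lambda>k. dil (s k) p) \<longlonglongrightarrow> (1 *\<^sub>R fst p, 1 *\<^sub>R fst (snd p), 1\<^sup>2 * snd (snd p))"
          unfolding dil_def by (intro tendsto_intros sl)
        then have l: "(\<lambda>k. dil (s k) p) \<longlonglongrightarrow> p" by simp
        have "(\<lambda>k. \<phi> (dil (s k) p)) \<longlonglongrightarrow> \<phi> p" by (rule continuous_on_tendsto_compose[OF c l]) auto
        then show "(\<lambda>k. \<phi> p * cnj (\<phi> (dil (s k) p))) \<longlonglongrightarrow> \<phi> p * cnj (\<phi> p)" by (intro tendsto_intros)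
      qed
    qed
    then have "cmod (L2_inner UNIV \<phi> \<phi>) \<le> \<epsilon> * (L2.nrm \<phi> + L2.nrm v)"
      by (rule Lim_bounded[OF tendsto_norm, of _ _ 0]) (intro allI impI bound)
    then have 1: "(L2.nrm \<phi>)\<^sup>2 \<le> \<epsilon> * (L2.nrm \<phi> + L2.nrm v)"
      using complex_Re_le_cmod[of "L2_inner UNIV \<phi> \<phi>"] L2.nrm_sq[OF \<phi>L] by linarith
    have 2: "L2.nrm \<phi> \<le> L2.nrm v + \<epsilon>" using L2.nrm_le_add[OF \<phi>L vL] dn by linarith
    have 3: "L2.nrm v \<le> L2.nrm \<phi> + \<epsilon>" using L2.nrm_le_add[OF vL \<phi>L] L2.nrm_minus_commute[OF vL \<phi>L] dn by linarith
    have n: "0 \<le> L2.nrm v" "0 \<le> L2.nrm \<phi>" using vL \<phi>L by auto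
    have "(L2.nrm v)\<^sup>2 \<le> (L2.nrm \<phi> + \<epsilon>)\<^sup>2" using 3 n by (intro power_mono)
    also have "\<dots> = (L2.nrm \<phi>)\<^sup>2 + 2 * \<epsilon> * L2.nrm \<phi> + \<epsilon> * \<epsilon>" by (simp add: power2_eq_square algebra_simps)
    also have "\<dots> \<le> \<epsilon> * (L2.nrm \<phi> + L2.nrm v) + 2 * \<epsilon> * L2.nrm \<phi> + \<epsilon> * \<epsilon>" using 1 by simp
    also have "\<dots> = \<epsilon> * (3 * L2.nrm \<phi> + L2.nrm v + \<epsilon>)" by (simp add: algebra_simps)
    also have "\<dots> \<le> \<epsilon> * (4 * L2.nrm v + 4 * \<epsilon>)" using 2 \<epsilon> by (intro mult_left_mono) auto
    finally show ?thesis .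
  qed
  have "(\<lambda>k. inverse (real (Suc k)) * (4 * L2.nrm v + 4 * inverse (real (Suc k)))) \<longlonglongrightarrow> 0 * (4 * L2.nrm v + 4 * 0)"
    by (intro tendsto_intros LIMSEQ_inverse_real_of_nat)
  then have "(L2.nrm v)\<^sup>2 \<le> 0 * (4 * L2.nrm v + 4 * 0)"
    by (rule LIMSEQ_le_const) (intro exI allI impI small, simp)
  then have "L2.nrm v = 0" by simp
  moreover have "L2_inner \<Omega> u u = L2_inner UNIV v v"
    unfolding L2_inner_def lebesgue_on_UNIV_eq by (intro integral_zext[OF \<Omega>L]) (auto simp: v_def zext_def)
  ultimately show ?thesis by (simp add: L2_nrm[symmetric] semi_inner.nrm_def[OF L2_semi_inner])
qed

end

section \<open>Gaussian averages\<close>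

lemma lborel_integral_affine:
  fixes f :: "'a::euclidean_space \<Rightarrow> real"
  assumes f: "integrable lborel f" and c: "c \<noteq> 0"
  shows "integrable lborel (\<lambda>v. f (t + c *\<^sub>R v))"
    and "\<bar>c\<bar> ^ DIM('a) * (LINT v|lborel. f (t + c *\<^sub>R v)) = (LINT v|lborel. f v)"
proof -
  let ?D = "distr lborel borel (\<lambda>v. t + c *\<^sub>R v)"
  have fm [measurable]: "f \<in> borel_measurable borel" using f by auto
  have pos: "\<bar>c\<bar> ^ DIM('a) > 0" using c by simp
  have d: "(lborel :: 'a measure) = density ?D (\<lambda>_. ennreal (\<bar>c\<bar> ^ DIM('a)))"
    using lborel_affine[OF c, of t] by (simp add: ennreal_power)
  have "integrable (density ?D (\<lambda>_. ennreal (\<bar>c\<bar> ^ DIM('a)))) f" using f d by metis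
  then have "integrable ?D (\<lambda>v. \<bar>c\<bar> ^ DIM('a) *\<^sub>R f v)" using pos by (subst (asm) integrable_density) auto
  then have "integrable ?D f"
    using pos integrable_scaleR_right[of "inverse (\<bar>c\<bar> ^ DIM('a))" ?D "\<lambda>v. \<bar>c\<bar> ^ DIM('a) *\<^sub>R f v"] by simp
  then show "integrable lborel (\<lambda>v. f (t + c *\<^sub>R v))" by (subst (asm) integrable_distr_eq) auto
  have "(LINT v|lborel. f v) = (LINT v|density ?D (\<lambda>_. ennreal (\<bar>c\<bar> ^ DIM('a))). f v)" using d by metis
  also have "\<dots> = (LINT v|?D. \<bar>c\<bar> ^ DIM('a) *\<^sub>R f v)" using pos by (subst integral_density) auto
  also have "\<dots> = \<bar>c\<bar> ^ DIM('a) * (LINT v|lborel. f (t + c *\<^sub>R v))" by (subst integral_distr) auto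
  finally show "\<bar>c\<bar> ^ DIM('a) * (LINT v|lborel. f (t + c *\<^sub>R v)) = (LINT v|lborel. f v)" by simp
qed

lemma gaussian_integrable:
  assumes c: "c > 0"
  shows "integrable lborel (\<lambda>v::'a::euclidean_space. exp (- c * (norm v)\<^sup>2))"
proof -
  have 1: "integrable lborel (\<lambda>x::real. exp (- c * x\<^sup>2))"
  proof -
    \<comment> \<open>The standard deviation for which the normal density is a multiple of
      \<open>exp (- c x^2)\<close>.\<close>
    define \<sigma> where "\<sigma> = 1 / sqrt (2 * c)"
    have \<sigma>: "\<sigma> > 0" "2 * \<sigma>\<^sup>2 = 1 / c" using c by (auto simp: \<sigma>_def power_divide)
    define K where "K = 1 / sqrt (2 * pi * \<sigma>\<^sup>2)"
    have K: "K \<noteq> 0" using \<sigma>(1) by (simp add: K_def)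
    have "normal_density 0 \<sigma> x * (x - 0) ^ 0 = K * exp (- c * x\<^sup>2)" for x
      unfolding normal_density_def \<sigma>(2) K_def by (simp add: mult.commute)
    then have "integrable lborel (\<lambda>x. K * exp (- c * x\<^sup>2))"
      using integrable_normal_moment[OF \<sigma>(1), of 0 0] by simp
    then have "integrable lborel (\<lambda>x. (1 / K) * (K * exp (- c * x\<^sup>2)))" by (rule integrable_mult_right)
    then show ?thesis using K by simp
  qed
  have e: "ennreal (exp (- c * (norm v)\<^sup>2)) = (\<Prod>b\<in>Basis. ennreal (exp (- c * (v \<bullet> b)\<^sup>2)))" for v :: 'a
  proof -
    have "(norm v)\<^sup>2 = (\<Sum>b\<in>Basis. (v \<bullet> b)\<^sup>2)" by (simp add: norm_eq_sqrt_inner euclidean_inner[of v v] power2_eq_square sum_nonneg)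
    then have "exp (- c * (norm v)\<^sup>2) = (\<Prod>b\<in>Basis. exp (- c * (v \<bullet> b)\<^sup>2))"
      by (simp add: sum_distrib_left exp_sum[symmetric] sum_negf)
    then show ?thesis by (simp add: prod_ennreal)
  qed
  have "(\<integral>\<^sup>+v. ennreal (exp (- c * (norm v)\<^sup>2)) \<partial>(lborel :: 'a measure))
      = (\<Prod>b\<in>(Basis::'a set). \<integral>\<^sup>+x. ennreal (exp (- c * x\<^sup>2)) \<partial>lborel)"
    unfolding e by (rule nn_integral_lborel_prod) auto
  also have "\<dots> = ennreal (LINT x|lborel. exp (- c * x\<^sup>2)) ^ DIM('a)"
    using nn_integral_eq_integral[OF 1] by simp
  also have "\<dots> < \<infinity>" by (simp add: ennreal_power)
  finally show ?thesis by (intro integrableI_nonneg) auto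
qed

text \<open>The first bound trades the factor \<open>s\<close> for half of the decay and so
  preserves integrability; the second is a uniform bound, good enough on finite measures.\<close>

lemma times_exp_bound: "s * exp (- s) \<le> 2 * exp (- s / 2)" "s * exp (- s) \<le> 1" for s :: real
proof -
  have "s / 2 \<le> exp (s / 2)" using exp_ge_add_one_self[of "s/2"] by linarith
  then have "s * exp (- s) \<le> (2 * exp (s / 2)) * exp (- s)" by (intro mult_right_mono) auto
  also have "(2 * exp (s / 2)) * exp (- s) = 2 * exp (- s / 2)" by (simp add: mult.assoc exp_add[symmetric])
  finally show "s * exp (- s) \<le> 2 * exp (- s / 2)" .
  have "s \<le> exp s" using exp_ge_add_one_self[of s] by linarith
  then show "s * exp (- s) \<le> 1" by (simp add: exp_minus field_simps)
qed

lemma gaussian_moment_integrable: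
  assumes c: "c > 0"
  shows "integrable lborel (\<lambda>v::'a::euclidean_space. (norm v)\<^sup>2 * exp (- c * (norm v)\<^sup>2))"
proof (rule Bochner_Integration.integrable_bound)
  show "integrable lborel (\<lambda>v::'a. (2 / c) * exp (- (c / 2) * (norm v)\<^sup>2))"
    using c by (intro integrable_mult_right gaussian_integrable) simp
  show "AE v in lborel. norm ((norm v)\<^sup>2 * exp (- c * (norm v)\<^sup>2)) \<le> norm ((2 / c) * exp (- (c / 2) * (norm (v::'a))\<^sup>2))"
  proof (rule AE_I2)
    fix v :: 'a
    have "(1 / c) * ((c * (norm v)\<^sup>2) * exp (- (c * (norm v)\<^sup>2))) \<le> (1 / c) * (2 * exp (- (c * (norm v)\<^sup>2) / 2))"
      using c by (intro mult_left_mono times_exp_bound) auto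
    then show "norm ((norm v)\<^sup>2 * exp (- c * (norm v)\<^sup>2)) \<le> norm ((2 / c) * exp (- (c / 2) * (norm v)\<^sup>2))"
      using c by simp
  qed
qed simp

lemma gaussian_scaling:
  assumes c: "c > 0"
  shows "(LINT v|lborel. exp (- c * (norm (v::'a::euclidean_space))\<^sup>2))
    = c powr (- (real DIM('a) / 2)) * (LINT v|lborel. exp (- 1 * (norm (v::'a))\<^sup>2))"
proof -
  have "\<bar>sqrt c\<bar> ^ DIM('a) * (LINT v|lborel. exp (- 1 * (norm (0 + sqrt c *\<^sub>R (v::'a)))\<^sup>2)) = (LINT v|lborel. exp (- 1 * (norm (v::'a))\<^sup>2))"
    using c by (intro lborel_integral_affine(2) gaussian_integrable) auto
  then have "sqrt c ^ DIM('a) * (LINT v|lborel. exp (- c * (norm (v::'a))\<^sup>2)) = (LINT v|lborel. exp (- 1 * (norm (v::'a))\<^sup>2))"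
    using c by (simp add: power_mult_distrib)
  moreover have "sqrt c ^ DIM('a) = c powr (real DIM('a) / 2)"
    using c by (simp add: powr_half_sqrt[symmetric] powr_realpow[symmetric] powr_powr)
  ultimately have "c powr (- (real DIM('a) / 2)) * (LINT v|lborel. exp (- 1 * (norm (v::'a))\<^sup>2))
      = c powr (- (real DIM('a) / 2)) * (c powr (real DIM('a) / 2) * (LINT v|lborel. exp (- c * (norm (v::'a))\<^sup>2)))" by simp
  also have "\<dots> = (LINT v|lborel. exp (- c * (norm (v::'a))\<^sup>2))"
    using c by (simp add: mult.assoc[symmetric] powr_add[symmetric])
  finally show ?thesis by simp
qed

text \<open>By convexity of the exponential function \<open>t \<mapsto> \<integral> exp (- t \<bar>v\<bar>\<^sup>2)\<close> lies above its tangent at \<open>c\<close>, which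
  determines its derivative there without differentiating under the integral sign.\<close>

lemma gaussian_second_moment:
  assumes c: "c > 0"
  shows "c * (LINT v|lborel. (norm (v::'a::euclidean_space))\<^sup>2 * exp (- c * (norm v)\<^sup>2))
    = real DIM('a) / 2 * (LINT v|lborel. exp (- c * (norm (v::'a))\<^sup>2))"
proof -
  define I where "I t = (LINT v|lborel. exp (- t * (norm (v::'a))\<^sup>2))" for t
  define M where "M = (LINT v|lborel. (norm (v::'a))\<^sup>2 * exp (- c * (norm v)\<^sup>2))"
  \<comment> \<open>The integral minus its supporting line of slope \<open>- M\<close> at
    \<open>c\<close>, up to a constant. The scaling law has been inserted, so \<open>F\<close> can
    be differentiated explicitly, and its minimum at \<open>c\<close> yields
    \<open>M\<close>.\<close>
  define F where "F t = t powr (- (real DIM('a) / 2)) * I 1 + (t - c) * M" for t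
  have I: "I t = t powr (- (real DIM('a) / 2)) * I 1" if "t > 0" for t
    unfolding I_def by (rule gaussian_scaling[OF that])
  have "F c \<le> F t" if t: "t > 0" for t
  proof -
    have "(LINT v|lborel. exp (- c * (norm (v::'a))\<^sup>2)) \<le> (LINT v|lborel. exp (- t * (norm (v::'a))\<^sup>2) + (t - c) * ((norm v)\<^sup>2 * exp (- c * (norm v)\<^sup>2)))"
    proof (rule integral_mono)
      fix v :: 'a
      let ?s = "(norm v)\<^sup>2"
      have "exp (- c * ?s) * (1 + (c - t) * ?s) \<le> exp (- c * ?s) * exp ((c - t) * ?s)"
        using exp_ge_add_one_self[of "(c - t) * ?s"] by (intro mult_left_mono) auto
      also have "\<dots> = exp (- t * ?s)" by (simp add: exp_add[symmetric] algebra_simps)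
      finally show "exp (- c * ?s) \<le> exp (- t * ?s) + (t - c) * (?s * exp (- c * ?s))" by (simp add: algebra_simps)
    qed (intro Bochner_Integration.integrable_add integrable_mult_right gaussian_integrable gaussian_moment_integrable t c)+
    also have "\<dots> = I t + (t - c) * M"
      unfolding I_def M_def
      by (simp only: Bochner_Integration.integral_add integral_mult_right_zero integrable_mult_right
          gaussian_integrable[OF t] gaussian_moment_integrable[OF c])
    finally show ?thesis unfolding F_def using I[OF t] I[OF c] by (simp add: I_def)
  qed
  then have "\<forall>t. \<bar>c - t\<bar> < c \<longrightarrow> F c \<le> F t" by auto
  moreover have "(F has_real_derivative (- (real DIM('a) / 2) * c powr (- (real DIM('a) / 2) - 1)) * I 1 + M) (at c)"
    unfolding F_def using c by (auto intro!: derivative_eq_intros)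
  ultimately have "(- (real DIM('a) / 2) * c powr (- (real DIM('a) / 2) - 1)) * I 1 + M = 0"
    using DERIV_local_min c by blast
  then have "c * M = c * ((real DIM('a) / 2) * c powr (- (real DIM('a) / 2) - 1) * I 1)" by simp
  also have "\<dots> = (real DIM('a) / 2) * (c powr 1 * c powr (- (real DIM('a) / 2) - 1)) * I 1" using c by simp
  also have "\<dots> = (real DIM('a) / 2) * I c" using I[OF c] by (simp only: powr_add[symmetric]) simp
  finally show ?thesis by (simp add: M_def I_def)
qed

lemma gaussian_first_moment:
  assumes c: "c > 0"
  shows "integrable lborel (\<lambda>v::'a::euclidean_space. (z \<bullet> v) * exp (- c * (norm v)\<^sup>2))"
    and "(LINT v|lborel. (z \<bullet> v) * exp (- c * (norm (v::'a))\<^sup>2)) = 0"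
proof -
  show i: "integrable lborel (\<lambda>v::'a. (z \<bullet> v) * exp (- c * (norm v)\<^sup>2))"
  proof (rule Bochner_Integration.integrable_bound)
    show "integrable lborel (\<lambda>v::'a. norm z * (exp (- c * (norm v)\<^sup>2) + (norm v)\<^sup>2 * exp (- c * (norm v)\<^sup>2)))"
      by (intro integrable_mult_right Bochner_Integration.integrable_add gaussian_integrable gaussian_moment_integrable c)
    show "AE v in lborel. norm ((z \<bullet> v) * exp (- c * (norm v)\<^sup>2)) \<le> norm (norm z * (exp (- c * (norm v)\<^sup>2) + (norm (v::'a))\<^sup>2 * exp (- c * (norm v)\<^sup>2)))"
    proof (rule AE_I2)
      fix v :: 'a
      have "2 * norm v \<le> (norm v)\<^sup>2 + 1" using sum_squares_bound[of "norm v" 1] by simp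
      then have "norm v \<le> 1 + (norm v)\<^sup>2" using norm_ge_zero[of v] by linarith
      then have "\<bar>z \<bullet> v\<bar> \<le> norm z * (1 + (norm v)\<^sup>2)"
        using Cauchy_Schwarz_ineq2[of z v] mult_left_mono[of "norm v" "1 + (norm v)\<^sup>2" "norm z"] by simp
      then have "\<bar>z \<bullet> v\<bar> * exp (- c * (norm v)\<^sup>2) \<le> norm z * (1 + (norm v)\<^sup>2) * exp (- c * (norm v)\<^sup>2)" by (intro mult_right_mono) auto
      also have "\<dots> = norm z * (exp (- c * (norm v)\<^sup>2) + (norm v)\<^sup>2 * exp (- c * (norm v)\<^sup>2))" by (simp add: algebra_simps)
      also have "\<dots> \<le> \<bar>\<dots>\<bar>" by (rule abs_ge_self)
      finally show "norm ((z \<bullet> v) * exp (- c * (norm v)\<^sup>2)) \<le> norm (norm z * (exp (- c * (norm v)\<^sup>2) + (norm v)\<^sup>2 * exp (- c * (norm v)\<^sup>2)))"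
        by (simp add: abs_mult)
    qed
  qed simp
  show "(LINT v|lborel. (z \<bullet> v) * exp (- c * (norm (v::'a))\<^sup>2)) = 0"
    using lborel_integral_affine(2)[OF i, of "-1" 0] by simp
qed

text \<open>With d the dimension, \<open>4 a (a |v|^2 - d/2) exp (- a |v|^2)\<close> is the
  Laplacian of a Gaussian, and averaging is convolution with another Gaussian; so the profile is
  reproduced with a new parameter. Parameters combine by \<open>1/b = 1/a + 1/\<epsilon>\<close>,
  which is the origin of \<epsilon>.\<close>

lemma gaussian_average:
  fixes z :: "'a::euclidean_space"
  assumes b: "0 < b" "b < a"
  defines "\<epsilon> \<equiv> a * b / (a - b)"
  shows "\<exists>C>0. \<forall>z::'a. (LINT w|lborel. (a * (norm (z - w))\<^sup>2 - real DIM('a) / 2) * exp (- a * (norm (z - w))\<^sup>2) * exp (- \<epsilon> * (norm w)\<^sup>2))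
    = C * ((b * (norm z)\<^sup>2 - real DIM('a) / 2) * exp (- b * (norm z)\<^sup>2))"
proof -
  define c where "c = a + \<epsilon>"
  \<comment> \<open>The product of the two Gaussians in \<open>w\<close> is centred at
    \<open>(1 - \<beta>) z\<close> and decays with rate \<open>c\<close>. Shifting to this centre
    removes the linear term in the exponent because
    \<open>\<epsilon> (1 - \<beta>) = a \<beta>\<close>.\<close>
  define \<beta> where "\<beta> = b / a"
  have a: "a > 0" using b by simp
  have \<epsilon>: "\<epsilon> > 0" using b by (simp add: \<epsilon>_def)
  have c: "c > 0" using a \<epsilon> by (simp add: c_def)
  have c_eq: "c = a\<^sup>2 / (a - b)" using b by (simp add: c_def \<epsilon>_def field_simps power2_eq_square)
  have \<beta>1: "\<epsilon> * (1 - \<beta>) = a * \<beta>" using b by (simp add: \<epsilon>_def \<beta>_def field_simps)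
  have \<beta>2: "a * \<beta>\<^sup>2 + \<epsilon> * (1 - \<beta>)\<^sup>2 = b"
  proof -
    have "\<epsilon> * (1 - \<beta>)\<^sup>2 = a * \<beta> * (1 - \<beta>)" using \<beta>1 by (simp add: power2_eq_square mult.assoc[symmetric])
    then have "a * \<beta>\<^sup>2 + \<epsilon> * (1 - \<beta>)\<^sup>2 = a * \<beta>" by (simp add: algebra_simps power2_eq_square)
    then show ?thesis using a by (simp add: \<beta>_def)
  qed
  define I where "I = (LINT v|lborel. exp (- c * (norm (v::'a))\<^sup>2))"
  let ?d = "real DIM('a) / 2"
  have Ipos: "I > 0"
  proof -
    have "I \<noteq> 0"
    proof
      assume "I = 0"
      then have "AE v in (lborel::'a measure). exp (- c * (norm v)\<^sup>2) = 0"
        unfolding I_def by (intro integral_nonneg_eq_0_iff_AE[OF gaussian_integrable[OF c], THEN iffD1]) simp_all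
      then have "AE v in (lborel::'a measure). False" by simp
      then show False by (simp add: trivial_limit_def[symmetric] ae_filter_eq_bot_iff)
    qed
    moreover have "I \<ge> 0" unfolding I_def by simp
    ultimately show ?thesis by simp
  qed
  have "(LINT w|lborel. (a * (norm (z - w))\<^sup>2 - ?d) * exp (- a * (norm (z - w))\<^sup>2) * exp (- \<epsilon> * (norm w)\<^sup>2))
    = I * \<beta> * ((b * (norm z)\<^sup>2 - ?d) * exp (- b * (norm z)\<^sup>2))" for z :: 'a
  proof -
    let ?g = "\<lambda>w. (a * (norm (z - w))\<^sup>2 - ?d) * exp (- a * (norm (z - w))\<^sup>2) * exp (- \<epsilon> * (norm w)\<^sup>2)"
    let ?E = "\<lambda>v::'a. exp (- c * (norm v)\<^sup>2)"
    define h where "h v = exp (- b * (norm z)\<^sup>2) * ((a * \<beta>\<^sup>2 * (norm z)\<^sup>2 - ?d) * ?E v + (a * ((norm v)\<^sup>2 * ?E v) - 2 * a * \<beta> * ((z \<bullet> v) * ?E v)))" for v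
    have gh: "?g ((1 - \<beta>) *\<^sub>R z + 1 *\<^sub>R v) = h v" for v
    proof -
      have n1: "(norm (z - ((1 - \<beta>) *\<^sub>R z + 1 *\<^sub>R v)))\<^sup>2 = \<beta>\<^sup>2 * (norm z)\<^sup>2 - 2 * \<beta> * (z \<bullet> v) + (norm v)\<^sup>2"
      proof -
        have "z - ((1 - \<beta>) *\<^sub>R z + 1 *\<^sub>R v) = \<beta> *\<^sub>R z - v" by (simp add: algebra_simps)
        then show ?thesis unfolding power2_norm_eq_inner
          by (simp add: inner_diff_left inner_diff_right inner_commute[of v z] power2_eq_square algebra_simps)
      qed
      have n2: "(norm ((1 - \<beta>) *\<^sub>R z + 1 *\<^sub>R v))\<^sup>2 = (1 - \<beta>)\<^sup>2 * (norm z)\<^sup>2 + 2 * (1 - \<beta>) * (z \<bullet> v) + (norm v)\<^sup>2"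
        unfolding power2_norm_eq_inner
        by (simp add: inner_add_left inner_add_right inner_commute[of v z] power2_eq_square algebra_simps)
      have "- a * (\<beta>\<^sup>2 * (norm z)\<^sup>2 - 2 * \<beta> * (z \<bullet> v) + (norm v)\<^sup>2) + - \<epsilon> * ((1 - \<beta>)\<^sup>2 * (norm z)\<^sup>2 + 2 * (1 - \<beta>) * (z \<bullet> v) + (norm v)\<^sup>2)
          = - (a * \<beta>\<^sup>2 + \<epsilon> * (1 - \<beta>)\<^sup>2) * (norm z)\<^sup>2 + 2 * (a * \<beta> - \<epsilon> * (1 - \<beta>)) * (z \<bullet> v) - (a + \<epsilon>) * (norm v)\<^sup>2"
        by (simp add: algebra_simps)
      also have "\<dots> = - b * (norm z)\<^sup>2 + - c * (norm v)\<^sup>2" unfolding \<beta>1 \<beta>2 c_def by (simp add: algebra_simps)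
      finally have e: "exp (- a * (\<beta>\<^sup>2 * (norm z)\<^sup>2 - 2 * \<beta> * (z \<bullet> v) + (norm v)\<^sup>2)) * exp (- \<epsilon> * ((1 - \<beta>)\<^sup>2 * (norm z)\<^sup>2 + 2 * (1 - \<beta>) * (z \<bullet> v) + (norm v)\<^sup>2))
          = exp (- b * (norm z)\<^sup>2) * ?E v" by (simp only: exp_add[symmetric])
      have "?g ((1 - \<beta>) *\<^sub>R z + 1 *\<^sub>R v) = (a * (\<beta>\<^sup>2 * (norm z)\<^sup>2 - 2 * \<beta> * (z \<bullet> v) + (norm v)\<^sup>2) - ?d) * (exp (- b * (norm z)\<^sup>2) * ?E v)"
        unfolding n1 n2 e[symmetric] by (rule mult.assoc)
      also have "\<dots> = h v" unfolding h_def by (simp add: algebra_simps)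
      finally show ?thesis .
    qed
    have hi: "integrable lborel h"
      unfolding h_def by (intro integrable_mult_right Bochner_Integration.integrable_add Bochner_Integration.integrable_diff
          gaussian_integrable gaussian_moment_integrable gaussian_first_moment c)
    have gi: "integrable lborel ?g"
    proof -
      have "integrable lborel (\<lambda>w. h (- ((1 - \<beta>) *\<^sub>R z) + 1 *\<^sub>R w))" by (rule lborel_integral_affine(1)[OF hi]) simp
      also have "(\<lambda>w. h (- ((1 - \<beta>) *\<^sub>R z) + 1 *\<^sub>R w)) = ?g" by (simp only: gh[symmetric]) simp
      finally show ?thesis .
    qed
    have "(LINT w|lborel. ?g w) = (LINT v|lborel. h v)"
      using lborel_integral_affine(2)[OF gi, of 1 "(1 - \<beta>) *\<^sub>R z"] unfolding gh by simp
    also have "\<dots> = exp (- b * (norm z)\<^sup>2) * ((a * \<beta>\<^sup>2 * (norm z)\<^sup>2 - ?d) * I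
        + (a * (LINT v|lborel. (norm (v::'a))\<^sup>2 * ?E v) - 2 * a * \<beta> * (LINT v|lborel. (z \<bullet> v) * ?E v)))"
      unfolding h_def I_def
      by (simp only: integral_mult_right_zero Bochner_Integration.integral_add Bochner_Integration.integral_diff
          integrable_mult_right Bochner_Integration.integrable_diff gaussian_integrable[OF c] gaussian_moment_integrable[OF c] gaussian_first_moment(1)[OF c])
    also have "(LINT v|lborel. (z \<bullet> v) * ?E v) = 0" by (rule gaussian_first_moment(2)[OF c])
    also have "a * (LINT v|lborel. (norm (v::'a))\<^sup>2 * ?E v) = (a / c) * (?d * I)"
      using gaussian_second_moment[OF c, where 'a = 'a] c by (simp add: I_def field_simps)
    also have "a / c = 1 - \<beta>" using a b by (simp add: c_eq \<beta>_def field_simps power2_eq_square)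
    also have "exp (- b * (norm z)\<^sup>2) * ((a * \<beta>\<^sup>2 * (norm z)\<^sup>2 - ?d) * I + ((1 - \<beta>) * (?d * I) - 2 * a * \<beta> * 0))
        = I * \<beta> * ((a * \<beta> * (norm z)\<^sup>2 - ?d) * exp (- b * (norm z)\<^sup>2))"
      by (simp add: field_simps power2_eq_square)
    also have "a * \<beta> = b" using a by (simp add: \<beta>_def)
    finally show ?thesis .
  qed
  moreover have "I * \<beta> > 0" using Ipos a b by (simp add: \<beta>_def)
  ultimately show ?thesis by blast
qed

text \<open>If no centre gave a negative value, every Gaussian average over \<open>w\<close> would
  be non-negative too. By Fubini such an average is a positive multiple of the integral of the
  profile with a smaller parameter \<open>b\<close>, and for \<open>b \<rightarrow> 0\<close> this
  profile tends boundedly to minus half the dimension, whose integral over a finite measure of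
  positive mass is negative.\<close>

lemma negative_gaussian_integral:
  fixes Z :: "'b \<Rightarrow> 'a::euclidean_space"
  assumes M: "finite_measure M" "measure M (space M) > 0" and Z [measurable]: "Z \<in> borel_measurable M" and a: "a > 0"
  shows "\<exists>w. (LINT p|M. (a * (norm (Z p - w))\<^sup>2 - real DIM('a) / 2) * exp (- a * (norm (Z p - w))\<^sup>2)) < 0"
proof (rule ccontr)
  interpret finite_measure M by (rule M)
  let ?d = "real DIM('a) / 2"
  define G where "G c v = (c * (norm v)\<^sup>2 - ?d) * exp (- c * (norm v)\<^sup>2)" for c and v :: 'a
  have G_bound: "\<bar>G c v\<bar> \<le> 1 + ?d" if c: "c \<ge> 0" for c v
  proof -
    have "\<bar>G c v\<bar> \<le> (c * (norm v)\<^sup>2) * exp (- (c * (norm v)\<^sup>2)) + ?d * exp (- (c * (norm v)\<^sup>2))"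
      using c by (simp add: G_def left_diff_distrib abs_if)
    also have "\<dots> \<le> 1 + ?d * 1" using c by (intro add_mono times_exp_bound mult_left_mono) auto
    finally show ?thesis by simp
  qed
  have Gm [measurable]: "G c \<in> borel_measurable borel" for c unfolding G_def[abs_def] by measurable
  assume "\<not> ?thesis"
  then have neg: "(LINT p|M. G a (Z p - w)) \<ge> 0" for w by (auto simp: G_def not_less)
  \<comment> \<open>The double successor keeps \<open>b k\<close> strictly below \<open>a\<close>
    from \<open>k = 0\<close> on, as the denominator of \<epsilon> requires.\<close>
  define b where "b k = a * inverse (real (Suc (Suc k)))" for k :: nat
  have b: "0 < b k" "b k < a" for k
  proof -
    have "0 < inverse (real (Suc (Suc k)))" "inverse (real (Suc (Suc k))) < 1" by (simp_all add: field_simps)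
    then show "0 < b k" "b k < a" unfolding b_def using a by (auto intro: mult_pos_pos simp: mult_less_cancel_left2)
  qed
  have b0: "b \<longlonglongrightarrow> 0"
    unfolding b_def using tendsto_mult[OF tendsto_const LIMSEQ_Suc[OF LIMSEQ_inverse_real_of_nat], of a] by simp
  have "(\<lambda>k. LINT p|M. G (b k) (Z p)) \<longlonglongrightarrow> (LINT p|M. - ?d)"
  proof (rule integral_dominated_convergence)
    show "integrable M (\<lambda>p. 1 + ?d)" by simp
    show "AE p in M. norm (G (b k) (Z p)) \<le> 1 + ?d" for k using G_bound[OF less_imp_le[OF b(1)]] by simp
    show "AE p in M. (\<lambda>k. G (b k) (Z p)) \<longlonglongrightarrow> - ?d"
    proof (rule AE_I2)
      fix p
      have "(\<lambda>k. G (b k) (Z p)) \<longlonglongrightarrow> (0 * (norm (Z p))\<^sup>2 - ?d) * exp (- 0 * (norm (Z p))\<^sup>2)"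
        unfolding G_def by (intro tendsto_intros b0)
      then show "(\<lambda>k. G (b k) (Z p)) \<longlonglongrightarrow> - ?d" by simp
    qed
  qed measurable
  moreover have "(LINT p|M. - ?d) < 0" using M(2) by (simp add: mult_pos_pos)
  ultimately have "eventually (\<lambda>k. (LINT p|M. G (b k) (Z p)) < 0) sequentially" by (rule order_tendstoD(2))
  then obtain k where k: "(LINT p|M. G (b k) (Z p)) < 0" by (auto simp: eventually_sequentially)
  define \<epsilon> where "\<epsilon> = a * b k / (a - b k)"
  have \<epsilon>: "\<epsilon> > 0" using b[of k] a by (simp add: \<epsilon>_def)
  obtain C where C: "C > 0" "\<forall>z::'a. (LINT w|lborel. (a * (norm (z - w))\<^sup>2 - ?d) * exp (- a * (norm (z - w))\<^sup>2) * exp (- \<epsilon> * (norm w)\<^sup>2))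
    = C * ((b k * (norm z)\<^sup>2 - ?d) * exp (- b k * (norm z)\<^sup>2))"
    using gaussian_average[OF b[of k], where 'a = 'a] unfolding \<epsilon>_def by blast
  have C': "(LINT w|lborel. G a (z - w) * exp (- \<epsilon> * (norm w)\<^sup>2)) = C * G (b k) z" for z :: 'a
    using C(2) by (simp add: G_def)
  interpret pair_sigma_finite M "lborel :: 'a measure" ..
  let ?f = "\<lambda>(p, w). G a (Z p - w) * exp (- \<epsilon> * (norm w)\<^sup>2)"
  have fm: "?f \<in> borel_measurable (M \<Otimes>\<^sub>M lborel)" by measurable
  have fb: "norm (?f (p, w)) \<le> (1 + ?d) * exp (- \<epsilon> * (norm w)\<^sup>2)" for p w
    using G_bound[OF less_imp_le[OF a], of "Z p - w"] by (simp add: abs_mult mult_right_mono)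
  have ei: "integrable lborel (\<lambda>w::'a. (1 + ?d) * exp (- \<epsilon> * (norm w)\<^sup>2))" using \<epsilon> by (intro integrable_mult_right gaussian_integrable)
  have i2: "integrable lborel (\<lambda>w. ?f (p, w))" for p
  proof (rule Bochner_Integration.integrable_bound[OF ei])
    show "AE w in lborel. norm (?f (p, w)) \<le> norm ((1 + ?d) * exp (- \<epsilon> * (norm w)\<^sup>2))"
      using fb[of p] by (intro AE_I2) (simp add: order_trans[OF _ abs_ge_self])
  qed simp
  have "integrable (M \<Otimes>\<^sub>M lborel) ?f"
  proof (rule Fubini_integrable[OF fm])
    show "AE p in M. integrable lborel (\<lambda>w. ?f (p, w))" using i2 by (intro AE_I2)
    show "integrable M (\<lambda>p. LINT w|lborel. norm (?f (p, w)))"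
    proof (rule integrable_const_bound[where B = "LINT w|lborel. (1 + ?d) * exp (- \<epsilon> * (norm (w::'a))\<^sup>2)"])
      show "AE p in M. norm (LINT w|lborel. norm (?f (p, w))) \<le> (LINT w|lborel. (1 + ?d) * exp (- \<epsilon> * (norm (w::'a))\<^sup>2))"
      proof (rule AE_I2)
        fix p
        have "(LINT w|lborel. norm (?f (p, w))) \<le> (LINT w|lborel. (1 + ?d) * exp (- \<epsilon> * (norm (w::'a))\<^sup>2))"
          by (rule integral_mono[OF integrable_norm[OF i2] ei fb])
        then show "norm (LINT w|lborel. norm (?f (p, w))) \<le> (LINT w|lborel. (1 + ?d) * exp (- \<epsilon> * (norm (w::'a))\<^sup>2))"
          by simp
      qed
    qed (use fm in measurable)
  qed
  from Fubini_integral[OF this]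
  have "(LINT w|lborel. LINT p|M. ?f (p, w)) = (LINT p|M. LINT w|lborel. ?f (p, w))" by simp
  also have "\<dots> = C * (LINT p|M. G (b k) (Z p))" by (simp only: prod.case C' integral_mult_right_zero)
  also have "\<dots> < 0" using C(1) k by (simp add: mult_pos_neg)
  finally have "(LINT w|lborel. LINT p|M. ?f (p, w)) < 0" .
  moreover have "(LINT w|lborel. LINT p|M. ?f (p, w)) \<ge> 0"
  proof (rule integral_nonneg_AE, rule AE_I2)
    fix w :: 'a
    have "(LINT p|M. ?f (p, w)) = (LINT p|M. G a (Z p - w)) * exp (- \<epsilon> * (norm w)\<^sup>2)"
      unfolding prod.case by (rule integral_mult_left_zero)
    then show "0 \<le> (LINT p|M. ?f (p, w))" using neg[of w] by simp
  qed
  ultimately show False by simp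
qed

section \<open>A trial function in the lowest Landau level\<close>

definition horiz :: "'n::finite heis \<Rightarrow> (real ^ 'n) \<times> (real ^ 'n)" where
  "horiz p = (fst p, fst (snd p))"

text \<open>The complex conjugate of a coordinate of \<open>z - w\<close>, where
  \<open>z = x + \<i> y\<close>. The fields \<open>X_j\<close> and \<open>Y_j\<close> share it, so
  that sums over \<open>i\<close> count every coordinate twice.\<close>

definition zeta :: "(real ^ 'n) \<times> (real ^ 'n) \<Rightarrow> 'n::finite + 'n \<Rightarrow> 'n heis \<Rightarrow> complex" where
  "zeta w i p = (let j = (case i of Inl j \<Rightarrow> j | Inr j \<Rightarrow> j) in
     Complex (fst (horiz p - w) $ j) (- snd (horiz p - w) $ j))"

text \<open>The correction to t comes from the group law. The given fields are left-invariant for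
  the law whose last component is \<open>t + t' + 2 (y x' - x y')\<close>, and the imaginary part is
  \<tau> times the t-coordinate of \<open>(- w, 0)\<close> multiplied by \<open>p\<close>.\<close>

definition landau_exponent :: "real \<Rightarrow> (real ^ 'n) \<times> (real ^ 'n) \<Rightarrow> 'n::finite heis \<Rightarrow> complex" where
  "landau_exponent \<tau> w p = Complex (- \<tau> * ((horiz p - w) \<bullet> (horiz p - w)))
     (\<tau> * (snd (snd p) + 2 * (fst (snd p) \<bullet> fst w - fst p \<bullet> snd w)))"

text \<open>The translate by \<open>w\<close> of \<open>exp (- \<tau> \<bar>z\<bar>\<^sup>2 + \<i> \<tau> t)\<close>, which is annihilated by all \<open>X\<^sub>j + \<i> Y\<^sub>j\<close>.\<close>

definition landau :: "real \<Rightarrow> (real ^ 'n) \<times> (real ^ 'n) \<Rightarrow> 'n::finite heis \<Rightarrow> complex" where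
  "landau \<tau> w p = exp (landau_exponent \<tau> w p)"

definition landau_coeff :: "real \<Rightarrow> 'n + 'n \<Rightarrow> complex" where
  "landau_coeff \<tau> i = (case i of Inl j \<Rightarrow> of_real (- 2 * \<tau>) | Inr j \<Rightarrow> of_real (- 2 * \<tau>) * \<i>)"

lemma horiz_linear: "bounded_linear horiz"
  unfolding horiz_def[abs_def]
  by (intro bounded_linear_Pair bounded_linear_fst bounded_linear_fst[THEN bounded_linear_compose] bounded_linear_snd)

lemma horiz_has_derivative [derivative_intros]: "(horiz has_derivative horiz) F"
  by (rule bounded_linear_imp_has_derivative[OF horiz_linear])

lemma complex_has_derivative:
  "(f has_derivative f') F \<Longrightarrow> (g has_derivative g') F \<Longrightarrow>
    ((\<lambda>p. Complex (f p) (g p)) has_derivative (\<lambda>h. Complex (f' h) (g' h))) F"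
  unfolding Complex_eq by (intro has_derivative_add has_derivative_mult_right has_derivative_of_real)

lemma zeta_has_derivative:
  "(zeta w i has_derivative (\<lambda>h. zeta 0 i h)) (at p)"
proof -
  have c: "bounded_linear (\<lambda>v::real^'a. v $ j)" for j by (rule bounded_linear_vec_nth)
  show ?thesis
    unfolding zeta_def[abs_def] Let_def
    by (intro complex_has_derivative)
      (auto intro!: derivative_eq_intros bounded_linear.has_derivative[OF c])
qed

lemma landau_exponent_has_derivative:
  "(landau_exponent \<tau> w has_derivative (\<lambda>h. Complex (- 2 * \<tau> * ((horiz p - w) \<bullet> horiz h))
     (\<tau> * (snd (snd h) + 2 * (fst (snd h) \<bullet> fst w - fst h \<bullet> snd w))))) (at p)"
  unfolding landau_exponent_def[abs_def]
  by (intro complex_has_derivative) (auto intro!: derivative_eq_intros simp: inner_commute)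

lemma C_k_zeta: "C_k k (zeta w i)"
proof -
  let ?j = "case i of Inl j \<Rightarrow> j | Inr j \<Rightarrow> j"
  have "bounded_linear (\<lambda>p. of_real (fst p $ ?j) - \<i> * of_real (fst (snd p) $ ?j))"
    by (intro bounded_linear_sub bounded_linear_const_mult bounded_linear_of_real[THEN bounded_linear_compose]
        bounded_linear_vec_nth[THEN bounded_linear_compose] bounded_linear_fst
        bounded_linear_fst[THEN bounded_linear_compose] bounded_linear_snd)
  then have "C_k k (\<lambda>p. (of_real (fst p $ ?j) - \<i> * of_real (fst (snd p) $ ?j)) - (of_real (fst w $ ?j) - \<i> * of_real (snd w $ ?j)))"
    by (intro C_k_diff C_k_const C_k_linear)
  also have "(\<lambda>p. (of_real (fst p $ ?j) - \<i> * of_real (fst (snd p) $ ?j)) - (of_real (fst w $ ?j) - \<i> * of_real (snd w $ ?j))) = zeta w i"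
    by (auto simp: fun_eq_iff zeta_def horiz_def Let_def Complex_eq algebra_simps)
  finally show ?thesis .
qed

lemma sum_zeta: "(\<Sum>i\<in>UNIV. (cmod (zeta w i p))\<^sup>2) = 2 * (norm (horiz p - w))\<^sup>2"
proof -
  have v: "(norm v)\<^sup>2 = (\<Sum>j\<in>UNIV. (v $ j)\<^sup>2)" for v :: "real ^ 'n"
    unfolding power2_norm_eq_inner inner_vec_def by (simp add: power2_eq_square)
  have "(norm (horiz p - w))\<^sup>2 = (norm (fst (horiz p - w)))\<^sup>2 + (norm (snd (horiz p - w)))\<^sup>2"
    by (simp add: norm_prod_def)
  then show ?thesis
    by (simp add: sum_UNIV_Plus zeta_def cmod_power2 v sum.distrib power2_commute[of "snd w $ _"])
qed

lemma zeta_le: "(cmod (zeta w i p))\<^sup>2 \<le> 2 * (norm (horiz p - w))\<^sup>2"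
  unfolding sum_zeta[symmetric] by (rule member_le_sum) auto

lemma C_k_landau: "C_k k (landau \<tau> w)"
proof -
  have l: "bounded_linear (\<lambda>p::'a heis. snd (snd p) + 2 * (fst (snd p) \<bullet> fst w - fst p \<bullet> snd w))"
    by (intro bounded_linear_add bounded_linear_sub bounded_linear_const_mult bounded_linear_inner_left[THEN bounded_linear_compose]
        bounded_linear_fst bounded_linear_snd[THEN bounded_linear_compose] bounded_linear_fst[THEN bounded_linear_compose] bounded_linear_snd)
  \<comment> \<open>The squared distance is half of the sum of \<open>zeta * cnj zeta\<close>, an
    expression in functions already known to be smooth.\<close>
  have eq: "landau_exponent \<tau> w = (\<lambda>p. of_real (- \<tau> / 2) * (\<Sum>i\<in>UNIV. zeta w i p * cnj (zeta w i p))
      + of_real \<tau> * \<i> * of_real (snd (snd p) + 2 * (fst (snd p) \<bullet> fst w - fst p \<bullet> snd w)))"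
  proof
    fix p
    have "(\<Sum>i\<in>UNIV. zeta w i p * cnj (zeta w i p)) = of_real (2 * (norm (horiz p - w))\<^sup>2)"
      unfolding sum_zeta[symmetric] of_real_sum by (intro sum.cong refl) (simp only: complex_norm_square)
    then show "landau_exponent \<tau> w p = of_real (- \<tau> / 2) * (\<Sum>i\<in>UNIV. zeta w i p * cnj (zeta w i p))
      + of_real \<tau> * \<i> * of_real (snd (snd p) + 2 * (fst (snd p) \<bullet> fst w - fst p \<bullet> snd w))"
      by (simp add: landau_exponent_def complex_eq_iff power2_norm_eq_inner)
  qed
  have "C_k k (landau_exponent \<tau> w)"
    unfolding eq by (intro C_k_add C_k_mult C_k_sum C_k_zeta C_k_cnj C_k_const
        C_k_linear[OF bounded_linear_compose[OF bounded_linear_of_real l]])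
  then show ?thesis unfolding landau_def[abs_def] by (rule C_k_exp)
qed

text \<open>The coefficient of the t-derivative contributes a coordinate of the point and the phase
  correction that of \<open>w\<close>; the imaginary part thus becomes a coordinate of
  \<open>z - w\<close> and combines with the real part to a multiple of \<open>zeta\<close>.\<close>

lemma vf_landau: "vf i (landau \<tau> w) p = landau_coeff \<tau> i * (zeta w i p * landau \<tau> w p)"
proof -
  have "(landau \<tau> w has_derivative (\<lambda>h. exp (landau_exponent \<tau> w p) * Complex (- 2 * \<tau> * ((horiz p - w) \<bullet> horiz h))
     (\<tau> * (snd (snd h) + 2 * (fst (snd h) \<bullet> fst w - fst h \<bullet> snd w))))) (at p)"
    unfolding landau_def[abs_def]
    by (rule has_derivative_compose[OF landau_exponent_has_derivative DERIV_exp[unfolded has_field_derivative_def]])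
  note D = vf_has_derivative[OF this, of i]
  have factor: "E * A + c * (E * B) = L * (Z * E)" if "A + c * B = L * Z" for A B E c L Z :: complex
    using arg_cong[OF that, of "\<lambda>x. x * E"] by (simp add: algebra_simps)
  show ?thesis
  proof (cases i)
    case (Inl j)
    have "Complex (- 2 * \<tau> * ((horiz p - w) \<bullet> horiz (hdir i))) (\<tau> * (snd (snd (hdir i)) + 2 * (fst (snd (hdir i)) \<bullet> fst w - fst (hdir i) \<bullet> snd w)))
      + of_real (hcoef i p) * Complex (- 2 * \<tau> * ((horiz p - w) \<bullet> horiz vdir)) (\<tau> * (snd (snd vdir) + 2 * (fst (snd vdir) \<bullet> fst w - fst vdir \<bullet> snd w)))
      = landau_coeff \<tau> i * zeta w i p"
      by (simp add: Inl complex_eq_iff hdir_def vdir_def hcoef_def horiz_def landau_coeff_def zeta_def inner_prod_def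
          inner_axis inner_axis' algebra_simps)
    then show ?thesis unfolding D landau_def by (rule factor)
  next
    case (Inr j)
    have "Complex (- 2 * \<tau> * ((horiz p - w) \<bullet> horiz (hdir i))) (\<tau> * (snd (snd (hdir i)) + 2 * (fst (snd (hdir i)) \<bullet> fst w - fst (hdir i) \<bullet> snd w)))
      + of_real (hcoef i p) * Complex (- 2 * \<tau> * ((horiz p - w) \<bullet> horiz vdir)) (\<tau> * (snd (snd vdir) + 2 * (fst (snd vdir) \<bullet> fst w - fst vdir \<bullet> snd w)))
      = landau_coeff \<tau> i * zeta w i p"
      by (simp add: Inr complex_eq_iff hdir_def vdir_def hcoef_def horiz_def landau_coeff_def zeta_def inner_prod_def
          inner_axis inner_axis' algebra_simps)
    then show ?thesis unfolding D landau_def by (rule factor)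
  qed
qed

lemma vf_zeta: "vf i (zeta w i) p = (case i of Inl j \<Rightarrow> 1 | Inr j \<Rightarrow> - \<i>)"
  unfolding vf_has_derivative[OF zeta_has_derivative]
  by (cases i) (auto simp: zeta_def hdir_def vdir_def horiz_def complex_eq_iff axis_def)

lemma vf_vf_landau:
  "vf i (vf i (landau \<tau> w)) p = of_real (- 2 * \<tau>) * landau \<tau> w p + (landau_coeff \<tau> i)\<^sup>2 * ((zeta w i p)\<^sup>2 * landau \<tau> w p)"
proof -
  have d: "zeta w i differentiable (at p)" "landau \<tau> w differentiable (at p)" "(\<lambda>p. zeta w i p * landau \<tau> w p) differentiable (at p)"
    by (rule C_k_1D(1)[OF C_k_zeta] C_k_1D(1)[OF C_k_landau] C_k_1D(1)[OF C_k_mult[OF C_k_zeta C_k_landau]])+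
  have c: "vf i (\<lambda>p. landau_coeff \<tau> i) p = 0" by (simp add: vf_has_derivative[OF has_derivative_const])
  have "vf i (vf i (landau \<tau> w)) p = vf i (\<lambda>p. landau_coeff \<tau> i * (zeta w i p * landau \<tau> w p)) p"
    by (simp only: vf_landau[abs_def])
  also have "\<dots> = landau_coeff \<tau> i * (zeta w i p * (landau_coeff \<tau> i * (zeta w i p * landau \<tau> w p)) + vf i (zeta w i) p * landau \<tau> w p)"
    by (simp add: vf_mult[OF differentiable_const d(3)] vf_mult[OF d(1,2)] c vf_landau)
  also have "\<dots> = (landau_coeff \<tau> i * vf i (zeta w i) p) * landau \<tau> w p + (landau_coeff \<tau> i)\<^sup>2 * ((zeta w i p)\<^sup>2 * landau \<tau> w p)"
    by (simp add: algebra_simps power2_eq_square)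
  also have "landau_coeff \<tau> i * vf i (zeta w i) p = of_real (- 2 * \<tau>)"
    by (cases i) (auto simp: landau_coeff_def vf_zeta)
  finally show ?thesis .
qed

text \<open>The squares of \<open>landau_coeff\<close> are opposite for \<open>X_j\<close> and
  \<open>Y_j\<close>, which cancels the terms with \<open>zeta\<close> squared. The rest is
  \<open>- 2 \<tau>\<close> for each of the 2 n fields; this is why \<tau> is chosen as
  \<open>\<mu> / (4 n)\<close>.\<close>

lemma sum_vf_vf_landau:
  "(\<Sum>i\<in>UNIV. vf i (vf i (landau \<tau> w)) p) = - of_real (4 * real CARD('n) * \<tau>) * landau \<tau> (w :: (real ^ 'n::finite) \<times> _) p"
proof -
  have "(landau_coeff \<tau> (Inl j))\<^sup>2 * ((zeta w (Inl j) p)\<^sup>2 * landau \<tau> w p) + (landau_coeff \<tau> (Inr j))\<^sup>2 * ((zeta w (Inr j) p)\<^sup>2 * landau \<tau> w p) = 0" for j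
    by (simp add: landau_coeff_def zeta_def power_mult_distrib)
  then have "(\<Sum>i\<in>UNIV. (landau_coeff \<tau> i)\<^sup>2 * ((zeta w i p)\<^sup>2 * landau \<tau> w p)) = 0"
    unfolding sum_UNIV_Plus sum.distrib[symmetric] by simp
  moreover have "(\<Sum>i\<in>(UNIV :: ('n + 'n) set). of_real (- 2 * \<tau>) * landau \<tau> w p) = - of_real (4 * real CARD('n) * \<tau>) * landau \<tau> w p"
    unfolding sum_UNIV_Plus by (simp add: algebra_simps)
  ultimately show ?thesis unfolding vf_vf_landau sum.distrib by (simp only: add_0_right)
qed

lemma norm_landau: "cmod (landau \<tau> w p) = exp (- \<tau> * (norm (horiz p - w))\<^sup>2)"
  by (simp add: landau_def landau_exponent_def norm_exp_eq_Re power2_norm_eq_inner)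

lemma norm_landau_coeff: "\<tau> > 0 \<Longrightarrow> cmod (landau_coeff \<tau> i) = 2 * \<tau>"
  by (auto simp: landau_coeff_def norm_mult split: sum.split)

text \<open>The modulus does not decay in t and \<Omega> may be unbounded, so square-integrability
  of the trial function and its derivatives rests on boundedness and finite measure. The factors
  \<open>zeta\<close> are absorbed by the Gaussian decay in the horizontal variables.\<close>

lemma landau_bounded:
  assumes \<tau>: "\<tau> > 0"
  shows "cmod (landau \<tau> w p) \<le> 1" "(cmod (zeta w i p))\<^sup>2 * cmod (landau \<tau> w p) \<le> 2 / \<tau>"
    "cmod (zeta w i p) * cmod (landau \<tau> w p) \<le> 1 + 2 / \<tau>"
proof -
  let ?s = "(norm (horiz p - w))\<^sup>2"
  show 1: "cmod (landau \<tau> w p) \<le> 1" using \<tau> by (simp add: norm_landau)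
  have "(cmod (zeta w i p))\<^sup>2 * cmod (landau \<tau> w p) \<le> (2 * ?s) * cmod (landau \<tau> w p)"
    by (intro mult_right_mono zeta_le) simp
  also have "\<dots> = (2 / \<tau>) * ((\<tau> * ?s) * exp (- (\<tau> * ?s)))" using \<tau> by (simp add: norm_landau)
  also have "\<dots> \<le> (2 / \<tau>) * 1" using \<tau> by (intro mult_left_mono times_exp_bound) auto
  finally show 2: "(cmod (zeta w i p))\<^sup>2 * cmod (landau \<tau> w p) \<le> 2 / \<tau>" by simp
  have "2 * cmod (zeta w i p) \<le> (cmod (zeta w i p))\<^sup>2 + 1" using sum_squares_bound[of "cmod (zeta w i p)" 1] by simp
  then have "cmod (zeta w i p) \<le> 1 + (cmod (zeta w i p))\<^sup>2" using norm_ge_zero[of "zeta w i p"] by linarith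
  then have "cmod (zeta w i p) * cmod (landau \<tau> w p) \<le> (1 + (cmod (zeta w i p))\<^sup>2) * cmod (landau \<tau> w p)" by (intro mult_right_mono) auto
  then show "cmod (zeta w i p) * cmod (landau \<tau> w p) \<le> 1 + 2 / \<tau>" using 1 2 by (simp add: distrib_right)
qed

lemma L2_bounded_continuous:
  assumes "\<Omega> \<in> lmeasurable" "continuous_on UNIV e" "\<And>p. cmod (e p) \<le> B"
  shows "e \<in> L2 \<Omega>"
proof -
  interpret finite_measure "lebesgue_on \<Omega>" using assms(1) by (rule finite_measure_lebesgue_on)
  have "(\<lambda>p. 1) \<in> L2 \<Omega>" by (simp add: L2_def)
  from L2_bounded_mult[OF this assms(2,3)] show ?thesis by simp
qed

lemma trial_function:
  fixes \<Omega> :: "'n::finite heis set"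
  assumes \<Omega>: "open \<Omega>" and ne: "\<Omega> \<noteq> {}" and fin: "\<Omega> \<in> lmeasurable" and \<mu>: "\<mu> > 0"
  obtains U where "U \<in> S1 \<Omega>" "\<And>d. d \<in> S1_0 \<Omega> \<Longrightarrow> sub_form \<Omega> d U = of_real \<mu> * L2_inner \<Omega> d U"
    "Re (sub_form \<Omega> U U) < \<mu> * Re (L2_inner \<Omega> U U)"
proof -
  define \<tau> where "\<tau> = \<mu> / (4 * real CARD('n))"
  have \<tau>: "\<tau> > 0" "4 * real CARD('n) * \<tau> = \<mu>" using \<mu> by (simp_all add: \<tau>_def)
  interpret fm: finite_measure "lebesgue_on \<Omega>" using fin by (rule finite_measure_lebesgue_on)
  have pos: "measure (lebesgue_on \<Omega>) (space (lebesgue_on \<Omega>)) > 0"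
  proof -
    have "\<not> negligible \<Omega>" by (rule open_not_negligible[OF \<Omega> ne])
    then have "measure lebesgue \<Omega> \<noteq> 0" using fin by (simp add: negligible_iff_measure)
    then show ?thesis using fin by (simp add: measure_restrict_space less_le space_restrict_space)
  qed
  have hm: "horiz \<in> borel_measurable (lebesgue_on \<Omega>)"
    by (intro measurable_restrict_space1 measurable_completion) (simp add: borel_measurable_continuous_onI linear_continuous_on horiz_linear)
  have dim: "real DIM((real ^ 'n) \<times> (real ^ 'n)) / 2 = real CARD('n)" by simp
  \<comment> \<open>The rate is doubled to \<open>2 \<tau>\<close> because \<open>|U|^2\<close>
    enters; the constant n is half the dimension of the horizontal space.\<close>
  obtain w where w: "(LINT p|lebesgue_on \<Omega>. (2 * \<tau> * (norm (horiz p - w))\<^sup>2 - real CARD('n)) * exp (- (2 * \<tau>) * (norm (horiz p - w))\<^sup>2)) < 0"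
    using negative_gaussian_integral[OF fm.finite_measure_axioms pos hm, of "2 * \<tau>"] \<tau>(1) unfolding dim by auto
  define U where "U = landau \<tau> w"
  have UC: "C_k k U" for k unfolding U_def by (rule C_k_landau)
  have VC: "C_k k (vf i U)" for k i by (rule C_k_vf[OF UC])
  have UL: "U \<in> L2 \<Omega>" unfolding U_def
    by (rule L2_bounded_continuous[OF fin C_k_continuous[OF C_k_landau] landau_bounded(1)[OF \<tau>(1)]])
  have nV: "cmod (vf i U p) = 2 * \<tau> * (cmod (zeta w i p) * cmod (landau \<tau> w p))" for i p
    by (simp add: U_def vf_landau norm_mult norm_landau_coeff[OF \<tau>(1)])
  have VL: "vf i U \<in> L2 \<Omega>" for i
  proof (rule L2_bounded_continuous[OF fin C_k_continuous[OF VC]])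
    show "cmod (vf i U p) \<le> 2 * \<tau> * (1 + 2 / \<tau>)" for p
      unfolding nV using \<tau>(1) landau_bounded(3)[OF \<tau>(1), of w i p] by (intro mult_left_mono) auto
  qed
  have WL: "vf i (vf i U) \<in> L2 \<Omega>" for i
  proof (rule L2_bounded_continuous[OF fin C_k_continuous[OF C_k_vf[OF VC]]])
    fix p
    have "cmod (vf i (vf i U) p) \<le> cmod (of_real (- 2 * \<tau>) * landau \<tau> w p) + cmod ((landau_coeff \<tau> i)\<^sup>2 * ((zeta w i p)\<^sup>2 * landau \<tau> w p))"
      unfolding U_def vf_vf_landau by (rule norm_triangle_ineq)
    also have "\<dots> = 2 * \<tau> * cmod (landau \<tau> w p) + (2 * \<tau>)\<^sup>2 * ((cmod (zeta w i p))\<^sup>2 * cmod (landau \<tau> w p))"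
      using \<tau>(1) by (simp add: norm_mult norm_power norm_landau_coeff)
    also have "\<dots> \<le> 2 * \<tau> * 1 + (2 * \<tau>)\<^sup>2 * (2 / \<tau>)"
      by (intro add_mono mult_left_mono landau_bounded(1)[OF \<tau>(1)] landau_bounded(2)[OF \<tau>(1)]) (use \<tau>(1) in simp_all)
    finally show "cmod (vf i (vf i U) p) \<le> 2 * \<tau> * 1 + (2 * \<tau>)\<^sup>2 * (2 / \<tau>)" .
  qed
  have wk: "is_weak \<Omega> i U (vf i U)" for i by (rule is_weak_classical[OF \<Omega> UC VL])
  have US: "U \<in> S1 \<Omega>" by (rule S1I[OF UL wk])
  have 1: "sub_form \<Omega> d U = of_real \<mu> * L2_inner \<Omega> d U" if d: "d \<in> S1_0 \<Omega>" for d
  proof -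
    have dS: "d \<in> S1 \<Omega>" by (rule S1_0_S1[OF \<Omega> d])
    \<comment> \<open>The field is moved from \<open>d\<close> to \<open>U\<close>. Although
      \<open>U\<close> does not vanish at the boundary, no boundary term arises, since
      \<open>d\<close> lies in \<open>S1_0\<close>.\<close>
    have "L2_inner \<Omega> (weak \<Omega> i d) (vf i U) = - (LINT p|lebesgue_on \<Omega>. d p * cnj (vf i (vf i U) p))" for i
    proof -
      have e: "vf i (\<lambda>p. cnj (vf i U p)) = (\<lambda>p. cnj (vf i (vf i U) p))"
        by (intro ext vf_cnj C_k_1D(1)[OF VC])
      show ?thesis unfolding L2_inner_def
        by (subst S1_0_integration_by_parts[OF \<Omega> d C_k_cnj[OF VC]]) (simp_all add: e L2_cnj VL WL)
    qed
    then have "sub_form \<Omega> d U = - (\<Sum>i\<in>UNIV. LINT p|lebesgue_on \<Omega>. d p * cnj (vf i (vf i U) p))"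
      by (simp add: sub_form_weak[OF \<Omega> S1_weak[OF dS] wk S1_L2[OF dS] UL] sum_negf)
    also have "(\<Sum>i\<in>UNIV. LINT p|lebesgue_on \<Omega>. d p * cnj (vf i (vf i U) p)) = (LINT p|lebesgue_on \<Omega>. (\<Sum>i\<in>UNIV. d p * cnj (vf i (vf i U) p)))"
      by (intro Bochner_Integration.integral_sum[symmetric] L2_inner_integrable S1_L2[OF dS] WL)
    also have "(\<lambda>p. \<Sum>i\<in>UNIV. d p * cnj (vf i (vf i U) p)) = (\<lambda>p. - of_real \<mu> * (d p * cnj (U p)))"
    proof
      fix p
      have "(\<Sum>i\<in>UNIV. d p * cnj (vf i (vf i U) p)) = d p * cnj (\<Sum>i\<in>UNIV. vf i (vf i U) p)"
        by (simp add: sum_distrib_left)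
      then show "(\<Sum>i\<in>UNIV. d p * cnj (vf i (vf i U) p)) = - of_real \<mu> * (d p * cnj (U p))"
        unfolding U_def sum_vf_vf_landau \<tau>(2) by simp
    qed
    also have "- (LINT p|lebesgue_on \<Omega>. - of_real \<mu> * (d p * cnj (U p))) = of_real \<mu> * L2_inner \<Omega> d U"
      unfolding L2_inner_def by (subst integral_mult_right_zero) simp
    finally show ?thesis .
  qed
  have 2: "Re (sub_form \<Omega> U U) < \<mu> * Re (L2_inner \<Omega> U U)"
  proof -
    let ?r = "\<lambda>p. (norm (horiz p - w))\<^sup>2"
    have sq: "(cmod (landau \<tau> w p))\<^sup>2 = exp (- (2 * \<tau>) * ?r p)" for p
      unfolding norm_landau exp_of_nat_mult[symmetric] by (simp add: power2_eq_square exp_add[symmetric])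
    have iV: "integrable (lebesgue_on \<Omega>) (\<lambda>p. (cmod (vf i U p))\<^sup>2)" for i by (rule L2D(2)[OF VL])
    have iU: "integrable (lebesgue_on \<Omega>) (\<lambda>p. (cmod (U p))\<^sup>2)" by (rule L2D(2)[OF UL])
    have "Re (sub_form \<Omega> U U) = (\<Sum>i\<in>UNIV. LINT p|lebesgue_on \<Omega>. (cmod (vf i U p))\<^sup>2)"
      by (simp add: sub_form_weak[OF \<Omega> wk wk UL UL] L2_inner_self)
    also have "\<dots> = (LINT p|lebesgue_on \<Omega>. (\<Sum>i\<in>UNIV. (cmod (vf i U p))\<^sup>2))"
      by (rule Bochner_Integration.integral_sum[symmetric]) (rule iV)
    finally have "Re (sub_form \<Omega> U U) - \<mu> * Re (L2_inner \<Omega> U U)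
        = (LINT p|lebesgue_on \<Omega>. (\<Sum>i\<in>UNIV. (cmod (vf i U p))\<^sup>2) - \<mu> * (cmod (U p))\<^sup>2)"
      by (simp add: L2_inner_self iV iU)
    \<comment> \<open>With \<open>r = |z - w|^2\<close> the derivatives contribute
      \<open>8 \<tau>^2 r |U|^2\<close>, and \<open>\<mu> = 4 n \<tau>\<close> turns the difference
      into the Gaussian profile of rate \<open>2 \<tau>\<close> for which \<open>w\<close> was
      chosen.\<close>
    also have "\<dots> = (LINT p|lebesgue_on \<Omega>. 4 * \<tau> * ((2 * \<tau> * ?r p - real CARD('n)) * exp (- (2 * \<tau>) * ?r p)))"
    proof (rule Bochner_Integration.integral_cong[OF refl])
      fix p
      have "(\<Sum>i\<in>UNIV. (cmod (vf i U p))\<^sup>2) = (2 * \<tau>)\<^sup>2 * (2 * ?r p) * (cmod (landau \<tau> w p))\<^sup>2"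
        unfolding sum_zeta[symmetric] nV by (simp add: power_mult_distrib sum_distrib_left sum_distrib_right mult.assoc)
      then show "(\<Sum>i\<in>UNIV. (cmod (vf i U p))\<^sup>2) - \<mu> * (cmod (U p))\<^sup>2
          = 4 * \<tau> * ((2 * \<tau> * ?r p - real CARD('n)) * exp (- (2 * \<tau>) * ?r p))"
        unfolding U_def sq \<tau>(2)[symmetric] by (simp add: algebra_simps power2_eq_square)
    qed
    also have "\<dots> = 4 * \<tau> * (LINT p|lebesgue_on \<Omega>. (2 * \<tau> * ?r p - real CARD('n)) * exp (- (2 * \<tau>) * ?r p))"
      by (rule integral_mult_right_zero)
    also have "\<dots> < 0" using w \<tau>(1) by (simp add: mult_pos_neg)
    finally show ?thesis by simp
  qed
  show thesis by (rule that[OF US 1 2])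
qed

section \<open>Enumeration of the eigenvalues\<close>

text \<open>With more independent vectors than spanning ones, the homogeneous system for the
  coefficients would have a non-trivial solution. Applied in both directions this makes the
  dimension modulo null functions well defined.\<close>

lemma L2_has_dim_le:
  assumes "L2_has_dim \<Omega> E m" "L2_has_dim \<Omega> E m'"
  shows "m \<le> m'"
proof (rule ccontr)
  assume "\<not> m \<le> m'"
  obtain e where e: "\<And>i. i < m \<Longrightarrow> e i \<in> E"
    "\<And>c. (AE p in lebesgue_on \<Omega>. (\<Sum>i<m. c i * e i p) = 0) \<Longrightarrow> (\<forall>i<m. c i = 0)"
    using assms(1) unfolding L2_has_dim_def by blast
  obtain f where f: "\<And>u. u \<in> E \<Longrightarrow> \<exists>c. AE p in lebesgue_on \<Omega>. u p = (\<Sum>k<m'. c k * f k p)"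
    using assms(2) unfolding L2_has_dim_def by blast
  have "\<exists>A. \<forall>i. i < m \<longrightarrow> (AE p in lebesgue_on \<Omega>. e i p = (\<Sum>k<m'. A i k * f k p))"
    using f[OF e(1)] by (intro choice) blast
  then obtain A where A: "\<And>i. i < m \<Longrightarrow> AE p in lebesgue_on \<Omega>. e i p = (\<Sum>k<m'. A i k * f k p)" by blast
  obtain c :: "nat \<Rightarrow> complex" where c: "\<exists>i<m. c i \<noteq> 0" "\<forall>k<m'. (\<Sum>i<m. c i * A i k) = 0"
    using homogeneous_system_nontrivial[of m' m "\<lambda>k i. A i k"] \<open>\<not> m \<le> m'\<close> by auto
  have "AE p in lebesgue_on \<Omega>. \<forall>i\<in>{..<m}. e i p = (\<Sum>k<m'. A i k * f k p)"
    using A by (intro AE_finite_allI) auto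
  then have "AE p in lebesgue_on \<Omega>. (\<Sum>i<m. c i * e i p) = 0"
  proof eventually_elim
    case (elim p)
    then have "(\<Sum>i<m. c i * e i p) = (\<Sum>i<m. \<Sum>k<m'. c i * A i k * f k p)"
      by (simp add: sum_distrib_left mult.assoc)
    also have "\<dots> = (\<Sum>k<m'. (\<Sum>i<m. c i * A i k) * f k p)"
      by (subst sum.swap) (simp add: sum_distrib_right)
    finally show ?case using c(2) by simp
  qed
  then show False using e(2) c(1) by blast
qed

text \<open>At the first disagreement, say \<open>f k < g k\<close>, monotonicity confines the
  indices at which \<open>g\<close> takes the value \<open>f k\<close> to those below
  \<open>k\<close>, where the two agree; \<open>f\<close> takes it at \<open>k\<close> in addition.
  But both multiplicities are the dimension of the same eigenspace.\<close>

lemma eigenvalue_enumeration_unique: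
  assumes l: "eigenvalue_enumeration \<Omega> A l" and l': "eigenvalue_enumeration \<Omega> A l'" and "k \<ge> 1"
  shows "l k = l' k"
  using \<open>k \<ge> 1\<close>
proof (induction k rule: less_induct)
  case (less k)
  have le: "\<not> f k < g k" if f: "eigenvalue_enumeration \<Omega> A f" and g: "eigenvalue_enumeration \<Omega> A g"
    and eq: "\<And>i. i < k \<Longrightarrow> 1 \<le> i \<Longrightarrow> f i = g i" for f g
  proof
    assume lt: "f k < g k"
    let ?F = "{i. i \<ge> 1 \<and> f i = f k}" and ?G = "{i. i \<ge> 1 \<and> g i = f k}"
    have same: "card ?F = card ?G"
      using f g L2_has_dim_le unfolding eigenvalue_enumeration_def by (blast intro: antisym)
    have "finite ?F" using f by (simp add: eigenvalue_enumeration_def)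
    moreover have "?G \<subset> ?F"
    proof (rule psubsetI)
      show "?G \<subseteq> ?F"
      proof
        fix i assume i: "i \<in> ?G"
        have "i < k"
        proof (rule ccontr)
          assume "\<not> i < k"
          then have "g k \<le> g i" using g less.prems by (auto simp: eigenvalue_enumeration_def intro: mono_onD)
          then show False using i lt by simp
        qed
        then show "i \<in> ?F" using i eq by auto
      qed
      have "k \<in> ?F" "k \<notin> ?G" using less.prems lt by auto
      then show "?G \<noteq> ?F" by blast
    qed
    ultimately have "card ?G < card ?F" by (rule psubset_card_mono)
    then show False using same by simp
  qed
  have "\<not> l k < l' k" using less.IH by (intro le[OF l l']) auto
  moreover have "\<not> l' k < l k" using less.IH by (intro le[OF l' l]) auto
  ultimately show ?case by simp
qed

lemma eigval_eq: "eigenvalue_enumeration \<Omega> A l \<Longrightarrow> j \<ge> 1 \<Longrightarrow> eigval \<Omega> A j = l j"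
  unfolding eigval_def using eigenvalue_enumeration_unique by (intro the_equality) blast+

text \<open>Eigenvalues are counted from 1 and the eigenbasis from 0, hence the shift. The
  eigenspace has the required dimension because the vectors \<open>e k\<close> with
  \<open>l k = \<mu>\<close> are orthonormal and every eigenvector differs from its expansion in
  them by a null function.\<close>

lemma eigenvalue_enumeration_eigenbasis:
  assumes cf: "compact_form fscale V (L2_inner \<Omega>) (sub_form \<Omega>)" and V: "V \<subseteq> L2 \<Omega>"
    and b: "compact_form.eigenbasis V (L2_inner \<Omega>) (sub_form \<Omega>) e l"
  shows "eigenvalue_enumeration \<Omega> (form_operator \<Omega> (sub_form \<Omega>) V) (\<lambda>k. l (k - 1))"
proof -
  interpret compact_form fscale V "L2_inner \<Omega>" "sub_form \<Omega>" by (rule cf)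
  interpret L2: semi_inner fscale "L2 \<Omega>" "L2_inner \<Omega>" by (rule L2_semi_inner)
  have mono: "mono l" and ev: "eigenvector (l k) (e k)" and on: "L2_inner \<Omega> (e i) (e k) = (if i = k then 1 else 0)" for i k
    using b by (auto simp: eigenbasis_def)
  have eV: "e k \<in> V" for k using ev by (simp add: eigenvector_def)
  have space: "eigenspace (form_operator \<Omega> (sub_form \<Omega>) V) \<mu> = {u. eigenvector \<mu> u}" for \<mu>
    using V by (auto simp: eigenspace_def form_operator_def eigenvector_def L2_scale ip_scale subset_iff)
  note fin = eigenvalue_finite[OF b]
  have "L2_has_dim \<Omega> {u. eigenvector \<mu> u} (card {k. l k = \<mu>})" for \<mu>
  proof -
    define m where "m = card {k. l k = \<mu>}"
    obtain g where g: "bij_betw g {..<m} {k. l k = \<mu>}"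
      using ex_bij_betw_nat_finite[OF fin] by (auto simp: m_def atLeast0LessThan)
    have gl: "l (g i) = \<mu>" if "i < m" for i using bij_betwE[OF g] that by auto
    have gi: "g i = g k \<longleftrightarrow> i = k" if "i < m" "k < m" for i k
      using g that by (auto simp: bij_betw_def inj_on_def)
    define f where "f i = e (g i)" for i
    have fL: "f i \<in> L2 \<Omega>" for i using eV V by (auto simp: f_def)
    show "L2_has_dim \<Omega> {u. eigenvector \<mu> u} (card {k. l k = \<mu>})"
      unfolding L2_has_dim_def m_def[symmetric]
    proof (intro exI[of _ f] conjI allI impI ballI)
      fix i assume "i < m"
      then show "f i \<in> {u. eigenvector \<mu> u}" using ev[of "g i"] gl by (simp add: f_def)
    next
      fix c :: "nat \<Rightarrow> complex" and k
      assume z: "AE p in lebesgue_on \<Omega>. (\<Sum>i<m. c i * f i p) = 0" and k: "k < m"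
      have "L2_inner \<Omega> (\<Sum>i<m. fscale (c i) (f i)) (f k) = 0"
        unfolding L2_inner_def
        by (rule integral_eq_zero_AE) (use z in \<open>eventually_elim, simp add: sum_fun_apply\<close>)
      also have "L2_inner \<Omega> (\<Sum>i<m. fscale (c i) (f i)) (f k) = (\<Sum>i<m. c i * L2_inner \<Omega> (f i) (f k))"
        by (subst L2.ip_sum) (auto intro!: L2_scale fL simp: L2.ip_scale fL)
      also have "\<dots> = (\<Sum>i<m. if i = k then c i else 0)"
        using k by (intro sum.cong) (auto simp: f_def on gi)
      finally show "c k = 0" using k by simp
    next
      fix u assume "u \<in> {u. eigenvector \<mu> u}"
      then have u: "eigenvector \<mu> u" by simp
      then have uL: "u \<in> L2 \<Omega>" using V by (auto simp: eigenvector_def)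
      let ?s = "\<Sum>i<m. fscale (L2_inner \<Omega> u (f i)) (f i)"
      have "(\<Sum>k | l k = \<mu>. fscale (L2_inner \<Omega> u (e k)) (e k)) = ?s"
        unfolding f_def by (rule sum.reindex_bij_betw[OF g, symmetric])
      then have "L2_inner \<Omega> (u - ?s) (u - ?s) = 0" using eigenspace_expansion[OF b u] by simp
      then have "L2_norm \<Omega> (u - ?s) = 0" by (simp add: L2_nrm[symmetric] L2.nrm_def)
      then have "AE p in lebesgue_on \<Omega>. (u - ?s) p = 0"
        by (intro L2_norm_eq_0_iff[THEN iffD1] L2.V_diff uL L2.V_sum L2_scale fL)
      then have "AE p in lebesgue_on \<Omega>. u p = (\<Sum>i<m. L2_inner \<Omega> u (f i) * f i p)"
        by eventually_elim (simp add: sum_fun_apply)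
      then show "\<exists>c. AE p in lebesgue_on \<Omega>. u p = (\<Sum>i<m. c i * f i p)"
        by (rule exI[of _ "\<lambda>i. L2_inner \<Omega> u (f i)"])
    qed
  qed
  moreover have "{k. k \<ge> 1 \<and> l (k - 1) = \<mu>} = Suc ` {k. l k = \<mu>}" for \<mu>
  proof -
    have "k \<in> Suc ` {k. l k = \<mu>}" if "k \<ge> 1" "l (k - 1) = \<mu>" for k using that by (intro image_eqI[of _ _ "k - 1"]) auto
    then show ?thesis by auto
  qed
  ultimately show ?thesis
    using mono fin unfolding eigenvalue_enumeration_def space
    by (auto simp: card_image mono_on_def intro!: monoD[OF mono])
qed

section \<open>The inequality between Neumann and Dirichlet eigenvalues\<close>

theorem theorem3p4:
  fixes \<Omega> :: "'n::finite heis set"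
  assumes "open \<Omega>" and "connected \<Omega>" and "\<Omega> \<noteq> {}"
    and "\<Omega> \<in> lmeasurable"
    and "compact_embedding \<Omega>"
  shows "\<forall>j\<ge>1. eigval \<Omega> (neumann_sublaplacian \<Omega>) (j + 1)
               < eigval \<Omega> (dirichlet_sublaplacian \<Omega>) j"
proof (intro allI impI)
  fix j :: nat assume j: "j \<ge> 1"
  note \<Omega> = assms(1)
  have S1L: "S1 \<Omega> \<subseteq> L2 \<Omega>" and S0: "S1_0 \<Omega> \<subseteq> S1 \<Omega>" using S1_L2 S1_0_S1[OF \<Omega>] by blast+
  interpret N: compact_form fscale "S1 \<Omega>" "L2_inner \<Omega>" "sub_form \<Omega>"
    by (rule neumann_compact_form[OF \<Omega> assms(5,3)])
  interpret D: compact_form fscale "S1_0 \<Omega>" "L2_inner \<Omega>" "sub_form \<Omega>"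
    by (rule dirichlet_compact_form[OF \<Omega> assms(5,3)])
  obtain e l where N: "N.eigenbasis e l" using N.eigenbasis_exists by blast
  obtain d \<nu> where D: "D.eigenbasis d \<nu>" using D.eigenbasis_exists by blast
  \<comment> \<open>Both eigenbases are numbered from 0, so Neumann eigenvalue number j + 1 is
    \<open>l j\<close> and Dirichlet eigenvalue number j is \<open>\<nu> (j - 1)\<close>; the
    subtraction is genuine as \<open>j \<ge> 1\<close>.\<close>
  have evN: "eigval \<Omega> (neumann_sublaplacian \<Omega>) (j + 1) = l j"
    using eigval_eq[OF eigenvalue_enumeration_eigenbasis[OF N.compact_form_axioms S1L N], of "j + 1"]
    by (simp add: neumann_sublaplacian_def)
  have evD: "eigval \<Omega> (dirichlet_sublaplacian \<Omega>) j = \<nu> (j - 1)"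
    using eigval_eq[OF eigenvalue_enumeration_eigenbasis[OF D.compact_form_axioms order_trans[OF S0 S1L] D] j]
    by (simp add: dirichlet_sublaplacian_def)
  have dS0: "d i \<in> S1_0 \<Omega>" and on: "L2_inner \<Omega> (d i) (d k) = (if i = k then 1 else 0)"
    and dev: "D.eigenvector (\<nu> i) (d i)" for i k
    using D by (auto simp: D.eigenbasis_def D.eigenvector_def)
  have dS: "d i \<in> S1 \<Omega>" for i using dS0 S0 by blast
  have da: "sub_form \<Omega> (d i) v = of_real (\<nu> i) * L2_inner \<Omega> (d i) v" if "v \<in> S1_0 \<Omega>" for i v
    using dev that by (simp add: D.eigenvector_def)
  define \<mu> where "\<mu> = \<nu> (j - 1)"
  have \<mu>0: "\<mu> \<ge> 0" unfolding \<mu>_def by (rule D.eigenvalue_nonneg[OF dev]) (simp add: on)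
  \<comment> \<open>Positivity enters twice: the rate \<tau> of the trial function is a positive
    multiple of \<mu>, and the dilation argument ends with a division by \<mu>.\<close>
  have \<mu>: "\<mu> > 0"
  proof (rule ccontr)
    assume "\<not> \<mu> > 0"
    then have "Re (sub_form \<Omega> (d (j - 1)) (d (j - 1))) = 0" using \<mu>0 da[OF dS0, of "j - 1" "j - 1"] by (simp add: \<mu>_def)
    then have "(\<Sum>i\<in>UNIV. (L2_norm \<Omega> (weak \<Omega> i (d (j - 1))))\<^sup>2) = 0" by (simp add: Re_sub_form_self[OF \<Omega>])
    \<comment> \<open>One horizontal direction suffices; \<open>undefined\<close> names some
      index.\<close>
    then have "L2_norm \<Omega> (weak \<Omega> (Inl undefined) (d (j - 1))) = 0"
      by (subst (asm) sum_nonneg_eq_0_iff) auto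
    then have "L2_norm \<Omega> (d (j - 1)) = 0" by (rule S1_0_zero_derivative[OF \<Omega> dS0])
    then show False using on[of "j - 1" "j - 1"] by (simp add: L2_nrm[symmetric] N.nrm_def)
  qed
  obtain U where U: "U \<in> S1 \<Omega>" "\<And>d. d \<in> S1_0 \<Omega> \<Longrightarrow> sub_form \<Omega> d U = of_real \<mu> * L2_inner \<Omega> d U"
    "Re (sub_form \<Omega> U U) < \<mu> * Re (L2_inner \<Omega> U U)"
    by (rule trial_function[OF \<Omega> assms(3,4) \<mu>]) (rule that)
  show "eigval \<Omega> (neumann_sublaplacian \<Omega>) (j + 1) < eigval \<Omega> (dirichlet_sublaplacian \<Omega>) j"
  proof (rule ccontr)
    assume "\<not> ?thesis"
    then have lj: "\<mu> \<le> l j" unfolding evN evD \<mu>_def by simp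
    have "\<nu> i \<le> \<mu>" if "i < j" for i
      using D that unfolding \<mu>_def D.eigenbasis_def by (auto intro: monoD)
    then obtain c where c: "\<exists>i<j. c i \<noteq> 0" "N.eigenvector \<mu> (\<Sum>i<j. fscale (c i) (d i))"
      using N.eigenvalue_comparison[OF N dS on da[OF dS0] _ U(1) U(2)[OF dS0] U(3) lj] by blast
    define v where "v = (\<Sum>i<j. fscale (c i) (d i))"
    have v0: "v \<in> S1_0 \<Omega>" unfolding v_def by (intro D.V_sum D.V_scale dS0)
    \<comment> \<open>\<open>v\<close> lies in the Dirichlet form domain and satisfies the Neumann
      equation, so the dilation argument makes it a null function; orthonormality of the
      \<open>d i\<close> then forces all coefficients to vanish.\<close>
    have "L2_norm \<Omega> v = 0"
      using c(2) \<mu> by (intro dirichlet_neumann_zero[OF \<Omega> v0, of \<mu>]) (auto simp: N.eigenvector_def v_def)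
    then have z: "L2_inner \<Omega> v (d k) = 0" for k
      using N.cauchy_schwarz[of v "d k"] v0 S0 dS by (auto simp: L2_nrm)
    have "c k = 0" if k: "k < j" for k
    proof -
      have "L2_inner \<Omega> v (d k) = (\<Sum>i<j. c i * L2_inner \<Omega> (d i) (d k))"
        unfolding v_def by (subst N.ip_sum) (auto intro!: N.V_scale dS simp: N.ip_scale dS)
      also have "\<dots> = (\<Sum>i<j. if i = k then c i else 0)" by (intro sum.cong) (auto simp: on)
      finally show ?thesis using z k by simp
    qed
    then show False using c(1) by blast
  qed
qed

end
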